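(* Let $R$ be a local principal ideal ring of length two with maximal ideal $(\pi)$ and residue field $k$. Let $p\in k[t]$ be monic irreducible of degree $d$, $\lambda_1\ge\dots\ge\lambda_r\geq 1$ integers, $n=d(\lambda_1+\dots+\lambda_r)$, and let $\mathbf A\in M_n(R)$ have image $A=C_{p^{\lambda_1}}\oplus\dots\oplus C_{p^{\lambda_r}}$ in $M_n(k)$. Let $\mathbf p\in R[t]$ be a monic lift of $p$ and let $h_j\in R^n$ be the first standard basis vector of the $j$-th block (the block of size $d\lambda_j$), $1\le j\le r$. Let $\epsilon_{ij}\in R[t]$ ($1\le i,j\le r$) be polynomials satisfying $$\mathbf p(\mathbf A)^{\lambda_j}h_j=\sum_{i=1}^r \epsilon_{ij}(\mathbf A)\,\pi h_i\qquad(1\le j\le r).$$ If $\xi\in\mathrm{Ext}^1_{k[t]}(M^A,M^A)$ is such that $E(\xi)=(\epsilon_{ij})$ (coefficients of $\epsilon_{ij}$ being reduced modulo $\pi$), then $\mathbf A=\mathbf A_\xi$, where $\mathbf A_\xi$ is formed using $\mathbf A_0=C_{\mathbf p^{\lambda_1}}\oplus\dots\oplus C_{\mathbf p^{\lambda_r}}$.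
   Context: $C_f$ denotes the companion matrix of a monic polynomial $f$: the matrix of multiplication by $t$ on $k[t]/f$ (or $R[t]/f$) in the basis $1,t,\dots,t^{\deg f-1}$. $M^A$ is the $k[t]$-module $k^n$ with $t$ acting by $A$, so $M^A=k[t]/p^{\lambda_1}\oplus\dots\oplus k[t]/p^{\lambda_r}$, with generators $e_1,\dots,e_r$ (the images of $1$ in the summands); it is also an $R[t]$-module via $R[t]\to k[t]$. For $\mathbf B\in M_n(R)$, $M^{\mathbf B}$ is $R^n$ with $t$ acting by $\mathbf B$. Matrix of an extension: for a class $\xi$ of $0\to M^A\xrightarrow{i}M\xrightarrow{q}M^A\to0$ in $\mathrm{Ext}^1_{k[t]}(M^A,M^A)$, choose $\tilde f_j\in M$ with $q(\tilde f_j)=e_j$ and write $p^{\lambda_j}\tilde f_j=\sum_i\epsilon_{ij}\,i(e_i)$ with $\epsilon_{ij}\in k[t]$. Then $E(\xi)=(\epsilon_{ij})$, where $\epsilon_{ij}$ is well defined modulo $p^{\min(\lambda_i,\lambda_j)}$. The matrix $\mathbf A_\xi$: for a lift $\mathbf B\in M_n(R)$ of $A$, $\xi_{\mathbf B}\in\mathrm{Ext}^1_{R[t]}(M^A,M^A)$ is the class of $0\to M^A\xrightarrow{\pi}M^{\mathbf B}\to M^A\to0$ (first map $x\mapsto\pi\tilde x$ for any lift $\tilde x$ of $x$, second map reduction). Let $\iota:\mathrm{Ext}^1_{k[t]}(M^A,M^A)\to \mathrm{Ext}^1_{R[t]}(M^A,M^A)$ be the natural map. For $\xi\in\mathrm{Ext}^1_{k[t]}(M^A,M^A)$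 take an extension of $R[t]$-modules $0\to M^A\to E\to M^A\to0$ in the class $\iota(\xi)+\xi_{\mathbf A_0}$; $E$ is free of rank $n$ over $R$ and $\mathbf A_\xi$ is the matrix of multiplication by $t$ on $E$ in any $R$-basis lifting the standard basis of $M^A$. Thus $\mathbf A_\xi$ is defined only up to conjugation by $\ker(\mathrm{GL}_n(R)\to\mathrm{GL}_n(k))$, and $\mathbf A=\mathbf A_\xi$ means equality up to such conjugation. *)

theory Defs
  imports "HOL-Algebra.Ideal" "Jordan_Normal_Form.VS_Connect" "Jordan_Normal_Form.Char_Poly"
begin

hide_const (open) Polynomial.smult Multiset.mult
  Modules.module Modules.module_hom

section \<open>Local principal ideal rings of length two\<close>

text \<open>The length of a commutative ring as a module over itself, witnessed by a composition
  series of ideals (the value does not depend on the series, by Jordan--Hoelder).\<close>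

definition has_length :: "('a, 'b) ring_scheme \<Rightarrow> nat \<Rightarrow> bool" where
  "has_length R l \<longleftrightarrow> (\<exists>I :: nat \<Rightarrow> 'a set.
     I 0 = {\<zero>\<^bsub>R\<^esub>} \<and> I l = carrier R \<and> (\<forall>i\<le>l. ideal (I i) R) \<and>
     (\<forall>i<l. I i \<subset> I (Suc i) \<and> \<not> (\<exists>J. ideal J R \<and> I i \<subset> J \<and> J \<subset> I (Suc i))))"

definition local_pir_length_two :: "'r::comm_ring_1 \<Rightarrow> bool" where
  "local_pir_length_two \<pi> \<longleftrightarrow>
     {I. maximalideal I (class_ring :: 'r ring)} = {PIdl\<^bsub>class_ring\<^esub> \<pi>} \<and>
     (\<forall>I. ideal I (class_ring :: 'r ring) \<longrightarrow> principalideal I (class_ring :: 'r ring)) \<and>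
     has_length (class_ring :: 'r ring) 2"


section \<open>Matrices and the modules they define\<close>

text \<open>Matrix of multiplication by \<open>t\<close> on \<open>R[t]/f\<close> in the basis \<open>1, t, \<dots>, t\<^bsup>deg f - 1\<^esup>\<close>,
  for monic \<open>f\<close>: column \<open>j\<close> holds the coordinates of \<open>t \<cdot> t\<^bsup>j\<^esup>\<close>
  (see \<open>companion_mat_column\<close> below).\<close>

definition companion_mat :: "'a::comm_ring_1 poly \<Rightarrow> 'a mat" where
  "companion_mat f = mat (degree f) (degree f)
     (\<lambda>(i, j). if Suc j = degree f then - coeff f i else if i = Suc j then 1 else 0)"

lemma companion_mat_column:
  fixes f :: "'a::comm_ring_1 poly"
  assumes "monic f" and j: "j < degree f"
  shows "f dvd monom 1 1 * monom 1 j - (\<Sum>i<degree f. monom (companion_mat f $$ (i, j)) i)"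
proof (cases "Suc j = degree f")
  case True
  have "(\<Sum>i<degree f. monom (companion_mat f $$ (i, j)) i) = (\<Sum>i<degree f. - monom (coeff f i) i)"
    using True j by (intro sum.cong refl) (simp add: companion_mat_def minus_monom)
  moreover have "f = (\<Sum>i<degree f. monom (coeff f i) i) + monom 1 (degree f)"
    using poly_as_sum_of_monoms[of f] assms(1) by (simp flip: lessThan_Suc_atMost)
  ultimately have "monom 1 1 * monom 1 j - (\<Sum>i<degree f. monom (companion_mat f $$ (i, j)) i) = f"
    using True by (simp add: mult_monom sum_negf add.commute)
  then show ?thesis by simp
next
  case False
  have "(\<Sum>i<degree f. monom (companion_mat f $$ (i, j)) i)
      = (\<Sum>i<degree f. if i = Suc j then monom 1 (Suc j) else 0)"
    using False j by (intro sum.cong refl) (auto simp: companion_mat_def)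
  also have "\<dots> = monom 1 (Suc j)"
    using False j by (simp add: sum.delta)
  finally show ?thesis by (simp add: mult_monom)
qed

definition poly_mat :: "'a::comm_ring_1 poly \<Rightarrow> 'a mat \<Rightarrow> 'a mat" where
  "poly_mat f A = mat (dim_row A) (dim_row A)
     (\<lambda>ij. \<Sum>k\<le>degree f. coeff f k * (A ^\<^sub>m k) $$ ij)"

text \<open>\<open>M\<^bsup>A\<^esup>\<close>: column vectors, with \<open>t\<close> acting by the square matrix \<open>A\<close>.
  The fields \<open>mult\<close> and \<open>one\<close> of a module record play no role.\<close>

definition mat_module :: "'a::comm_ring_1 mat \<Rightarrow> ('a poly, 'a vec) module" where
  "mat_module A = \<lparr>carrier = carrier_vec (dim_row A), mult = undefined, one = undefined,
     zero = 0\<^sub>v (dim_row A), add = (+), smult = (\<lambda>f v. poly_mat f A *\<^sub>v v)\<rparr>"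

definition restrict_scalars :: "('s \<Rightarrow> 'a) \<Rightarrow> ('a, 'm) module \<Rightarrow> ('s, 'm) module" where
  "restrict_scalars \<phi> M = \<lparr>carrier = carrier M, mult = mult M, one = one M,
     zero = zero M, add = add M, smult = (\<lambda>s x. \<phi> s \<odot>\<^bsub>M\<^esub> x)\<rparr>"

definition quotient_module :: "('a, 'm) module \<Rightarrow> 'm set \<Rightarrow> ('a, 'm set) module" where
  "quotient_module M D = \<lparr>carrier = a_rcosets\<^bsub>M\<^esub> D, mult = undefined, one = undefined,
     zero = D, add = set_add M, smult = (\<lambda>r C. \<Union>x\<in>C. D +>\<^bsub>M\<^esub> (r \<odot>\<^bsub>M\<^esub> x))\<rparr>"

definition module_basis :: "nat \<Rightarrow> ('a::comm_ring_1, 'm) module \<Rightarrow> (nat \<Rightarrow> 'm) \<Rightarrow> bool" where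
  "module_basis n M b \<longleftrightarrow> (\<forall>i<n. b i \<in> carrier M) \<and>
     (\<forall>x\<in>carrier M. \<exists>!c. c \<in> carrier_vec n \<and> x = (\<Oplus>\<^bsub>M\<^esub>i\<in>{..<n}. (c $ i) \<odot>\<^bsub>M\<^esub> b i))"


section \<open>Extensions and \<open>Ext\<^sup>1\<close>\<close>

text \<open>Extensions \<open>0 \<rightarrow> N \<rightarrow> M \<rightarrow> Q \<rightarrow> 0\<close> of modules over the ring given by the type \<open>'a\<close>.\<close>

record ('a, 'n, 'm, 'q) extension =
  middle :: "('a, 'm) module"
  inc :: "'n \<Rightarrow> 'm"
  prj :: "'m \<Rightarrow> 'q"

definition is_extension ::
  "('a::comm_ring_1, 'n) module \<Rightarrow> ('a, 'q) module \<Rightarrow> ('a, 'n, 'm, 'q) extension \<Rightarrow> bool" where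
  "is_extension N Q X \<longleftrightarrow>
     module class_ring N \<and> module class_ring Q \<and> module class_ring (middle X) \<and>
     inc X \<in> module_hom class_ring N (middle X) \<and>
     prj X \<in> module_hom class_ring (middle X) Q \<and>
     inj_on (inc X) (carrier N) \<and>
     prj X ` carrier (middle X) = carrier Q \<and>
     inc X ` carrier N = {x \<in> carrier (middle X). prj X x = \<zero>\<^bsub>Q\<^esub>}"

definition ext_equiv ::
  "('a::comm_ring_1, 'n) module \<Rightarrow> ('a, 'n, 'm, 'q) extension \<Rightarrow> ('a, 'n, 'l, 'q) extension \<Rightarrow> bool" where
  "ext_equiv N X Y \<longleftrightarrow> (\<exists>\<phi> \<in> module_hom class_ring (middle X) (middle Y).
     bij_betw \<phi> (carrier (middle X)) (carrier (middle Y)) \<and>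
     (\<forall>a\<in>carrier N. \<phi> (inc X a) = inc Y a) \<and>
     (\<forall>x\<in>carrier (middle X). prj Y (\<phi> x) = prj X x))"

text \<open>As the middle module of an extension of \<open>Q\<close> by \<open>N\<close> is in bijection with \<open>N \<times> Q\<close>, every
  extension is equivalent to one with middle module inside the type \<open>'n \<times> 'q\<close>. The class of an
  extension is represented by the set of all such extensions equivalent to it; hence
  \<open>ext_class N Q X = ext_class N Q Y\<close> iff \<open>X\<close> and \<open>Y\<close> are equivalent, whatever the types of their
  middle modules.\<close>

definition ext_class ::
  "('a::comm_ring_1, 'n) module \<Rightarrow> ('a, 'q) module \<Rightarrow> ('a, 'n, 'm, 'q) extension
     \<Rightarrow> ('a, 'n, 'n \<times> 'q, 'q) extension set" where
  "ext_class N Q X = {Y. is_extension N Q Y \<and> ext_equiv N Y X}"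

definition Ext1 ::
  "('a::comm_ring_1, 'n) module \<Rightarrow> ('a, 'q) module \<Rightarrow> ('a, 'n, 'n \<times> 'q, 'q) extension set set" where
  "Ext1 N Q = ext_class N Q ` {X :: ('a, 'n, 'n \<times> 'q, 'q) extension. is_extension N Q X}"

text \<open>Baer sum: the pullback of \<open>M\<^sub>1\<close> and \<open>M\<^sub>2\<close> over \<open>Q\<close>, modulo \<open>{(i\<^sub>1 a, - i\<^sub>2 a) | a \<in> N}\<close>.\<close>

definition baer_sum ::
  "('a::comm_ring_1, 'n) module \<Rightarrow> ('a, 'n, 'm, 'q) extension \<Rightarrow> ('a, 'n, 'l, 'q) extension
     \<Rightarrow> ('a, 'n, ('m \<times> 'l) set, 'q) extension" where
  "baer_sum N X Y =
    (let P = direct_sum (middle X) (middle Y)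
           \<lparr>carrier := {z \<in> carrier (middle X) \<times> carrier (middle Y). prj X (fst z) = prj Y (snd z)}\<rparr>;
         D = {(inc X a, \<ominus>\<^bsub>middle Y\<^esub> inc Y a) | a. a \<in> carrier N}
     in \<lparr>middle = quotient_module P D,
         inc = (\<lambda>a. D +>\<^bsub>P\<^esub> (inc X a, \<zero>\<^bsub>middle Y\<^esub>)),
         prj = (\<lambda>C. prj X (fst (SOME z. z \<in> C)))\<rparr>)"

definition Ext_add ::
  "('a::comm_ring_1, 'n) module \<Rightarrow> ('a, 'q) module \<Rightarrow> ('a, 'n, 'n \<times> 'q, 'q) extension set
     \<Rightarrow> ('a, 'n, 'n \<times> 'q, 'q) extension set \<Rightarrow> ('a, 'n, 'n \<times> 'q, 'q) extension set" where
  "Ext_add N Q \<xi> \<eta> = (\<Union>X\<in>\<xi>. \<Union>Y\<in>\<eta>. ext_class N Q (baer_sum N X Y))"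

definition restrict_ext ::
  "('s \<Rightarrow> 'a) \<Rightarrow> ('a, 'n, 'm, 'q) extension \<Rightarrow> ('s, 'n, 'm, 'q) extension" where
  "restrict_ext \<phi> X = \<lparr>middle = restrict_scalars \<phi> (middle X), inc = inc X, prj = prj X\<rparr>"

text \<open>The map on \<open>Ext\<^sup>1\<close> induced by restriction of scalars along a ring homomorphism \<open>\<phi>\<close>.\<close>

definition Ext_restrict ::
  "('s::comm_ring_1 \<Rightarrow> 'a::comm_ring_1) \<Rightarrow> ('a, 'n) module \<Rightarrow> ('a, 'q) module
     \<Rightarrow> ('a, 'n, 'n \<times> 'q, 'q) extension set \<Rightarrow> ('s, 'n, 'n \<times> 'q, 'q) extension set" where
  "Ext_restrict \<phi> N Q \<xi> =
     (\<Union>X\<in>\<xi>. ext_class (restrict_scalars \<phi> N) (restrict_scalars \<phi> Q) (restrict_ext \<phi> X))"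


section \<open>The matrix of an extension and the matrix attached to a class\<close>

text \<open>\<open>E(\<xi>) = (\<epsilon>\<^sub>i\<^sub>j)\<close>, as an equality of entries modulo \<open>p\<^bsup>min(\<lambda>\<^sub>i,\<lambda>\<^sub>j)\<^esup>\<close>; \<open>e\<close> lists the
  generators of \<open>\<Oplus>\<^sub>i k[t]/p\<^bsup>\<lambda>\<^sub>i\<^esup>\<close>, and \<open>\<eta>\<close> is obtained from a choice of lifts \<open>f\<close> of the generators.
  Indices start at \<open>0\<close>.\<close>

definition has_ext_matrix ::
  "'k::field poly \<Rightarrow> nat list \<Rightarrow> (nat \<Rightarrow> 'n) \<Rightarrow> ('k poly, 'n, 'm, 'n) extension set
     \<Rightarrow> (nat \<Rightarrow> nat \<Rightarrow> 'k poly) \<Rightarrow> bool" where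
  "has_ext_matrix p lam e \<xi> \<epsilon> \<longleftrightarrow>
    (\<exists>X\<in>\<xi>. \<exists>f \<eta>.
       (\<forall>j<length lam. f j \<in> carrier (middle X) \<and> prj X (f j) = e j \<and>
          (p ^ (lam ! j)) \<odot>\<^bsub>middle X\<^esub> f j
            = (\<Oplus>\<^bsub>middle X\<^esub>i\<in>{..<length lam}. \<eta> i j \<odot>\<^bsub>middle X\<^esub> inc X (e i))) \<and>
       (\<forall>i<length lam. \<forall>j<length lam. p ^ min (lam ! i) (lam ! j) dvd \<epsilon> i j - \<eta> i j))"

text \<open>In the following \<open>\<rho> : R \<rightarrow> k\<close> is the residue map. The extension attached to a matrix
  \<open>B\<close> over \<open>R\<close>, of \<open>M\<^bsup>A\<^esup>\<close> by \<open>M\<^bsup>A\<^esup>\<close> where \<open>A\<close> is the image of \<open>B\<close> over \<open>k\<close>:\<close>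

definition lift_ext ::
  "'r::comm_ring_1 \<Rightarrow> ('r \<Rightarrow> 'k::field) \<Rightarrow> 'r mat \<Rightarrow> ('r poly, 'k vec, 'r vec, 'k vec) extension" where
  "lift_ext \<pi> \<rho> B = \<lparr>middle = mat_module B,
     inc = (\<lambda>x. \<pi> \<cdot>\<^sub>v (SOME y. y \<in> carrier_vec (dim_row B) \<and> map_vec \<rho> y = x)),
     prj = map_vec \<rho>\<rparr>"

text \<open>The set of all matrices that qualify as \<open>\<^bold>A\<^sub>\<xi>\<close>: matrices of \<open>t\<close> on some \<open>E\<close> in the class
  \<open>\<iota>(\<xi>) + \<xi>\<^bsub>\<^bold>A\<^sub>0\<^esub>\<close> with respect to some \<open>R\<close>-basis of \<open>E\<close> lifting the standard basis.\<close>

definition A_xi ::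
  "'r::comm_ring_1 \<Rightarrow> ('r \<Rightarrow> 'k::field) \<Rightarrow> 'r mat
     \<Rightarrow> ('k poly, 'k vec, 'k vec \<times> 'k vec, 'k vec) extension set \<Rightarrow> 'r mat set" where
  "A_xi \<pi> \<rho> A0 \<xi> =
    (let n = dim_row A0;
         M = mat_module (map_mat \<rho> A0);
         M' = restrict_scalars (map_poly \<rho>) M
     in {B \<in> carrier_mat n n.
          \<exists>E \<in> Ext_add M' M' (Ext_restrict (map_poly \<rho>) M M \<xi>) (ext_class M' M' (lift_ext \<pi> \<rho> A0)).
          \<exists>b. module_basis n (restrict_scalars (\<lambda>c. [:c:]) (middle E)) b \<and>
              (\<forall>j<n. prj E (b j) = unit_vec n j) \<and>
              (\<forall>j<n. [:0, 1:] \<odot>\<^bsub>middle E\<^esub> b j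
                 = (\<Oplus>\<^bsub>middle E\<^esub>i\<in>{..<n}. [:B $$ (i, j):] \<odot>\<^bsub>middle E\<^esub> b i))})"

text \<open>The orbit of \<open>A\<close> under conjugation by \<open>ker (GL\<^sub>n(R) \<rightarrow> GL\<^sub>n(k))\<close>.\<close>

definition kernel_conj_class :: "('r::comm_ring_1 \<Rightarrow> 'k::field) \<Rightarrow> 'r mat \<Rightarrow> 'r mat set" where
  "kernel_conj_class \<rho> A =
     {B. \<exists>P P'. similar_mat_wit B A P P' \<and> map_mat \<rho> P = 1\<^sub>m (dim_row A)}"

definition block_vec :: "nat \<Rightarrow> nat \<Rightarrow> nat list \<Rightarrow> nat \<Rightarrow> 'a::zero_neq_one vec" where
  \<comment> \<open>first standard basis vector of the block with index \<open>j\<close>; block \<open>i\<close> has size \<open>d * lam ! i\<close>\<close>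
  "block_vec n d lam j = unit_vec n (d * sum_list (take j lam))"

end

theory Submission
  imports Defs
begin

text \<open>Write \<open>\<xi>\<^sub>0\<close> for the class attached to \<open>A\<^sub>0\<close>. The matrix \<open>A\<close> and the class \<open>\<iota>(\<xi>) + \<xi>\<^sub>0\<close> both
  describe extensions of \<open>M\<close> by itself, where \<open>M\<close> is the \<open>R[t]\<close>-module of the residual matrix, and the
  theorem amounts to the equivalence of these extensions. Let \<open>e\<^sub>j\<close> be
  the generators of the cyclic summands of \<open>M\<close>. As an \<open>R[t]\<close>-module, \<open>M\<close> has only the relations \<open>\<pi> e\<^sub>j = 0\<close>
  and \<open>P\<^sub>j e\<^sub>j = 0\<close>, where \<open>P\<^sub>j\<close> is the power with exponent \<open>\<lambda>\<^sub>j\<close> of the monic lift of \<open>p\<close>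
  (\<open>residue_module_presentation\<close>). Choose lifts \<open>g\<^sub>j\<close> of the \<open>e\<^sub>j\<close> to an extension. Then \<open>P\<^sub>j g\<^sub>j\<close> and \<open>\<pi> g\<^sub>j\<close>
  come from vectors \<open>w\<^sub>j\<close> and \<open>u\<^sub>j\<close> of \<open>M\<close>, and these vectors determine the extension. Moreover, data
  add up when classes are added: an extension with data \<open>(w + w', u + u')\<close> is the Baer sum of two
  extensions with data \<open>(w, u)\<close> and \<open>(w', u')\<close> (\<open>ext_equiv_baer_sum\<close>).

  It remains to compare three sets of data. Put \<open>w\<^sub>j = \<Sum>\<^sub>i \<epsilon>\<^sub>i\<^sub>j e\<^sub>i\<close>.

  \<^item> For the restriction of \<open>\<xi>\<close> to \<open>R[t]\<close> they are \<open>(w, 0)\<close>: the first part is the meaning of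
    \<open>E(\<xi>) = (\<epsilon>\<^sub>i\<^sub>j)\<close>, after a change of the lifts (\<open>ext_matrix_imp_lifts\<close>), and \<open>\<pi>\<close> acts as zero.
  \<^item> For \<open>A\<^sub>0\<close> they are \<open>(0, e)\<close>: in \<open>R[t]/P\<^sub>j\<close> the generator is killed by \<open>P\<^sub>j\<close>
    (\<open>block_companion_annihilated\<close>), and \<open>\<pi> h\<^sub>j\<close> is the image of \<open>e\<^sub>j\<close> by definition of the inclusion.
  \<^item> For \<open>A\<close> they are \<open>(w, e)\<close>, the first part being the hypothesis on the \<open>\<epsilon>\<^sub>i\<^sub>j\<close>.

  So the extension of \<open>A\<close> lies in the class \<open>\<iota>(\<xi>) + \<xi>\<^sub>0\<close>. Finally, the matrices of \<open>t\<close> in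
  bases lifting the standard basis, on extensions equivalent to that of \<open>A\<close>, are the conjugates of
  \<open>A\<close> by matrices that reduce to the identity (\<open>matrices_in_lifted_bases\<close>).\<close>

section \<open>Modules over the ring of a type\<close>

text \<open>The scalars are all elements of a type, so the membership conditions on scalars in the
  module axioms are vacuous. This locale restates the axioms in the type-class operations.\<close>

locale cmodule =
  fixes M :: "('s::comm_ring_1, 'm) module" (structure)
  assumes is_module: "module class_ring M"

sublocale cmodule \<subseteq> abelian_group M
  using is_module by (rule Module.module.axioms(2))

context cmodule
begin

lemma smult_closed [simp, intro]: "x \<in> carrier M \<Longrightarrow> a \<odot> x \<in> carrier M"
  using module.smult_closed[OF is_module] by simp

lemma smult_l_distr: "x \<in> carrier M \<Longrightarrow> (a + b) \<odot> x = a \<odot> x \<oplus> b \<odot> x"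
  using module.smult_l_distr[OF is_module] by simp

lemma smult_r_distr: "x \<in> carrier M \<Longrightarrow> y \<in> carrier M \<Longrightarrow> a \<odot> (x \<oplus> y) = a \<odot> x \<oplus> a \<odot> y"
  using module.smult_r_distr[OF is_module] by simp

lemma smult_assoc: "x \<in> carrier M \<Longrightarrow> (a * b) \<odot> x = a \<odot> (b \<odot> x)"
  using module.smult_assoc1[OF is_module] by simp

lemma smult_one [simp]: "x \<in> carrier M \<Longrightarrow> 1 \<odot> x = x"
  using module.smult_one[OF is_module] by simp

lemma smult_l_null [simp]: "x \<in> carrier M \<Longrightarrow> 0 \<odot> x = \<zero>"
  using module.smult_l_null[OF is_module] by simp

lemma smult_r_null [simp]: "a \<odot> \<zero> = \<zero>"
  using module.smult_r_null[OF is_module] by simp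

lemma minus_zero [simp]: "\<ominus> \<zero> = \<zero>"
  by (rule minus_equality) simp_all

lemma smult_l_minus: "x \<in> carrier M \<Longrightarrow> (- a) \<odot> x = \<ominus> (a \<odot> x)"
  by (rule minus_equality[symmetric]) (simp_all flip: smult_l_distr)

end

lemma module_class_ringI:
  fixes M :: "('s::comm_ring_1, 'm) module" (structure)
  assumes "abelian_group M"
    and "\<And>a x. x \<in> carrier M \<Longrightarrow> a \<odot> x \<in> carrier M"
    and "\<And>a b x. x \<in> carrier M \<Longrightarrow> (a + b) \<odot> x = a \<odot> x \<oplus> b \<odot> x"
    and "\<And>a x y. x \<in> carrier M \<Longrightarrow> y \<in> carrier M \<Longrightarrow> a \<odot> (x \<oplus> y) = a \<odot> x \<oplus> a \<odot> y"
    and "\<And>a b x. x \<in> carrier M \<Longrightarrow> (a * b) \<odot> x = a \<odot> (b \<odot> x)"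
    and "\<And>x. x \<in> carrier M \<Longrightarrow> 1 \<odot> x = x"
  shows "module class_ring M"
  by (intro moduleI class_cring.cring_axioms) (simp_all add: assms)

lemma module_homI:
  assumes "\<And>x. x \<in> carrier M \<Longrightarrow> f x \<in> carrier N"
    and "\<And>x y. x \<in> carrier M \<Longrightarrow> y \<in> carrier M \<Longrightarrow> f (x \<oplus>\<^bsub>M\<^esub> y) = f x \<oplus>\<^bsub>N\<^esub> f y"
    and "\<And>x r. x \<in> carrier M \<Longrightarrow> f (r \<odot>\<^bsub>M\<^esub> x) = r \<odot>\<^bsub>N\<^esub> f x"
  shows "f \<in> module_hom class_ring M N"
  using assms by (simp add: LinearCombinations.module_hom_def)

definition lin_comb :: "('s, 'm) module \<Rightarrow> nat \<Rightarrow> (nat \<Rightarrow> 'm) \<Rightarrow> (nat \<Rightarrow> 's) \<Rightarrow> 'm" where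
  "lin_comb M r g a = (\<Oplus>\<^bsub>M\<^esub>i\<in>{..<r}. a i \<odot>\<^bsub>M\<^esub> g i)"

context cmodule
begin

lemma lin_comb_0 [simp]: "lin_comb M 0 g a = \<zero>"
  by (simp add: lin_comb_def)

lemma lin_comb_Suc:
  assumes "\<And>i. i < Suc r \<Longrightarrow> g i \<in> carrier M"
  shows "lin_comb M (Suc r) g a = a r \<odot> g r \<oplus> lin_comb M r g a"
  using assms unfolding lin_comb_def lessThan_Suc by (subst finsum_insert) auto

lemma lin_comb_cong:
  assumes "\<And>i. i < r \<Longrightarrow> g i \<in> carrier M"
    and "\<And>i. i < r \<Longrightarrow> a i \<odot> g i = b i \<odot> h i"
  shows "lin_comb M r g a = lin_comb M r h b"
proof -
  have "b i \<odot> h i \<in> carrier M" if "i < r" for i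
    using assms that by (metis smult_closed)
  then show ?thesis
    unfolding lin_comb_def by (intro finsum_cong') (auto simp: assms)
qed

lemma lin_comb_closed [simp, intro]:
  assumes "\<And>i. i < r \<Longrightarrow> g i \<in> carrier M"
  shows "lin_comb M r g a \<in> carrier M"
  using assms unfolding lin_comb_def by (intro finsum_closed) auto

lemma lin_comb_zero:
  assumes "\<And>i. i < r \<Longrightarrow> g i \<in> carrier M"
  shows "lin_comb M r g (\<lambda>_. 0) = \<zero>"
  using assms by (induction r) (simp_all add: lin_comb_Suc)

lemma lin_comb_add:
  assumes "\<And>i. i < r \<Longrightarrow> g i \<in> carrier M"
  shows "lin_comb M r g (\<lambda>i. a i + b i) = lin_comb M r g a \<oplus> lin_comb M r g b"
  using assms
proof (induction r)
  case (Suc r)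
  then have "lin_comb M r g a \<in> carrier M" "lin_comb M r g b \<in> carrier M" "g r \<in> carrier M"
    by auto
  with Suc show ?case by (simp add: lin_comb_Suc smult_l_distr a_ac)
qed simp

lemma lin_comb_add_right:
  assumes "\<And>i. i < r \<Longrightarrow> g i \<in> carrier M" "\<And>i. i < r \<Longrightarrow> h i \<in> carrier M"
  shows "lin_comb M r (\<lambda>i. g i \<oplus> h i) a = lin_comb M r g a \<oplus> lin_comb M r h a"
  using assms
proof (induction r)
  case (Suc r)
  then have "lin_comb M r g a \<in> carrier M" "lin_comb M r h a \<in> carrier M"
    "g r \<in> carrier M" "h r \<in> carrier M"
    by auto
  with Suc show ?case by (simp add: lin_comb_Suc smult_r_distr a_ac)
qed simp

lemma lin_comb_smult:
  assumes "\<And>i. i < r \<Longrightarrow> g i \<in> carrier M"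
  shows "lin_comb M r g (\<lambda>i. s * a i) = s \<odot> lin_comb M r g a"
  using assms
proof (induction r)
  case (Suc r)
  then show ?case by (simp add: lin_comb_Suc smult_assoc smult_r_distr)
qed simp

end

locale cmodule_hom = M: cmodule M + N: cmodule N
  for M :: "('s::comm_ring_1, 'm) module" and N :: "('s, 'n) module" and h :: "'m \<Rightarrow> 'n" +
  assumes hom: "h \<in> module_hom class_ring M N"
begin

lemma closed [simp, intro]: "x \<in> carrier M \<Longrightarrow> h x \<in> carrier N"
  using LinearCombinations.module_hom_closed[OF hom] by auto

lemma add: "x \<in> carrier M \<Longrightarrow> y \<in> carrier M \<Longrightarrow> h (x \<oplus>\<^bsub>M\<^esub> y) = h x \<oplus>\<^bsub>N\<^esub> h y"
  by (rule LinearCombinations.module_hom_add[OF hom])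

lemma smult: "x \<in> carrier M \<Longrightarrow> h (a \<odot>\<^bsub>M\<^esub> x) = a \<odot>\<^bsub>N\<^esub> h x"
  using LinearCombinations.module_hom_smult[OF hom] by simp

lemma zero [simp]: "h \<zero>\<^bsub>M\<^esub> = \<zero>\<^bsub>N\<^esub>"
  using smult[of "\<zero>\<^bsub>M\<^esub>" 0] by simp

lemma uminus: "x \<in> carrier M \<Longrightarrow> h (\<ominus>\<^bsub>M\<^esub> x) = \<ominus>\<^bsub>N\<^esub> h x"
  using smult[of x "-1"] by (simp add: M.smult_l_minus N.smult_l_minus)

lemma lin_comb:
  assumes "\<And>i. i < r \<Longrightarrow> g i \<in> carrier M"
  shows "h (lin_comb M r g a) = lin_comb N r (\<lambda>i. h (g i)) a"
  using assms
proof (induction r)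
  case (Suc r)
  then show ?case by (simp add: M.lin_comb_Suc N.lin_comb_Suc add smult)
qed simp

end

section \<open>Extensions and their equivalence\<close>

locale cext =
  fixes N :: "('s::comm_ring_1, 'n) module" and Q :: "('s, 'q) module"
    and X :: "('s, 'n, 'm, 'q) extension"
  assumes is_ext: "is_extension N Q X"

sublocale cext \<subseteq> N: cmodule N
  by (rule cmodule.intro) (use is_ext in \<open>simp add: is_extension_def\<close>)
sublocale cext \<subseteq> Q: cmodule Q
  by (rule cmodule.intro) (use is_ext in \<open>simp add: is_extension_def\<close>)
sublocale cext \<subseteq> M: cmodule "middle X"
  by (rule cmodule.intro) (use is_ext in \<open>simp add: is_extension_def\<close>)
sublocale cext \<subseteq> inc: cmodule_hom N "middle X" "inc X"
  by (intro cmodule_hom.intro cmodule_hom_axioms.intro N.cmodule_axioms M.cmodule_axioms)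
    (use is_ext in \<open>simp add: is_extension_def\<close>)
sublocale cext \<subseteq> prj: cmodule_hom "middle X" Q "prj X"
  by (intro cmodule_hom.intro cmodule_hom_axioms.intro Q.cmodule_axioms M.cmodule_axioms)
    (use is_ext in \<open>simp add: is_extension_def\<close>)

context cext
begin

lemma inc_inj: "a \<in> carrier N \<Longrightarrow> b \<in> carrier N \<Longrightarrow> inc X a = inc X b \<Longrightarrow> a = b"
proof -
  assume "a \<in> carrier N" "b \<in> carrier N" "inc X a = inc X b"
  moreover have "inj_on (inc X) (carrier N)" using is_ext by (simp add: is_extension_def)
  ultimately show "a = b" by (simp add: inj_on_def)
qed

lemma inc_eq_zero: "a \<in> carrier N \<Longrightarrow> inc X a = \<zero>\<^bsub>middle X\<^esub> \<Longrightarrow> a = \<zero>\<^bsub>N\<^esub>"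
  using inc_inj[of a "\<zero>\<^bsub>N\<^esub>"] by simp

lemma prj_inc [simp]: "a \<in> carrier N \<Longrightarrow> prj X (inc X a) = \<zero>\<^bsub>Q\<^esub>"
proof -
  assume "a \<in> carrier N"
  moreover have "inc X ` carrier N = {x \<in> carrier (middle X). prj X x = \<zero>\<^bsub>Q\<^esub>}"
    using is_ext by (simp add: is_extension_def)
  ultimately show ?thesis by blast
qed

lemma prj_surj:
  assumes "q \<in> carrier Q" obtains x where "x \<in> carrier (middle X)" "prj X x = q"
proof -
  have "q \<in> prj X ` carrier (middle X)"
    using is_ext assms by (simp add: is_extension_def)
  with that show thesis by blast
qed

lemma exact:
  assumes "x \<in> carrier (middle X)" "prj X x = \<zero>\<^bsub>Q\<^esub>"
  obtains a where "a \<in> carrier N" "x = inc X a"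
proof -
  have "x \<in> inc X ` carrier N"
    using is_ext assms by (simp add: is_extension_def)
  with that show thesis by blast
qed

text \<open>Two elements with the same image in the quotient differ by an element of the
  submodule. Exactness is used below mostly in this form.\<close>

lemma same_prj:
  assumes "x \<in> carrier (middle X)" "y \<in> carrier (middle X)" "prj X x = prj X y"
  obtains a where "a \<in> carrier N" "x = y \<oplus>\<^bsub>middle X\<^esub> inc X a"
proof -
  have "prj X (x \<ominus>\<^bsub>middle X\<^esub> y) = \<zero>\<^bsub>Q\<^esub>"
    using assms by (simp add: M.minus_eq prj.add prj.uminus Q.r_neg)
  then obtain a where a: "a \<in> carrier N" "x \<ominus>\<^bsub>middle X\<^esub> y = inc X a"
    using exact assms by (metis M.minus_closed)
  have "x = y \<oplus>\<^bsub>middle X\<^esub> (x \<ominus>\<^bsub>middle X\<^esub> y)"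
    using assms by (simp add: M.minus_eq M.a_ac M.r_neg)
  with a that show thesis by metis
qed

end

lemma ext_equiv_refl:
  assumes "is_extension N Q X" shows "ext_equiv N X X"
  unfolding ext_equiv_def by (rule bexI[of _ "\<lambda>x. x"])
    (auto simp: LinearCombinations.module_hom_def bij_betw_def inj_on_def)

lemma ext_equiv_trans:
  assumes "ext_equiv N X Y" "ext_equiv N Y Z" shows "ext_equiv N X Z"
proof -
  obtain f where f: "f \<in> module_hom class_ring (middle X) (middle Y)"
    "bij_betw f (carrier (middle X)) (carrier (middle Y))"
    "\<forall>a\<in>carrier N. f (inc X a) = inc Y a" "\<forall>x\<in>carrier (middle X). prj Y (f x) = prj X x"
    using assms(1) unfolding ext_equiv_def by blast
  obtain g where g: "g \<in> module_hom class_ring (middle Y) (middle Z)"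
    "bij_betw g (carrier (middle Y)) (carrier (middle Z))"
    "\<forall>a\<in>carrier N. g (inc Y a) = inc Z a" "\<forall>x\<in>carrier (middle Y). prj Z (g x) = prj Y x"
    using assms(2) unfolding ext_equiv_def by blast
  show ?thesis
    unfolding ext_equiv_def
  proof (rule bexI[of _ "g \<circ> f"])
    show "g \<circ> f \<in> module_hom class_ring (middle X) (middle Z)"
      using f(1) g(1) by (auto simp: LinearCombinations.module_hom_def Pi_def)
    show "bij_betw (g \<circ> f) (carrier (middle X)) (carrier (middle Z)) \<and>
      (\<forall>a\<in>carrier N. (g \<circ> f) (inc X a) = inc Z a) \<and>
      (\<forall>x\<in>carrier (middle X). prj Z ((g \<circ> f) x) = prj X x)"
      using f g by (auto intro: bij_betw_trans dest: bij_betwE)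
  qed
qed

text \<open>Closure of the middle module of \<open>X\<close> under the operations is what makes the inverse map
  linear. Thus \<open>Y\<close> may be a Baer sum before its middle is known to be a module.\<close>

lemma ext_equiv_sym:
  fixes N :: "('s::comm_ring_1, 'n) module"
  assumes X: "is_extension N Q X" and "ext_equiv N X Y" shows "ext_equiv N Y X"
proof -
  interpret X: cext N Q X by unfold_locales (rule X)
  obtain f where f: "f \<in> module_hom class_ring (middle X) (middle Y)"
    "bij_betw f (carrier (middle X)) (carrier (middle Y))"
    "\<forall>a\<in>carrier N. f (inc X a) = inc Y a" "\<forall>x\<in>carrier (middle X). prj Y (f x) = prj X x"
    using assms(2) unfolding ext_equiv_def by blast
  define g where "g = the_inv_into (carrier (middle X)) f"
  have gf: "g (f x) = x" if "x \<in> carrier (middle X)" for x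
    using f(2) that by (simp add: g_def bij_betw_def the_inv_into_f_f)
  have surj: "\<exists>x\<in>carrier (middle X). y = f x" if "y \<in> carrier (middle Y)" for y
    using f(2) that by (auto simp: bij_betw_def)
  note hom = LinearCombinations.module_hom_add[OF f(1)] LinearCombinations.module_hom_smult[OF f(1)]
  show ?thesis
    unfolding ext_equiv_def
  proof (rule bexI[of _ g])
    show "g \<in> module_hom class_ring (middle Y) (middle X)"
    proof (rule module_homI)
      fix y assume "y \<in> carrier (middle Y)"
      then obtain x where x: "x \<in> carrier (middle X)" "y = f x"
        using surj by blast
      show "g y \<in> carrier (middle X)" using x gf by simp
      fix r :: 's
      have "g (r \<odot>\<^bsub>middle Y\<^esub> y) = g (f (r \<odot>\<^bsub>middle X\<^esub> x))"
        using x by (simp add: hom)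
      then show "g (r \<odot>\<^bsub>middle Y\<^esub> y) = r \<odot>\<^bsub>middle X\<^esub> g y"
        using x gf by simp
      fix y' assume "y' \<in> carrier (middle Y)"
      then obtain x' where x': "x' \<in> carrier (middle X)" "y' = f x'"
        using surj by blast
      have "g (y \<oplus>\<^bsub>middle Y\<^esub> y') = g (f (x \<oplus>\<^bsub>middle X\<^esub> x'))"
        using x x' by (simp add: hom)
      then show "g (y \<oplus>\<^bsub>middle Y\<^esub> y') = g y \<oplus>\<^bsub>middle X\<^esub> g y'"
        using x x' gf by simp
    qed
    have "g (inc Y a) = inc X a" if "a \<in> carrier N" for a
      using f(3) that gf[of "inc X a"] by simp
    moreover have "prj X (g y) = prj Y y" if "y \<in> carrier (middle Y)" for y
      using f(4) surj[OF that] gf by auto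
    ultimately show "bij_betw g (carrier (middle Y)) (carrier (middle X)) \<and>
      (\<forall>a\<in>carrier N. g (inc Y a) = inc X a) \<and> (\<forall>x\<in>carrier (middle Y). prj X (g x) = prj Y x)"
      using f(2) by (simp add: g_def bij_betw_the_inv_into)
  qed
qed

text \<open>The classes in \<open>Ext1\<close> only contain extensions whose middle lives on the product type. A
  set-theoretic section \<open>s\<close> of the projection identifies \<open>x\<close> with the pair of \<open>x - s (prj x)\<close>,
  read in the submodule, and \<open>prj x\<close>; transporting the structure of the middle along this injection
  shows that no equivalence class is lost.\<close>

lemma ex_ext_equiv_on_product:
  fixes N :: "('s::comm_ring_1, 'n) module" and Q :: "('s, 'q) module"
    and X :: "('s, 'n, 'm, 'q) extension"
  assumes X: "is_extension N Q X"
  shows "\<exists>Y :: ('s, 'n, 'n \<times> 'q, 'q) extension. is_extension N Q Y \<and> ext_equiv N Y X"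
proof -
  interpret X: cext N Q X by unfold_locales (rule X)
  define s where "s q = (SOME x. x \<in> carrier (middle X) \<and> prj X x = q)" for q
  have s: "s q \<in> carrier (middle X) \<and> prj X (s q) = q" if "q \<in> carrier Q" for q
    unfolding s_def by (rule X.prj_surj[OF that], rule someI_ex) blast
  have "\<exists>a. a \<in> carrier N \<and> x = s (prj X x) \<oplus>\<^bsub>middle X\<^esub> inc X a" if x: "x \<in> carrier (middle X)" for x
    using X.same_prj[OF x, of "s (prj X x)"] s[OF X.prj.closed[OF x]] by metis
  then obtain n where n: "\<And>x. x \<in> carrier (middle X) \<Longrightarrow> x = s (prj X x) \<oplus>\<^bsub>middle X\<^esub> inc X (n x)"
    by metis
  define \<tau> where "\<tau> x = (n x, prj X x)" for x
  have inj: "inj_on \<tau> (carrier (middle X))"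
  proof (rule inj_onI)
    fix x y assume x: "x \<in> carrier (middle X)" and y: "y \<in> carrier (middle X)" and "\<tau> x = \<tau> y"
    then have eq: "n x = n y" "prj X x = prj X y" by (simp_all add: \<tau>_def)
    have "x = s (prj X x) \<oplus>\<^bsub>middle X\<^esub> inc X (n x)" by (rule n[OF x])
    also have "\<dots> = s (prj X y) \<oplus>\<^bsub>middle X\<^esub> inc X (n y)" by (simp only: eq)
    also have "\<dots> = y" by (rule n[OF y, symmetric])
    finally show "x = y" .
  qed
  define \<sigma> where "\<sigma> = the_inv_into (carrier (middle X)) \<tau>"
  have \<sigma>\<tau> [simp]: "\<sigma> (\<tau> x) = x" if "x \<in> carrier (middle X)" for x
    unfolding \<sigma>_def using inj that by (rule the_inv_into_f_f)
  define M :: "('s, 'n \<times> 'q) module" where "M = \<lparr>carrier = \<tau> ` carrier (middle X), mult = undefined, one = undefined,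
    zero = \<tau> \<zero>\<^bsub>middle X\<^esub>, add = (\<lambda>x y. \<tau> (\<sigma> x \<oplus>\<^bsub>middle X\<^esub> \<sigma> y)),
    smult = (\<lambda>r x. \<tau> (r \<odot>\<^bsub>middle X\<^esub> \<sigma> x))\<rparr>"
  define Y :: "('s, 'n, 'n \<times> 'q, 'q) extension" where "Y = \<lparr>middle = M, inc = \<lambda>a. \<tau> (inc X a), prj = \<lambda>y. prj X (\<sigma> y)\<rparr>"
  have "abelian_group M"
  proof (rule abelian_groupI)
    fix x assume "x \<in> carrier M"
    then obtain x' where "x' \<in> carrier (middle X)" "x = \<tau> x'" by (auto simp: M_def)
    then show "\<exists>y\<in>carrier M. y \<oplus>\<^bsub>M\<^esub> x = \<zero>\<^bsub>M\<^esub>"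
      by (auto simp: M_def X.M.l_neg intro!: bexI[of _ "\<ominus>\<^bsub>middle X\<^esub> x'"])
  qed (auto simp: M_def X.M.a_ac)
  then have modM: "module class_ring M"
    by (rule module_class_ringI) (auto simp: M_def X.M.smult_l_distr X.M.smult_r_distr X.M.smult_assoc)
  have ker: "inc X ` carrier N = {x \<in> carrier (middle X). prj X x = \<zero>\<^bsub>Q\<^esub>}"
    and surj: "prj X ` carrier (middle X) = carrier Q"
    using X by (simp_all add: is_extension_def)
  have "inc Y ` carrier N = \<tau> ` (inc X ` carrier N)"
    by (auto simp: Y_def)
  also have "\<dots> = {y \<in> carrier M. prj Y y = \<zero>\<^bsub>Q\<^esub>}"
    unfolding ker by (auto simp: Y_def M_def)
  finally have kerY: "inc Y ` carrier N = {y \<in> carrier M. prj Y y = \<zero>\<^bsub>Q\<^esub>}" .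
  have surjY: "prj Y ` carrier M = carrier Q"
    unfolding surj[symmetric] by (auto simp: Y_def M_def image_image)
  have homs: "inc Y \<in> module_hom class_ring N M" "prj Y \<in> module_hom class_ring M Q"
    by (auto intro!: module_homI simp: Y_def M_def X.inc.add X.inc.smult X.prj.add X.prj.smult)
  have injY: "inj_on (inc Y) (carrier N)"
    using inj X.inc_inj X.inc.closed unfolding inj_on_def Y_def by simp
  have "is_extension N Q Y"
    using homs injY kerY surjY modM X by (simp add: is_extension_def Y_def)
  moreover have "ext_equiv N Y X"
    unfolding ext_equiv_def
  proof (rule bexI[of _ \<sigma>])
    show "\<sigma> \<in> module_hom class_ring (middle Y) (middle X)"
      by (auto intro!: module_homI simp: Y_def M_def)
    have "bij_betw \<sigma> (carrier M) (carrier (middle X))"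
      by (rule bij_betw_byWitness[where f' = \<tau>]) (auto simp: M_def)
    then show "bij_betw \<sigma> (carrier (middle Y)) (carrier (middle X)) \<and>
        (\<forall>a\<in>carrier N. \<sigma> (inc Y a) = inc X a) \<and> (\<forall>x\<in>carrier (middle Y). prj X (\<sigma> x) = prj Y x)"
      by (simp add: Y_def)
  qed
  ultimately show ?thesis by blast
qed

section \<open>Extensions described by lifts of generators\<close>

text \<open>\<open>Q\<close> is generated by \<open>e 0, \<dots>, e (r - 1)\<close>, and the coefficients of a linear relation are
  combinations of \<open>\<alpha> j\<close> and \<open>c\<close>. In the application \<open>\<alpha> j\<close> is the power of the monic polynomial that
  cuts out the \<open>j\<close>-th cyclic summand and \<open>c\<close> is the uniformizer, which kills everything.\<close>

definition generated_with_relations ::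
  "('s::comm_ring_1, 'q) module \<Rightarrow> nat \<Rightarrow> (nat \<Rightarrow> 'q) \<Rightarrow> (nat \<Rightarrow> 's) \<Rightarrow> 's \<Rightarrow> bool" where
  "generated_with_relations Q r e \<alpha> c \<longleftrightarrow>
     (\<forall>j<r. e j \<in> carrier Q) \<and>
     (\<forall>x\<in>carrier Q. \<exists>a. x = lin_comb Q r e a) \<and>
     (\<forall>b. lin_comb Q r e b = \<zero>\<^bsub>Q\<^esub> \<longrightarrow> (\<forall>j<r. \<exists>s t. b j = s * \<alpha> j + t * c))"

text \<open>The class of an extension of such a \<open>Q\<close> is recorded by what the defining relations
  become on lifts of the generators: \<open>w j\<close> for \<open>\<alpha> j\<close> and \<open>u j\<close> for \<open>c\<close>. Over \<open>k[t]\<close> the coordinates of \<open>w j\<close>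
  with respect to the generators form the \<open>j\<close>-th column of the matrix \<open>E(\<xi>)\<close>.\<close>

definition has_lifts ::
  "('s::comm_ring_1, 'n, 'm, 'q) extension \<Rightarrow> nat \<Rightarrow> (nat \<Rightarrow> 'q) \<Rightarrow> (nat \<Rightarrow> 's) \<Rightarrow> 's
     \<Rightarrow> (nat \<Rightarrow> 'n) \<Rightarrow> (nat \<Rightarrow> 'n) \<Rightarrow> bool" where
  "has_lifts X r e \<alpha> c w u \<longleftrightarrow> (\<exists>g. \<forall>j<r. g j \<in> carrier (middle X) \<and> prj X (g j) = e j \<and>
     \<alpha> j \<odot>\<^bsub>middle X\<^esub> g j = inc X (w j) \<and> c \<odot>\<^bsub>middle X\<^esub> g j = inc X (u j))"

lemma has_lifts_ext_equiv:
  fixes X :: "('s::comm_ring_1, 'n, 'm, 'q) extension"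
  assumes "has_lifts X r e \<alpha> c w u" "ext_equiv N X Y"
    and "\<And>j. j < r \<Longrightarrow> w j \<in> carrier N" "\<And>j. j < r \<Longrightarrow> u j \<in> carrier N"
  shows "has_lifts Y r e \<alpha> c w u"
proof -
  obtain g where g: "\<forall>j<r. g j \<in> carrier (middle X) \<and> prj X (g j) = e j \<and>
     \<alpha> j \<odot>\<^bsub>middle X\<^esub> g j = inc X (w j) \<and> c \<odot>\<^bsub>middle X\<^esub> g j = inc X (u j)"
    using assms(1) by (auto simp: has_lifts_def)
  obtain f where f: "f \<in> module_hom class_ring (middle X) (middle Y)"
    "\<forall>a\<in>carrier N. f (inc X a) = inc Y a" "\<forall>x\<in>carrier (middle X). prj Y (f x) = prj X x"
    using assms(2) unfolding ext_equiv_def by blast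
  have closed: "f x \<in> carrier (middle Y)" if "x \<in> carrier (middle X)" for x
    using LinearCombinations.module_hom_closed[OF f(1)] that by auto
  have smult: "s \<odot>\<^bsub>middle Y\<^esub> f x = f (s \<odot>\<^bsub>middle X\<^esub> x)" if "x \<in> carrier (middle X)" for s x
    using LinearCombinations.module_hom_smult[OF f(1)] that by simp
  show ?thesis
    unfolding has_lifts_def
    by (rule exI[of _ "f \<circ> g"]) (use g f assms(3,4) in \<open>simp add: closed smult\<close>)
qed

context cext
begin

text \<open>A combination of the lifts whose coefficients come from the relations lies in the submodule,
  and its value there is additive in the data \<open>(w, u)\<close>. This additivity is the reason why the data
  of a Baer sum are the sums of the data.\<close>

lemma lin_comb_lifts:
  assumes "\<And>i. i < r \<Longrightarrow> g i \<in> carrier (middle X)" "\<And>i. i < r \<Longrightarrow> w i \<in> carrier N"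
    and "\<And>i. i < r \<Longrightarrow> u i \<in> carrier N"
    and "\<And>i. i < r \<Longrightarrow> \<alpha> i \<odot>\<^bsub>middle X\<^esub> g i = inc X (w i)"
    and "\<And>i. i < r \<Longrightarrow> c \<odot>\<^bsub>middle X\<^esub> g i = inc X (u i)"
    and "\<And>i. i < r \<Longrightarrow> a i = s i * \<alpha> i + t i * c"
  shows "lin_comb (middle X) r g a = inc X (lin_comb N r w s \<oplus>\<^bsub>N\<^esub> lin_comb N r u t)"
proof -
  have "lin_comb (middle X) r g a = lin_comb (middle X) r g (\<lambda>i. s i * \<alpha> i + t i * c)"
    using assms(1,6) by (intro M.lin_comb_cong) auto
  also have "\<dots> = lin_comb (middle X) r g (\<lambda>i. s i * \<alpha> i) \<oplus>\<^bsub>middle X\<^esub> lin_comb (middle X) r g (\<lambda>i. t i * c)"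
    using assms(1) by (rule M.lin_comb_add)
  also have "lin_comb (middle X) r g (\<lambda>i. s i * \<alpha> i) = lin_comb (middle X) r (\<lambda>i. inc X (w i)) s"
    using assms by (intro M.lin_comb_cong) (auto simp: M.smult_assoc)
  also have "lin_comb (middle X) r g (\<lambda>i. t i * c) = lin_comb (middle X) r (\<lambda>i. inc X (u i)) t"
    using assms by (intro M.lin_comb_cong) (auto simp: M.smult_assoc)
  also have "lin_comb (middle X) r (\<lambda>i. inc X (w i)) s = inc X (lin_comb N r w s)"
    using assms by (simp add: inc.lin_comb)
  also have "lin_comb (middle X) r (\<lambda>i. inc X (u i)) t = inc X (lin_comb N r u t)"
    using assms by (simp add: inc.lin_comb)
  finally show ?thesis using assms by (simp add: inc.add)
qed

end

section \<open>The Baer sum of two extensions\<close>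

text \<open>The carrier of the pullback, whose quotient by the antidiagonal copy of \<open>N\<close> is the middle
  of the Baer sum.\<close>

definition fibre_product ::
  "('s, 'n, 'm, 'q) extension \<Rightarrow> ('s, 'n, 'l, 'q) extension \<Rightarrow> ('m \<times> 'l) set" where
  "fibre_product X Y = {z \<in> carrier (middle X) \<times> carrier (middle Y). prj X (fst z) = prj Y (snd z)}"

text \<open>Universal property of the Baer sum: a linear map \<open>\<psi>\<close> from the pullback to \<open>Z\<close> that is
  compatible with the projections and restricts to addition on \<open>N \<times> N\<close> is onto, and its fibres are
  exactly the cosets of the antidiagonal. Hence \<open>w \<mapsto> \<psi>\<^sup>-\<^sup>1(w)\<close> is an isomorphism from \<open>Z\<close> to the
  quotient. Working with fibres transports the module structure from \<open>Z\<close>, so the quotient does not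
  have to be shown to be a module beforehand.\<close>

lemma ext_equiv_baer_sumI:
  fixes X :: "('s::comm_ring_1, 'n, 'm, 'q) extension" and Y :: "('s, 'n, 'l, 'q) extension"
    and Z :: "('s, 'n, 'z, 'q) extension"
  assumes X: "is_extension N Q X" and Y: "is_extension N Q Y" and Z: "is_extension N Q Z"
    and prj: "\<And>x y. (x, y) \<in> fibre_product X Y \<Longrightarrow>
      \<psi> (x, y) \<in> carrier (middle Z) \<and> prj Z (\<psi> (x, y)) = prj X x"
    and add: "\<And>x y x' y'. (x, y) \<in> fibre_product X Y \<Longrightarrow> (x', y') \<in> fibre_product X Y \<Longrightarrow>
      \<psi> (x \<oplus>\<^bsub>middle X\<^esub> x', y \<oplus>\<^bsub>middle Y\<^esub> y') = \<psi> (x, y) \<oplus>\<^bsub>middle Z\<^esub> \<psi> (x', y')"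
    and smult: "\<And>x y s. (x, y) \<in> fibre_product X Y \<Longrightarrow>
      \<psi> (s \<odot>\<^bsub>middle X\<^esub> x, s \<odot>\<^bsub>middle Y\<^esub> y) = s \<odot>\<^bsub>middle Z\<^esub> \<psi> (x, y)"
    and inc: "\<And>a b. a \<in> carrier N \<Longrightarrow> b \<in> carrier N \<Longrightarrow> \<psi> (inc X a, inc Y b) = inc Z (a \<oplus>\<^bsub>N\<^esub> b)"
  shows "ext_equiv N Z (baer_sum N X Y)"
proof -
  interpret X: cext N Q X by unfold_locales (rule X)
  interpret Y: cext N Q Y by unfold_locales (rule Y)
  interpret Z: cext N Q Z by unfold_locales (rule Z)
  define P where "P = direct_sum (middle X) (middle Y)\<lparr>carrier := fibre_product X Y\<rparr>"
  define D where "D = {(inc X a, \<ominus>\<^bsub>middle Y\<^esub> inc Y a) | a. a \<in> carrier N}"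
  have B: "baer_sum N X Y = \<lparr>middle = quotient_module P D,
      inc = (\<lambda>a. D +>\<^bsub>P\<^esub> (inc X a, \<zero>\<^bsub>middle Y\<^esub>)), prj = (\<lambda>C. prj X (fst (SOME z. z \<in> C)))\<rparr>"
    by (simp add: baer_sum_def P_def D_def fibre_product_def Let_def)
  have carrier_P: "carrier P = fibre_product X Y"
    and add_P: "(x, y) \<oplus>\<^bsub>P\<^esub> (x', y') = (x \<oplus>\<^bsub>middle X\<^esub> x', y \<oplus>\<^bsub>middle Y\<^esub> y')"
    and smult_P: "s \<odot>\<^bsub>P\<^esub> (x, y) = (s \<odot>\<^bsub>middle X\<^esub> x, s \<odot>\<^bsub>middle Y\<^esub> y)" for x y x' y' s
    by (simp_all add: P_def direct_sum_def)
  have fp: "(x, y) \<in> fibre_product X Y \<longleftrightarrow>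
      x \<in> carrier (middle X) \<and> y \<in> carrier (middle Y) \<and> prj X x = prj Y y" for x y
    by (auto simp: fibre_product_def)
  have add_fp: "(x \<oplus>\<^bsub>middle X\<^esub> x', y \<oplus>\<^bsub>middle Y\<^esub> y') \<in> fibre_product X Y"
    if "(x, y) \<in> fibre_product X Y" "(x', y') \<in> fibre_product X Y" for x y x' y'
    using that by (simp add: fp X.prj.add Y.prj.add)
  have smult_fp: "(s \<odot>\<^bsub>middle X\<^esub> x, s \<odot>\<^bsub>middle Y\<^esub> y) \<in> fibre_product X Y"
    if "(x, y) \<in> fibre_product X Y" for x y s
    using that by (simp add: fp X.prj.smult Y.prj.smult)
  define F where "F w = {z \<in> fibre_product X Y. \<psi> z = w}" for w
  (* Two points of one fibre differ by (inc a, inc b) with a + b = 0, a point of D. *)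
  have F_coset: "D +>\<^bsub>P\<^esub> z = F (\<psi> z)" if "z \<in> fibre_product X Y" for z
  proof -
    obtain x y where z: "z = (x, y)" by (cases z)
    note xy = that[unfolded z fp]
    have D_fp: "(inc X a, \<ominus>\<^bsub>middle Y\<^esub> inc Y a) \<in> fibre_product X Y" if "a \<in> carrier N" for a
      using that by (simp add: fp Y.prj.uminus)
    have D_psi: "\<psi> (inc X a, \<ominus>\<^bsub>middle Y\<^esub> inc Y a) = \<zero>\<^bsub>middle Z\<^esub>" if "a \<in> carrier N" for a
      using inc[of a "\<ominus>\<^bsub>N\<^esub> a"] that by (simp add: Y.inc.uminus X.N.r_neg)
    have "z' \<in> F (\<psi> z) \<longleftrightarrow> z' \<in> D +>\<^bsub>P\<^esub> z" for z'
    proof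
      assume "z' \<in> F (\<psi> z)"
      then obtain x' y' where z': "z' = (x', y')" and xy': "(x', y') \<in> fibre_product X Y"
        and eq: "\<psi> (x', y') = \<psi> (x, y)"
        by (cases z') (auto simp: F_def z)
      have "prj X x' = prj X x"
        using prj[OF xy'] prj[of x y] that eq z by metis
      then obtain a where a: "a \<in> carrier N" "x' = x \<oplus>\<^bsub>middle X\<^esub> inc X a"
        using X.same_prj[of x' x] xy xy' fp by metis
      have "prj Y y' = prj Y y"
        using \<open>prj X x' = prj X x\<close> xy xy' fp by metis
      then obtain b where b: "b \<in> carrier N" "y' = y \<oplus>\<^bsub>middle Y\<^esub> inc Y b"
        using Y.same_prj[of y' y] xy xy' fp by metis
      have "\<psi> (x', y') = \<psi> (x, y) \<oplus>\<^bsub>middle Z\<^esub> inc Z (a \<oplus>\<^bsub>N\<^esub> b)"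
        using add[of x y "inc X a" "inc Y b"] that z a b by (simp add: inc fp)
      moreover have "\<psi> (x, y) \<in> carrier (middle Z)" using prj that z by blast
      ultimately have "inc Z (a \<oplus>\<^bsub>N\<^esub> b) = \<zero>\<^bsub>middle Z\<^esub>"
        using eq a b by (metis Z.M.add.r_cancel_one' Z.M.a_comm Z.inc.closed X.N.a_closed)
      then have "a \<oplus>\<^bsub>N\<^esub> b = \<zero>\<^bsub>N\<^esub>" using a b by (intro Z.inc_eq_zero) auto
      then have "b = \<ominus>\<^bsub>N\<^esub> a" using a b by (metis X.N.minus_equality X.N.a_comm)
      then have "z' = (inc X a, \<ominus>\<^bsub>middle Y\<^esub> inc Y a) \<oplus>\<^bsub>P\<^esub> z"
        using a b xy by (simp add: z z' add_P Y.inc.uminus X.M.a_comm Y.M.a_comm)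
      then show "z' \<in> D +>\<^bsub>P\<^esub> z"
        using a by (auto simp: a_r_coset_def' D_def)
    next
      assume "z' \<in> D +>\<^bsub>P\<^esub> z"
      then obtain a where a: "a \<in> carrier N" "z' = (inc X a, \<ominus>\<^bsub>middle Y\<^esub> inc Y a) \<oplus>\<^bsub>P\<^esub> z"
        by (auto simp: a_r_coset_def' D_def)
      then show "z' \<in> F (\<psi> z)"
        using D_fp[OF a(1)] D_psi[OF a(1)] that prj[of x y] by (simp add: F_def z add_P add add_fp)
    qed
    then show ?thesis by blast
  qed
  have F_nonempty: "\<exists>z\<in>fibre_product X Y. \<psi> z = w" if w: "w \<in> carrier (middle Z)" for w
  proof -
    obtain x where x: "x \<in> carrier (middle X)" "prj X x = prj Z w"
      by (rule X.prj_surj[OF Z.prj.closed[OF w]])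
    obtain y where y: "y \<in> carrier (middle Y)" "prj Y y = prj Z w"
      by (rule Y.prj_surj[OF Z.prj.closed[OF w]])
    have xy: "(x, y) \<in> fibre_product X Y" using x y by (simp add: fp)
    obtain a where a: "a \<in> carrier N" "w = \<psi> (x, y) \<oplus>\<^bsub>middle Z\<^esub> inc Z a"
      using Z.same_prj[of w "\<psi> (x, y)"] w prj[OF xy] x by metis
    have "\<psi> (x \<oplus>\<^bsub>middle X\<^esub> inc X a, y \<oplus>\<^bsub>middle Y\<^esub> inc Y \<zero>\<^bsub>N\<^esub>) = w"
      using a add[of x y "inc X a" "inc Y \<zero>\<^bsub>N\<^esub>"] inc[of a "\<zero>\<^bsub>N\<^esub>"] xy by (simp add: fp)
    moreover have "(x \<oplus>\<^bsub>middle X\<^esub> inc X a, y \<oplus>\<^bsub>middle Y\<^esub> inc Y \<zero>\<^bsub>N\<^esub>) \<in> fibre_product X Y"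
      using xy a by (intro add_fp) (auto simp: fp)
    ultimately show ?thesis by blast
  qed
  have F_add: "F (w \<oplus>\<^bsub>middle Z\<^esub> w') = F w <+>\<^bsub>P\<^esub> F w'"
    if w: "w \<in> carrier (middle Z)" and w': "w' \<in> carrier (middle Z)" for w w'
  proof -
    obtain x y where xy: "(x, y) \<in> fibre_product X Y" "\<psi> (x, y) = w"
      using F_nonempty[OF w] by auto
    have "z \<in> F (w \<oplus>\<^bsub>middle Z\<^esub> w') \<Longrightarrow> z \<in> F w <+>\<^bsub>P\<^esub> F w'" for z
    proof -
      assume "z \<in> F (w \<oplus>\<^bsub>middle Z\<^esub> w')"
      then obtain x' y' where z: "z = (x', y')" and xy': "(x', y') \<in> fibre_product X Y"
        and eq: "\<psi> (x', y') = w \<oplus>\<^bsub>middle Z\<^esub> w'"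
        by (cases z) (auto simp: F_def)
      define x1 y1 where "x1 = (-1) \<odot>\<^bsub>middle X\<^esub> x" and "y1 = (-1) \<odot>\<^bsub>middle Y\<^esub> y"
      have xy1: "(x1, y1) \<in> fibre_product X Y" and psi1: "\<psi> (x1, y1) = \<ominus>\<^bsub>middle Z\<^esub> w"
        using smult_fp[OF xy(1), of "-1"] smult[OF xy(1), of "-1"] xy(2) w
        by (simp_all add: x1_def y1_def Z.M.smult_l_minus)
      have "\<psi> (x' \<oplus>\<^bsub>middle X\<^esub> x1, y' \<oplus>\<^bsub>middle Y\<^esub> y1) = w'"
        using add[OF xy' xy1] eq psi1 w w' by (simp add: Z.M.a_ac Z.M.r_neg)
      moreover have "(x' \<oplus>\<^bsub>middle X\<^esub> x1, y' \<oplus>\<^bsub>middle Y\<^esub> y1) \<in> fibre_product X Y"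
        by (rule add_fp[OF xy' xy1])
      moreover have "(x, y) \<oplus>\<^bsub>P\<^esub> (x' \<oplus>\<^bsub>middle X\<^esub> x1, y' \<oplus>\<^bsub>middle Y\<^esub> y1) = z"
      proof -
        have "x1 = \<ominus>\<^bsub>middle X\<^esub> x" "y1 = \<ominus>\<^bsub>middle Y\<^esub> y"
          using xy by (simp_all add: x1_def y1_def fp X.M.smult_l_minus Y.M.smult_l_minus)
        then show ?thesis
          using xy xy' by (simp add: add_P z fp X.M.a_lcomm[of x x'] Y.M.a_lcomm[of y y'] X.M.r_neg Y.M.r_neg)
      qed
      ultimately show ?thesis
        using xy by (force simp: set_add_def' F_def)
    qed
    moreover have "z \<in> F w <+>\<^bsub>P\<^esub> F w' \<Longrightarrow> z \<in> F (w \<oplus>\<^bsub>middle Z\<^esub> w')" for z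
      using add add_fp by (auto simp: set_add_def' F_def add_P)
    ultimately show ?thesis by blast
  qed
  have F_smult: "F (s \<odot>\<^bsub>middle Z\<^esub> w) = (\<Union>z\<in>F w. D +>\<^bsub>P\<^esub> (s \<odot>\<^bsub>P\<^esub> z))"
    if w: "w \<in> carrier (middle Z)" for s w
  proof -
    have "D +>\<^bsub>P\<^esub> (s \<odot>\<^bsub>P\<^esub> z) = F (s \<odot>\<^bsub>middle Z\<^esub> w)" if "z \<in> F w" for z
      using that by (cases z) (auto simp: F_def smult_P F_coset smult_fp smult)
    moreover have "F w \<noteq> {}" using F_nonempty[OF w] by (auto simp: F_def)
    ultimately show ?thesis by auto
  qed
  have hom: "F \<in> module_hom class_ring (middle Z) (quotient_module P D)"
  proof (rule module_homI)
    fix w assume w: "w \<in> carrier (middle Z)"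
    obtain z where "z \<in> fibre_product X Y" "F w = D +>\<^bsub>P\<^esub> z"
      using F_nonempty[OF w] F_coset by metis
    then show "F w \<in> carrier (quotient_module P D)"
      by (auto simp: quotient_module_def A_RCOSETS_def' carrier_P)
  qed (simp_all add: F_add F_smult quotient_module_def)
  have bij: "bij_betw F (carrier (middle Z)) (carrier (quotient_module P D))"
    unfolding bij_betw_def
  proof
    show "inj_on F (carrier (middle Z))"
      using F_nonempty unfolding inj_on_def F_def by blast
    have "D +>\<^bsub>P\<^esub> z \<in> F ` carrier (middle Z)" if "z \<in> fibre_product X Y" for z
      using F_coset[OF that] prj that by (cases z) auto
    then have "carrier (quotient_module P D) \<subseteq> F ` carrier (middle Z)"
      by (auto simp: quotient_module_def A_RCOSETS_def' carrier_P)
    moreover have "F ` carrier (middle Z) \<subseteq> carrier (quotient_module P D)"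
      using LinearCombinations.module_hom_closed[OF hom] by blast
    ultimately show "F ` carrier (middle Z) = carrier (quotient_module P D)"
      by blast
  qed
  have "F (inc Z a) = D +>\<^bsub>P\<^esub> (inc X a, \<zero>\<^bsub>middle Y\<^esub>)" if "a \<in> carrier N" for a
    using that inc[of a "\<zero>\<^bsub>N\<^esub>"] F_coset[of "(inc X a, \<zero>\<^bsub>middle Y\<^esub>)"] by (simp add: fp)
  moreover have "prj X (fst (SOME z. z \<in> F w)) = prj Z w" if w: "w \<in> carrier (middle Z)" for w
  proof -
    obtain z where "z \<in> F w" using F_nonempty[OF w] by (auto simp: F_def)
    then have "(SOME z. z \<in> F w) \<in> F w" by (rule someI)
    moreover obtain x y where "(SOME z. z \<in> F w) = (x, y)" by (metis surj_pair)
    ultimately show ?thesis using prj[of x y] by (simp add: F_def)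
  qed
  ultimately show ?thesis
    using hom bij by (auto simp: ext_equiv_def B)
qed

text \<open>If the data of \<open>Z\<close> are the sums of those of \<open>X\<close> and \<open>Y\<close>, then \<open>Z\<close> is the Baer sum. Every
  element of the pullback has the form \<open>(\<Sum> a\<^sub>j g\<^sub>j + m, \<Sum> a\<^sub>j h\<^sub>j + m')\<close> with the same coefficients,
  where \<open>g\<^sub>j, h\<^sub>j, k\<^sub>j\<close> are the lifts in \<open>X, Y, Z\<close>, and \<open>\<psi>\<close> sends it to
  \<open>\<Sum> a\<^sub>j k\<^sub>j + (m + m')\<close>. The coefficients are not unique; that the value is unique is checked on
  the graph \<open>G\<close> of \<open>\<psi>\<close>, which is closed under the operations, so that it is enough to look at
  the elements over zero.\<close>

theorem ext_equiv_baer_sum: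
  fixes X :: "('s::comm_ring_1, 'n, 'm, 'q) extension" and Y :: "('s, 'n, 'l, 'q) extension"
    and Z :: "('s, 'n, 'z, 'q) extension"
  assumes X: "is_extension N Q X" and Y: "is_extension N Q Y" and Z: "is_extension N Q Z"
    and pres: "generated_with_relations Q r e \<alpha> c"
    and liftsX: "has_lifts X r e \<alpha> c w u" and liftsY: "has_lifts Y r e \<alpha> c w' u'"
    and liftsZ: "has_lifts Z r e \<alpha> c (\<lambda>j. w j \<oplus>\<^bsub>N\<^esub> w' j) (\<lambda>j. u j \<oplus>\<^bsub>N\<^esub> u' j)"
    and closed: "\<And>j. j < r \<Longrightarrow> w j \<in> carrier N" "\<And>j. j < r \<Longrightarrow> u j \<in> carrier N"
      "\<And>j. j < r \<Longrightarrow> w' j \<in> carrier N" "\<And>j. j < r \<Longrightarrow> u' j \<in> carrier N"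
  shows "ext_equiv N Z (baer_sum N X Y)"
proof -
  interpret X: cext N Q X by unfold_locales (rule X)
  interpret Y: cext N Q Y by unfold_locales (rule Y)
  interpret Z: cext N Q Z by unfold_locales (rule Z)
  obtain g where "\<forall>j<r. g j \<in> carrier (middle X) \<and> prj X (g j) = e j \<and>
     \<alpha> j \<odot>\<^bsub>middle X\<^esub> g j = inc X (w j) \<and> c \<odot>\<^bsub>middle X\<^esub> g j = inc X (u j)"
    using liftsX unfolding has_lifts_def by blast
  then have g: "\<And>j. j < r \<Longrightarrow> g j \<in> carrier (middle X)" "\<And>j. j < r \<Longrightarrow> prj X (g j) = e j"
    "\<And>j. j < r \<Longrightarrow> \<alpha> j \<odot>\<^bsub>middle X\<^esub> g j = inc X (w j)"
    "\<And>j. j < r \<Longrightarrow> c \<odot>\<^bsub>middle X\<^esub> g j = inc X (u j)" by auto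
  obtain h where "\<forall>j<r. h j \<in> carrier (middle Y) \<and> prj Y (h j) = e j \<and>
     \<alpha> j \<odot>\<^bsub>middle Y\<^esub> h j = inc Y (w' j) \<and> c \<odot>\<^bsub>middle Y\<^esub> h j = inc Y (u' j)"
    using liftsY unfolding has_lifts_def by blast
  then have h: "\<And>j. j < r \<Longrightarrow> h j \<in> carrier (middle Y)" "\<And>j. j < r \<Longrightarrow> prj Y (h j) = e j"
    "\<And>j. j < r \<Longrightarrow> \<alpha> j \<odot>\<^bsub>middle Y\<^esub> h j = inc Y (w' j)"
    "\<And>j. j < r \<Longrightarrow> c \<odot>\<^bsub>middle Y\<^esub> h j = inc Y (u' j)" by auto
  obtain k where "\<forall>j<r. k j \<in> carrier (middle Z) \<and> prj Z (k j) = e j \<and>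
     \<alpha> j \<odot>\<^bsub>middle Z\<^esub> k j = inc Z (w j \<oplus>\<^bsub>N\<^esub> w' j) \<and> c \<odot>\<^bsub>middle Z\<^esub> k j = inc Z (u j \<oplus>\<^bsub>N\<^esub> u' j)"
    using liftsZ unfolding has_lifts_def by blast
  then have k: "\<And>j. j < r \<Longrightarrow> k j \<in> carrier (middle Z)" "\<And>j. j < r \<Longrightarrow> prj Z (k j) = e j"
    "\<And>j. j < r \<Longrightarrow> \<alpha> j \<odot>\<^bsub>middle Z\<^esub> k j = inc Z (w j \<oplus>\<^bsub>N\<^esub> w' j)"
    "\<And>j. j < r \<Longrightarrow> c \<odot>\<^bsub>middle Z\<^esub> k j = inc Z (u j \<oplus>\<^bsub>N\<^esub> u' j)" by auto
  have e: "e j \<in> carrier Q" if "j < r" for j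
    using pres that by (auto simp: generated_with_relations_def)
  have gen: "\<exists>a. x = lin_comb Q r e a" if "x \<in> carrier Q" for x
    using pres that by (auto simp: generated_with_relations_def)
  have lcX: "lin_comb (middle X) r g a \<in> carrier (middle X)" for a using g by auto
  have lcY: "lin_comb (middle Y) r h a \<in> carrier (middle Y)" for a using h by auto
  have lcZ: "lin_comb (middle Z) r k a \<in> carrier (middle Z)" for a using k by auto
  have prjX: "prj X (lin_comb (middle X) r g a) = lin_comb Q r e a" for a
    using g e by (simp add: X.prj.lin_comb cong: X.Q.lin_comb_cong)
  have prjY: "prj Y (lin_comb (middle Y) r h a) = lin_comb Q r e a" for a
    using h e by (simp add: Y.prj.lin_comb cong: X.Q.lin_comb_cong)
  have prjZ: "prj Z (lin_comb (middle Z) r k a) = lin_comb Q r e a" for a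
    using k e by (simp add: Z.prj.lin_comb cong: X.Q.lin_comb_cong)
  define G where "G z v \<longleftrightarrow> (\<exists>a m m'. m \<in> carrier N \<and> m' \<in> carrier N \<and>
      z = (lin_comb (middle X) r g a \<oplus>\<^bsub>middle X\<^esub> inc X m,
           lin_comb (middle Y) r h a \<oplus>\<^bsub>middle Y\<^esub> inc Y m') \<and>
      v = lin_comb (middle Z) r k a \<oplus>\<^bsub>middle Z\<^esub> inc Z (m \<oplus>\<^bsub>N\<^esub> m'))" for z v
  have G_add: "G (x \<oplus>\<^bsub>middle X\<^esub> x', y \<oplus>\<^bsub>middle Y\<^esub> y') (v \<oplus>\<^bsub>middle Z\<^esub> v')"
    if G: "G (x, y) v" and G': "G (x', y') v'" for x y v x' y' v'
  proof -
    obtain a m m' where a: "m \<in> carrier N" "m' \<in> carrier N"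
      "x = lin_comb (middle X) r g a \<oplus>\<^bsub>middle X\<^esub> inc X m"
      "y = lin_comb (middle Y) r h a \<oplus>\<^bsub>middle Y\<^esub> inc Y m'"
      "v = lin_comb (middle Z) r k a \<oplus>\<^bsub>middle Z\<^esub> inc Z (m \<oplus>\<^bsub>N\<^esub> m')"
      using G unfolding G_def by auto
    obtain b l l' where b: "l \<in> carrier N" "l' \<in> carrier N"
      "x' = lin_comb (middle X) r g b \<oplus>\<^bsub>middle X\<^esub> inc X l"
      "y' = lin_comb (middle Y) r h b \<oplus>\<^bsub>middle Y\<^esub> inc Y l'"
      "v' = lin_comb (middle Z) r k b \<oplus>\<^bsub>middle Z\<^esub> inc Z (l \<oplus>\<^bsub>N\<^esub> l')"
      using G' unfolding G_def by auto
    show ?thesis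
      unfolding G_def
      by (rule exI[of _ "\<lambda>i. a i + b i"], rule exI[of _ "m \<oplus>\<^bsub>N\<^esub> l"], rule exI[of _ "m' \<oplus>\<^bsub>N\<^esub> l'"])
        (use a b lcX lcY lcZ in \<open>simp add: X.M.lin_comb_add[OF g(1)] Y.M.lin_comb_add[OF h(1)]
          Z.M.lin_comb_add[OF k(1)] X.inc.add Y.inc.add Z.inc.add X.M.a_ac Y.M.a_ac Z.M.a_ac\<close>)
  qed
  have G_smult: "G (s \<odot>\<^bsub>middle X\<^esub> x, s \<odot>\<^bsub>middle Y\<^esub> y) (s \<odot>\<^bsub>middle Z\<^esub> v)"
    if G: "G (x, y) v" for x y v s
  proof -
    obtain a m m' where a: "m \<in> carrier N" "m' \<in> carrier N"
      "x = lin_comb (middle X) r g a \<oplus>\<^bsub>middle X\<^esub> inc X m"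
      "y = lin_comb (middle Y) r h a \<oplus>\<^bsub>middle Y\<^esub> inc Y m'"
      "v = lin_comb (middle Z) r k a \<oplus>\<^bsub>middle Z\<^esub> inc Z (m \<oplus>\<^bsub>N\<^esub> m')"
      using G unfolding G_def by auto
    show ?thesis
      unfolding G_def
      by (rule exI[of _ "\<lambda>i. s * a i"], rule exI[of _ "s \<odot>\<^bsub>N\<^esub> m"], rule exI[of _ "s \<odot>\<^bsub>N\<^esub> m'"])
        (use a lcX lcY lcZ in \<open>simp add: X.M.lin_comb_smult[OF g(1)] Y.M.lin_comb_smult[OF h(1)]
          Z.M.lin_comb_smult[OF k(1)] X.inc.smult Y.inc.smult Z.inc.smult X.inc.add Y.inc.add Z.inc.add
          X.M.smult_r_distr Y.M.smult_r_distr Z.M.smult_r_distr\<close>)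
  qed
  have G_closed: "v \<in> carrier (middle Z)" "prj Z v = prj X x"
    if G: "G (x, y) v" for x y v
    using G lcX lcZ unfolding G_def by (auto simp: X.prj.add Z.prj.add prjX prjZ)
  have G_total: "\<exists>v. G z v" if z: "z \<in> fibre_product X Y" for z
  proof -
    obtain x y where xy: "z = (x, y)" "x \<in> carrier (middle X)" "y \<in> carrier (middle Y)" "prj X x = prj Y y"
      using z by (auto simp: fibre_product_def)
    obtain a where a: "prj X x = lin_comb Q r e a" using gen[of "prj X x"] xy by auto
    obtain m where "m \<in> carrier N" "x = lin_comb (middle X) r g a \<oplus>\<^bsub>middle X\<^esub> inc X m"
      using X.same_prj[OF xy(2) lcX, of a] a prjX by metis
    moreover obtain m' where "m' \<in> carrier N" "y = lin_comb (middle Y) r h a \<oplus>\<^bsub>middle Y\<^esub> inc Y m'"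
      using Y.same_prj[OF xy(3) lcY, of a] a prjY xy(4) by metis
    ultimately show ?thesis unfolding G_def xy(1) by blast
  qed
  (* Over zero the coefficients are combinations of the relations, so the three sums are the values
     of the relation data W, W' and W + W'; since m = - W and m' = - W', everything cancels. *)
  have G_zero: "v = \<zero>\<^bsub>middle Z\<^esub>" if G: "G (\<zero>\<^bsub>middle X\<^esub>, \<zero>\<^bsub>middle Y\<^esub>) v" for v
  proof -
    obtain a m m' where a: "m \<in> carrier N" "m' \<in> carrier N"
      "\<zero>\<^bsub>middle X\<^esub> = lin_comb (middle X) r g a \<oplus>\<^bsub>middle X\<^esub> inc X m"
      "\<zero>\<^bsub>middle Y\<^esub> = lin_comb (middle Y) r h a \<oplus>\<^bsub>middle Y\<^esub> inc Y m'"
      "v = lin_comb (middle Z) r k a \<oplus>\<^bsub>middle Z\<^esub> inc Z (m \<oplus>\<^bsub>N\<^esub> m')"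
      using G unfolding G_def by auto
    have "prj X (lin_comb (middle X) r g a \<oplus>\<^bsub>middle X\<^esub> inc X m) = \<zero>\<^bsub>Q\<^esub>"
      unfolding a(3)[symmetric] by (rule X.prj.zero)
    then have "lin_comb Q r e a = \<zero>\<^bsub>Q\<^esub>"
      using a(1) e by (simp add: X.prj.add lcX prjX)
    then have "\<forall>j<r. \<exists>s t. a j = s * \<alpha> j + t * c"
      using pres by (auto simp: generated_with_relations_def)
    then obtain s t where st: "\<And>j. j < r \<Longrightarrow> a j = s j * \<alpha> j + t j * c" by metis
    define W where "W = lin_comb N r w s \<oplus>\<^bsub>N\<^esub> lin_comb N r u t"
    define W' where "W' = lin_comb N r w' s \<oplus>\<^bsub>N\<^esub> lin_comb N r u' t"
    have W: "W \<in> carrier N" "W' \<in> carrier N" using closed by (auto simp: W_def W'_def)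
    have "inc X (W \<oplus>\<^bsub>N\<^esub> m) = \<zero>\<^bsub>middle X\<^esub>"
      using a(1,3) W X.lin_comb_lifts[OF g(1) closed(1,2) g(3,4) st] by (simp add: X.inc.add W_def)
    then have m: "W \<oplus>\<^bsub>N\<^esub> m = \<zero>\<^bsub>N\<^esub>" using a(1) W by (intro X.inc_eq_zero) auto
    have "inc Y (W' \<oplus>\<^bsub>N\<^esub> m') = \<zero>\<^bsub>middle Y\<^esub>"
      using a(2,4) W Y.lin_comb_lifts[OF h(1) closed(3,4) h(3,4) st] by (simp add: Y.inc.add W'_def)
    then have m': "W' \<oplus>\<^bsub>N\<^esub> m' = \<zero>\<^bsub>N\<^esub>" using a(2) W by (intro Y.inc_eq_zero) auto
    have "lin_comb (middle Z) r k a = inc Z (lin_comb N r (\<lambda>j. w j \<oplus>\<^bsub>N\<^esub> w' j) s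
        \<oplus>\<^bsub>N\<^esub> lin_comb N r (\<lambda>j. u j \<oplus>\<^bsub>N\<^esub> u' j) t)"
      using closed by (intro Z.lin_comb_lifts[OF k(1) _ _ k(3,4) st]) auto
    also have "lin_comb N r (\<lambda>j. w j \<oplus>\<^bsub>N\<^esub> w' j) s \<oplus>\<^bsub>N\<^esub> lin_comb N r (\<lambda>j. u j \<oplus>\<^bsub>N\<^esub> u' j) t = W \<oplus>\<^bsub>N\<^esub> W'"
      using closed by (simp add: W_def W'_def X.N.lin_comb_add_right X.N.a_ac)
    finally have "v = inc Z ((W \<oplus>\<^bsub>N\<^esub> m) \<oplus>\<^bsub>N\<^esub> (W' \<oplus>\<^bsub>N\<^esub> m'))"
      using a(1,2,5) W by (simp add: Z.inc.add X.N.a_ac Z.M.a_ac)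
    then show ?thesis by (simp add: m m')
  qed
  have G_unique: "v = v'" if G: "G (x, y) v" and G': "G (x, y) v'" for x y v v'
  proof -
    have xy: "x \<in> carrier (middle X)" "y \<in> carrier (middle Y)"
      using G lcX lcY unfolding G_def by auto
    have "G (x \<oplus>\<^bsub>middle X\<^esub> (-1) \<odot>\<^bsub>middle X\<^esub> x, y \<oplus>\<^bsub>middle Y\<^esub> (-1) \<odot>\<^bsub>middle Y\<^esub> y)
        (v \<oplus>\<^bsub>middle Z\<^esub> (-1) \<odot>\<^bsub>middle Z\<^esub> v')"
      by (intro G_add G_smult G G')
    then have "v \<ominus>\<^bsub>middle Z\<^esub> v' = \<zero>\<^bsub>middle Z\<^esub>"
      using xy G_closed(1)[OF G] G_closed(1)[OF G']
      by (intro G_zero) (simp add: X.M.smult_l_minus Y.M.smult_l_minus Z.M.smult_l_minus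
          X.M.r_neg Y.M.r_neg Z.M.minus_eq)
    then show ?thesis using G_closed(1)[OF G] G_closed(1)[OF G'] by simp
  qed
  define \<psi> where "\<psi> z = (THE v. G z v)" for z
  have psi: "\<psi> (x, y) = v" if "G (x, y) v" for x y v
    unfolding \<psi>_def using that G_unique by blast
  have G_psi: "G (x, y) (\<psi> (x, y))" if "(x, y) \<in> fibre_product X Y" for x y
    using G_total[OF that] psi by metis
  show ?thesis
  proof (rule ext_equiv_baer_sumI[OF X Y Z])
    fix a b assume ab: "a \<in> carrier N" "b \<in> carrier N"
    have "lin_comb (middle X) r g (\<lambda>_. 0) = \<zero>\<^bsub>middle X\<^esub>" "lin_comb (middle Y) r h (\<lambda>_. 0) = \<zero>\<^bsub>middle Y\<^esub>"
      "lin_comb (middle Z) r k (\<lambda>_. 0) = \<zero>\<^bsub>middle Z\<^esub>"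
      using g(1) h(1) k(1) by (simp_all add: X.M.lin_comb_zero Y.M.lin_comb_zero Z.M.lin_comb_zero)
    then have "G (inc X a, inc Y b) (inc Z (a \<oplus>\<^bsub>N\<^esub> b))"
      unfolding G_def using ab by (intro exI[of _ "\<lambda>_. 0"] exI[of _ a] exI[of _ b]) simp
    then show "\<psi> (inc X a, inc Y b) = inc Z (a \<oplus>\<^bsub>N\<^esub> b)" by (rule psi)
  next
    fix x y assume "(x, y) \<in> fibre_product X Y"
    then have G: "G (x, y) (\<psi> (x, y))" by (rule G_psi)
    show "\<psi> (x, y) \<in> carrier (middle Z) \<and> prj Z (\<psi> (x, y)) = prj X x"
      using G_closed[OF G] by blast
    show "\<psi> (s \<odot>\<^bsub>middle X\<^esub> x, s \<odot>\<^bsub>middle Y\<^esub> y) = s \<odot>\<^bsub>middle Z\<^esub> \<psi> (x, y)" for s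
      by (rule psi[OF G_smult[OF G]])
    fix x' y' assume "(x', y') \<in> fibre_product X Y"
    then have G': "G (x', y') (\<psi> (x', y'))" by (rule G_psi)
    show "\<psi> (x \<oplus>\<^bsub>middle X\<^esub> x', y \<oplus>\<^bsub>middle Y\<^esub> y') = \<psi> (x, y) \<oplus>\<^bsub>middle Z\<^esub> \<psi> (x', y')"
      by (rule psi[OF G_add[OF G G']])
  qed
qed

text \<open>The sum of two classes is a union over all representatives; it collapses to a single class
  once every Baer sum of representatives is equivalent to the same extension.\<close>

lemma Ext_add_eqI:
  assumes "is_extension N Q Z" "\<xi> \<noteq> {}" "\<eta> \<noteq> {}"
    and equiv: "\<And>X Y. X \<in> \<xi> \<Longrightarrow> Y \<in> \<eta> \<Longrightarrow> ext_equiv N Z (baer_sum N X Y)"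
  shows "Ext_add N Q \<xi> \<eta> = ext_class N Q Z"
proof -
  have "ext_class N Q (baer_sum N X Y) = ext_class N Q Z" if "X \<in> \<xi>" "Y \<in> \<eta>" for X Y
    using equiv[OF that] ext_equiv_sym[OF assms(1) equiv[OF that]]
    by (auto simp: ext_class_def intro: ext_equiv_trans)
  then show ?thesis using assms(2,3) by (auto simp: Ext_add_def)
qed

section \<open>Polynomials in a matrix and the module of a matrix\<close>

lemma pow_mat_Suc_left: 
  assumes "A \<in> carrier_mat n n" shows "A ^\<^sub>m Suc k = A * A ^\<^sub>m k"
proof (induction k)
  case (Suc k)
  have "A ^\<^sub>m Suc (Suc k) = (A * A ^\<^sub>m k) * A" using Suc by simp
  also have "\<dots> = A * (A ^\<^sub>m k * A)"
    using assms by (intro assoc_mult_mat) (auto intro: pow_carrier_mat)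
  finally show ?case by simp
qed (use assms in simp)

lemma mult_mat_smult_vec:
  fixes A :: "'a::comm_ring_1 mat"
  assumes "A \<in> carrier_mat m n" "v \<in> carrier_vec n"
  shows "A *\<^sub>v (k \<cdot>\<^sub>v v) = k \<cdot>\<^sub>v (A *\<^sub>v v)"
  using assms by (intro eq_vecI) (auto simp: scalar_prod_def sum_distrib_left mult_ac)

lemma poly_mat_carrier [simp]: "A \<in> carrier_mat n n \<Longrightarrow> poly_mat f A \<in> carrier_mat n n"
  by (auto simp: poly_mat_def)

lemma poly_mat_bound:
  assumes "A \<in> carrier_mat n n" "i < n" "j < n" "degree f \<le> m"
  shows "poly_mat f A $$ (i, j) = (\<Sum>k\<le>m. coeff f k * (A ^\<^sub>m k) $$ (i, j))"
proof -
  have "(\<Sum>k\<le>degree f. coeff f k * (A ^\<^sub>m k) $$ (i, j)) = (\<Sum>k\<le>m. coeff f k * (A ^\<^sub>m k) $$ (i, j))"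
    using assms(4) by (intro sum.mono_neutral_left) (simp_all add: coeff_eq_0)
  then show ?thesis using assms by (auto simp: poly_mat_def)
qed

lemma poly_mat_0 [simp]: "A \<in> carrier_mat n n \<Longrightarrow> poly_mat 0 A = 0\<^sub>m n n"
  by (rule eq_matI) (auto simp: poly_mat_def)

lemma poly_mat_add:
  assumes "A \<in> carrier_mat n n"
  shows "poly_mat (f + g) A = poly_mat f A + poly_mat g A"
proof (rule eq_matI)
  let ?m = "max (degree f) (degree g)"
  fix i j assume "i < dim_row (poly_mat f A + poly_mat g A)" "j < dim_col (poly_mat f A + poly_mat g A)"
  then have ij: "i < n" "j < n" using assms by (auto simp: poly_mat_def)
  then show "poly_mat (f + g) A $$ (i, j) = (poly_mat f A + poly_mat g A) $$ (i, j)"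
    using assms by (simp add: poly_mat_bound[of A n i j _ ?m] degree_add_le carrier_matD[OF poly_mat_carrier]
        distrib_right sum.distrib)
qed (use assms in \<open>auto simp: poly_mat_def\<close>)

text \<open>The Horner step. It reduces statements about \<open>poly_mat\<close> to induction on the polynomial,
  avoiding the explicit sum over powers of the matrix.\<close>

lemma poly_mat_pCons:
  assumes A: "A \<in> carrier_mat n n"
  shows "poly_mat (pCons a f) A = a \<cdot>\<^sub>m 1\<^sub>m n + A * poly_mat f A"
proof (rule eq_matI)
  fix i j assume "i < dim_row (a \<cdot>\<^sub>m 1\<^sub>m n + A * poly_mat f A)" "j < dim_col (a \<cdot>\<^sub>m 1\<^sub>m n + A * poly_mat f A)"
  then have ij: "i < n" "j < n" using A by (auto simp: poly_mat_def)
  have pow: "A ^\<^sub>m k \<in> carrier_mat n n" for k using A by (rule pow_carrier_mat)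
  have "poly_mat (pCons a f) A $$ (i, j) = (\<Sum>k\<le>Suc (degree f). coeff (pCons a f) k * (A ^\<^sub>m k) $$ (i, j))"
    using A ij by (intro poly_mat_bound) (auto simp: degree_pCons_le)
  also have "\<dots> = a * (1\<^sub>m n) $$ (i, j) + (\<Sum>k\<le>degree f. coeff f k * (A ^\<^sub>m Suc k) $$ (i, j))"
    using A by (subst sum.atMost_Suc_shift) simp
  also have "(\<Sum>k\<le>degree f. coeff f k * (A ^\<^sub>m Suc k) $$ (i, j))
      = (\<Sum>k\<le>degree f. coeff f k * (\<Sum>l<n. A $$ (i, l) * (A ^\<^sub>m k) $$ (l, j)))"
    using A ij pow by (intro sum.cong refl)
      (simp add: pow_mat_Suc_left del: pow_mat.simps, simp add: scalar_prod_def atLeast0LessThan carrier_matD[OF pow])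
  also have "\<dots> = (\<Sum>l<n. A $$ (i, l) * (\<Sum>k\<le>degree f. coeff f k * (A ^\<^sub>m k) $$ (l, j)))"
    by (simp add: sum_distrib_left, subst sum.swap) (simp add: ac_simps)
  also have "\<dots> = (\<Sum>l<n. A $$ (i, l) * poly_mat f A $$ (l, j))"
    using A ij by (simp add: poly_mat_bound[of A n _ j f "degree f"])
  also have "\<dots> = (A * poly_mat f A) $$ (i, j)"
    using A ij by (simp add: scalar_prod_def atLeast0LessThan carrier_matD[OF poly_mat_carrier])
  finally show "poly_mat (pCons a f) A $$ (i, j) = (a \<cdot>\<^sub>m 1\<^sub>m n + A * poly_mat f A) $$ (i, j)"
    using A ij by (simp add: carrier_matD[OF poly_mat_carrier])
qed (use A in \<open>auto simp: poly_mat_def\<close>)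

lemma poly_mat_pCons_vec:
  assumes A: "A \<in> carrier_mat n n" and v: "v \<in> carrier_vec n"
  shows "poly_mat (pCons a f) A *\<^sub>v v = a \<cdot>\<^sub>v v + A *\<^sub>v (poly_mat f A *\<^sub>v v)"
proof -
  note f = poly_mat_carrier[OF A, of f]
  have "poly_mat (pCons a f) A *\<^sub>v v = (a \<cdot>\<^sub>m 1\<^sub>m n) *\<^sub>v v + (A * poly_mat f A) *\<^sub>v v"
    unfolding poly_mat_pCons[OF A] using A f v by (intro add_mult_distrib_mat_vec[of _ n n]) auto
  also have "(a \<cdot>\<^sub>m 1\<^sub>m n) *\<^sub>v v = a \<cdot>\<^sub>v v"
  proof (rule eq_vecI)
    fix i assume "i < dim_vec (a \<cdot>\<^sub>v v)"
    then have i: "i < n" using v by simp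
    have "(\<Sum>k = 0..<n. a * (if k = i then 1 else 0) * v $ k) = (\<Sum>k = 0..<n. if k = i then a * v $ k else 0)"
      by (intro sum.cong) auto
    then show "((a \<cdot>\<^sub>m 1\<^sub>m n) *\<^sub>v v) $ i = (a \<cdot>\<^sub>v v) $ i"
      using i v by (simp add: scalar_prod_def)
  qed (use v in simp)
  also have "(A * poly_mat f A) *\<^sub>v v = A *\<^sub>v (poly_mat f A *\<^sub>v v)"
    using A f v by (rule assoc_mult_mat_vec)
  finally show ?thesis .
qed

lemma poly_mat_const_vec:
  assumes A: "A \<in> carrier_mat n n" and v: "v \<in> carrier_vec n"
  shows "poly_mat [:a:] A *\<^sub>v v = a \<cdot>\<^sub>v v"
proof -
  have "0\<^sub>m n n *\<^sub>v v = 0\<^sub>v n" using v by (auto intro!: eq_vecI)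
  moreover have "A *\<^sub>v 0\<^sub>v n = 0\<^sub>v n" using A by (auto intro!: eq_vecI)
  ultimately show ?thesis using poly_mat_pCons_vec[OF A v, of a 0] v A by (simp add: poly_mat_0)
qed

lemma poly_mat_const: "A \<in> carrier_mat n n \<Longrightarrow> poly_mat [:a:] A = a \<cdot>\<^sub>m 1\<^sub>m n"
  by (simp add: poly_mat_pCons)

lemma poly_mat_smult:
  assumes A: "A \<in> carrier_mat n n"
  shows "poly_mat (Polynomial.smult a f) A = a \<cdot>\<^sub>m poly_mat f A"
  using A by (intro eq_matI)
    (auto simp: poly_mat_bound[of A n _ _ _ "degree f"] degree_smult_le sum_distrib_left ac_simps
      carrier_matD[OF poly_mat_carrier])

lemma zero_smult_one_mat [simp]: "(0 :: 'a :: comm_ring_1) \<cdot>\<^sub>m 1\<^sub>m n = 0\<^sub>m n n"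
  by (rule eq_matI) auto

lemma poly_mat_mult:
  assumes A: "A \<in> carrier_mat n n"
  shows "poly_mat (f * g) A = poly_mat f A * poly_mat g A"
proof (induction f)
  case (pCons a f)
  have "poly_mat (pCons a f * g) A = a \<cdot>\<^sub>m poly_mat g A + A * (poly_mat f A * poly_mat g A)"
  proof -
    have "A * (poly_mat f A * poly_mat g A) \<in> carrier_mat n n"
      using A by (meson mult_carrier_mat poly_mat_carrier)
    then show ?thesis
      using A pCons by (simp add: poly_mat_add poly_mat_smult poly_mat_pCons)
  qed
  also have "\<dots> = poly_mat (pCons a f) A * poly_mat g A"
  proof -
    have "(a \<cdot>\<^sub>m 1\<^sub>m n + A * poly_mat f A) * poly_mat g A
        = (a \<cdot>\<^sub>m 1\<^sub>m n) * poly_mat g A + (A * poly_mat f A) * poly_mat g A"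
      using A by (intro add_mult_distrib_mat[of _ n n _ _ n]) auto
    also have "(a \<cdot>\<^sub>m 1\<^sub>m n) * poly_mat g A = a \<cdot>\<^sub>m poly_mat g A"
      using poly_mat_carrier[OF A, of g]
      by (simp add: mult_smult_assoc_mat[of "1\<^sub>m n" n n "poly_mat g A" n a] left_mult_one_mat[of "poly_mat g A" n n])
    also have "(A * poly_mat f A) * poly_mat g A = A * (poly_mat f A * poly_mat g A)"
      using A by (intro assoc_mult_mat[of _ n n _ n _ n]) auto
    finally show ?thesis using A by (simp add: poly_mat_pCons)
  qed
  finally show ?case .
qed (use A in \<open>simp add: left_mult_zero_mat[OF poly_mat_carrier[OF A]]\<close>)

lemma poly_mat_1: "A \<in> carrier_mat n n \<Longrightarrow> poly_mat 1 A = 1\<^sub>m n"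
  using poly_mat_const[of A n 1] by (simp add: one_pCons, auto intro!: eq_matI)

lemma poly_mat_X: "A \<in> carrier_mat n n \<Longrightarrow> poly_mat [:0, 1:] A = A"
  using poly_mat_pCons[of A n 0 "[:1:]"] poly_mat_1[of A n] by (auto simp: one_pCons intro!: eq_matI)

lemma poly_mat_power:
  assumes A: "A \<in> carrier_mat n n"
  shows "poly_mat (f ^ l) A = poly_mat f A ^\<^sub>m l"
  using A by (induction l) (simp_all add: poly_mat_1 poly_mat_mult[OF A] mult.commute[of f] carrier_matD[OF poly_mat_carrier])

lemma mat_module_simps [simp]:
  "carrier (mat_module A) = carrier_vec (dim_row A)" "zero (mat_module A) = 0\<^sub>v (dim_row A)"
  "add (mat_module A) = (+)" "f \<odot>\<^bsub>mat_module A\<^esub> v = poly_mat f A *\<^sub>v v"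
  by (simp_all add: mat_module_def)

lemma mat_module_is_module:
  assumes A: "A \<in> carrier_mat n n"
  shows "module class_ring (mat_module A)"
proof (rule module_class_ringI)
  show "abelian_group (mat_module A)"
  proof (rule abelian_groupI)
    fix x assume "x \<in> carrier (mat_module A)"
    then show "\<exists>y\<in>carrier (mat_module A). y \<oplus>\<^bsub>mat_module A\<^esub> x = \<zero>\<^bsub>mat_module A\<^esub>"
      by (intro bexI[of _ "- x"]) (auto intro: uminus_l_inv_vec)
  qed (auto simp: assoc_add_vec comm_add_vec)
next
  fix a b :: "'a poly" and x y assume "x \<in> carrier (mat_module A)"
  then have x: "x \<in> carrier_vec n" using A by auto
  show "a \<odot>\<^bsub>mat_module A\<^esub> x \<in> carrier (mat_module A)"
    using A x by (simp add: mult_mat_vec_carrier[OF poly_mat_carrier])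
  show "(a + b) \<odot>\<^bsub>mat_module A\<^esub> x = a \<odot>\<^bsub>mat_module A\<^esub> x \<oplus>\<^bsub>mat_module A\<^esub> b \<odot>\<^bsub>mat_module A\<^esub> x"
    using A x by (simp add: poly_mat_add[OF A] add_mult_distrib_mat_vec[of _ n n])
  show "(a * b) \<odot>\<^bsub>mat_module A\<^esub> x = a \<odot>\<^bsub>mat_module A\<^esub> (b \<odot>\<^bsub>mat_module A\<^esub> x)"
    using A x by (simp add: poly_mat_mult[OF A] assoc_mult_mat_vec[of _ n n _ n])
  show "1 \<odot>\<^bsub>mat_module A\<^esub> x = x" using A x by (simp add: poly_mat_1[OF A])
  assume "y \<in> carrier (mat_module A)"
  then show "a \<odot>\<^bsub>mat_module A\<^esub> (x \<oplus>\<^bsub>mat_module A\<^esub> y) = a \<odot>\<^bsub>mat_module A\<^esub> x \<oplus>\<^bsub>mat_module A\<^esub> a \<odot>\<^bsub>mat_module A\<^esub> y"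
    using A x by (simp add: mult_add_distrib_mat_vec[of _ n n])
qed

text \<open>The abstract sum in the module is the sum of vectors, for which a formula for the
  coordinates is available.\<close>

lemma finsum_mat_module:
  assumes "(A :: 'a::comm_ring_1 mat) \<in> carrier_mat n n"
  shows "finsum (mat_module A) = finsum_vec TYPE('a) n"
proof -
  have "dim_row A = n" using assms by simp
  then show ?thesis
    by (intro ext) (simp add: finsum_def finsum_vec_def finprod_def monoid_vec_def)
qed

section \<open>Block companion matrices\<close>

text \<open>\<open>M\<close> of a block companion matrix is the direct sum of the \<open>R[t]/f\<^sub>i\<close>. For \<open>g\<close> of degree
  less than \<open>deg f\<^sub>j\<close> this is the coordinate vector of the class of \<open>g\<close> in the \<open>j\<close>-th summand; the
  coefficients of a larger \<open>g\<close> are cut off, not reduced modulo \<open>f\<^sub>j\<close>.\<close>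

definition block_coeffs :: "'a::comm_ring_1 poly list \<Rightarrow> nat \<Rightarrow> 'a poly \<Rightarrow> 'a vec" where
  "block_coeffs fs j g = vec (sum_list (map degree fs)) (\<lambda>i.
     let b = sum_list (map degree (take j fs)) in
     if b \<le> i \<and> i < b + degree (fs ! j) then coeff g (i - b) else 0)"

lemma block_coeffs_Cons_0:
  "block_coeffs (f # fs) 0 g = vec (degree f) (coeff g) @\<^sub>v 0\<^sub>v (sum_list (map degree fs))"
  by (rule eq_vecI) (auto simp: block_coeffs_def)

lemma block_coeffs_Cons_Suc:
  "block_coeffs (f # fs) (Suc j) g = 0\<^sub>v (degree f) @\<^sub>v block_coeffs fs j g"
  by (rule eq_vecI) (auto simp: block_coeffs_def Let_def add.assoc diff_diff_left)

lemma block_coeffs_carrier [simp]: "block_coeffs fs j g \<in> carrier_vec (sum_list (map degree fs))"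
  by (simp add: block_coeffs_def)

text \<open>Multiplication by \<open>t\<close> modulo \<open>f\<close>: the top coefficient of \<open>g\<close> is the multiple of \<open>f\<close> to
  be subtracted from \<open>t g\<close> to get back below degree \<open>deg f\<close>.\<close>

lemma companion_mat_mult_coeffs:
  "companion_mat f *\<^sub>v vec (degree f) (coeff g)
    = vec (degree f) (coeff (pCons 0 g - Polynomial.smult (coeff g (degree f - 1)) f))"
proof (rule eq_vecI)
  fix i assume "i < dim_vec (vec (degree f) (coeff (pCons 0 g - Polynomial.smult (coeff g (degree f - 1)) f)))"
  then have i: "i < degree f" by simp
  have "(companion_mat f *\<^sub>v vec (degree f) (coeff g)) $ i
      = (\<Sum>k<degree f. (if Suc k = degree f then - coeff f i else if i = Suc k then 1 else 0) * coeff g k)"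
    using i by (simp add: companion_mat_def scalar_prod_def atLeast0LessThan)
  also have "\<dots> = (\<Sum>k<degree f. (if k = degree f - 1 then - coeff f i * coeff g k else 0)
      + (if k = i - 1 then (if i = 0 then 0 else coeff g k) else 0))"
    using i by (intro sum.cong refl) auto
  also have "\<dots> = - coeff f i * coeff g (degree f - 1) + (if i = 0 then 0 else coeff g (i - 1))"
    using i by (simp add: sum.distrib)
  finally show "(companion_mat f *\<^sub>v vec (degree f) (coeff g)) $ i
      = vec (degree f) (coeff (pCons 0 g - Polynomial.smult (coeff g (degree f - 1)) f)) $ i"
    using i by (cases i) (simp_all add: mult.commute)
qed (simp add: companion_mat_def)

abbreviation block_companion :: "'a::comm_ring_1 poly list \<Rightarrow> 'a mat" where
  "block_companion fs \<equiv> diag_block_mat (map companion_mat fs)"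

lemma map_mat_diag_block_mat:
  assumes "f 0 = 0"
  shows "map_mat f (diag_block_mat Bs) = diag_block_mat (map (map_mat f) Bs)"
proof (induction Bs)
  case (Cons B Bs)
  have dim: "dim_row (diag_block_mat (map (map_mat f) Bs)) = dim_row (diag_block_mat Bs)"
    "dim_col (diag_block_mat (map (map_mat f) Bs)) = dim_col (diag_block_mat Bs)"
    by (simp_all flip: Cons.IH)
  have entry: "diag_block_mat (map (map_mat f) Bs) $$ (i, j) = f (diag_block_mat Bs $$ (i, j))"
    if "i < dim_row (diag_block_mat Bs)" "j < dim_col (diag_block_mat Bs)" for i j
    using that by (simp flip: Cons.IH)
  show ?case
    by (rule eq_matI) (use assms in \<open>auto simp: Let_def dim entry\<close>)
qed (auto intro!: eq_matI)

lemma companion_mat_carrier [simp]: "companion_mat f \<in> carrier_mat (degree f) (degree f)"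
  by (simp add: companion_mat_def)

lemma block_companion_carrier [simp]:
  "block_companion fs \<in> carrier_mat (sum_list (map degree fs)) (sum_list (map degree fs))"
  by (rule carrier_matI) (simp_all add: dim_diag_block_mat companion_mat_def o_def)

lemma block_companion_mult_coeffs:
  assumes "j < length fs"
  shows "block_companion fs *\<^sub>v block_coeffs fs j g
    = block_coeffs fs j (pCons 0 g - Polynomial.smult (coeff g (degree (fs ! j) - 1)) (fs ! j))"
  using assms
proof (induction fs arbitrary: j)
  case (Cons f fs)
  let ?n = "sum_list (map degree fs)"
  have D: "block_companion (f # fs) = four_block_mat (companion_mat f) (0\<^sub>m (degree f) ?n)
      (0\<^sub>m ?n (degree f)) (block_companion fs)"
    by (simp add: Let_def carrier_matD[OF block_companion_carrier] carrier_matD[OF companion_mat_carrier])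
  have mult: "block_companion (f # fs) *\<^sub>v (x @\<^sub>v y) = (companion_mat f *\<^sub>v x) @\<^sub>v (block_companion fs *\<^sub>v y)"
    if "x \<in> carrier_vec (degree f)" "y \<in> carrier_vec ?n" for x y
    unfolding D by (rule mult_mat_vec_split) (use that in auto)
  have zero: "companion_mat f *\<^sub>v 0\<^sub>v (degree f) = 0\<^sub>v (degree f)" "block_companion fs *\<^sub>v 0\<^sub>v ?n = 0\<^sub>v ?n"
    by (auto intro!: eq_vecI simp: companion_mat_def carrier_matD[OF block_companion_carrier])
  show ?case
  proof (cases j)
    case 0
    then show ?thesis
      using Cons.prems by (simp add: block_coeffs_Cons_0 mult zero companion_mat_mult_coeffs del: diag_block_mat.simps list.map)
  next
    case (Suc j')
    then show ?thesis
      using Cons by (simp add: block_coeffs_Cons_Suc mult zero del: diag_block_mat.simps list.map)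
  qed
qed simp

lemma block_coeffs_add: "block_coeffs fs j (g + h) = block_coeffs fs j g + block_coeffs fs j h"
  by (rule eq_vecI) (auto simp: block_coeffs_def Let_def)

lemma block_coeffs_const: "block_coeffs fs j [:a:] = a \<cdot>\<^sub>v block_coeffs fs j 1"
  by (rule eq_vecI) (auto simp: block_coeffs_def Let_def coeff_pCons split: nat.splits)

text \<open>\<open>g\<close> times the class of \<open>1\<close> is the class of \<open>g\<close>; as long as the degree stays below
  \<open>deg f\<^sub>j\<close>, no reduction occurs in the Horner steps.\<close>

lemma poly_mat_block_companion:
  assumes j: "j < length fs" and g: "degree g < degree (fs ! j)"
  shows "poly_mat g (block_companion fs) *\<^sub>v block_coeffs fs j 1 = block_coeffs fs j g"
  using g
proof (induction g)
  case 0
  show ?case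
    by (rule eq_vecI) (auto simp: poly_mat_0[OF block_companion_carrier] block_coeffs_def Let_def)
next
  case (pCons a g)
  let ?A = "block_companion fs" and ?n = "sum_list (map degree fs)" and ?h = "block_coeffs fs j 1"
  have "g = 0 \<or> Suc (degree g) < degree (fs ! j)"
    using pCons.prems by (auto split: if_splits)
  then have g: "degree g < degree (fs ! j)" "coeff g (degree (fs ! j) - 1) = 0"
    using pCons.prems by (auto simp: coeff_eq_0)
  have "poly_mat (pCons a g) ?A *\<^sub>v ?h = a \<cdot>\<^sub>v ?h + ?A *\<^sub>v (poly_mat g ?A *\<^sub>v ?h)"
    by (rule poly_mat_pCons_vec[where n = "?n"]) simp_all
  also have "\<dots> = block_coeffs fs j ([:a:] + pCons 0 g)"
    using pCons.IH[OF g(1)] g(2) j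
    by (simp add: block_companion_mult_coeffs block_coeffs_const block_coeffs_add del: add_pCons)
  finally show ?case by simp
qed

text \<open>In the last Horner step \<open>f\<^sub>j = a + t g\<close> with \<open>g\<close> of top coefficient \<open>1\<close>, so exactly one copy
  of \<open>f\<^sub>j\<close> is subtracted.\<close>

lemma block_companion_annihilated:
  assumes j: "j < length fs" and f: "monic (fs ! j)" "0 < degree (fs ! j)"
  shows "poly_mat (fs ! j) (block_companion fs) *\<^sub>v block_coeffs fs j 1 = 0\<^sub>v (sum_list (map degree fs))"
proof -
  let ?A = "block_companion fs" and ?n = "sum_list (map degree fs)" and ?h = "block_coeffs fs j 1"
  obtain a g where ag: "fs ! j = pCons a g" by (cases "fs ! j")
  have g: "degree g < degree (fs ! j)" "coeff g (degree (fs ! j) - 1) = 1"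
    using f by (auto simp: ag split: if_splits)
  have "poly_mat (fs ! j) ?A *\<^sub>v ?h = a \<cdot>\<^sub>v ?h + ?A *\<^sub>v (poly_mat g ?A *\<^sub>v ?h)"
    unfolding ag by (rule poly_mat_pCons_vec[where n = "?n"]) simp_all
  also have "\<dots> = block_coeffs fs j ([:a:] + (pCons 0 g - fs ! j))"
    using g j unfolding block_coeffs_add
    by (simp add: block_companion_mult_coeffs block_coeffs_const poly_mat_block_companion)
  also have "[:a:] + (pCons 0 g - fs ! j) = 0"
    by (simp add: ag)
  also have "block_coeffs fs j 0 = 0\<^sub>v ?n"
    by (rule eq_vecI) (auto simp: block_coeffs_def Let_def)
  finally show ?thesis .
qed

definition block_offset :: "'a::comm_ring_1 poly list \<Rightarrow> nat \<Rightarrow> nat" where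
  "block_offset fs j = sum_list (map degree (take j fs))"

lemma block_offset_Suc: "j < length fs \<Longrightarrow> block_offset fs (Suc j) = block_offset fs j + degree (fs ! j)"
  by (simp add: block_offset_def take_Suc_conv_app_nth)

lemma block_offset_mono:
  assumes "i \<le> j" shows "block_offset fs i \<le> block_offset fs j"
proof -
  have "block_offset fs j \<le> block_offset fs (Suc j)" for j
    by (cases "j < length fs") (simp_all add: block_offset_Suc, simp add: block_offset_def)
  then show ?thesis using assms by (rule lift_Suc_mono_le)
qed

lemma block_offset_length: "block_offset fs (length fs) = sum_list (map degree fs)"
  by (simp add: block_offset_def)

lemma block_index_bound:
  assumes "j < length fs" "k < degree (fs ! j)"
  shows "block_offset fs j + k < sum_list (map degree fs)"
  using block_offset_mono[of "Suc j" "length fs" fs] assms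
  by (simp add: block_offset_Suc block_offset_length)

text \<open>Together with the disjointness of blocks inside the next lemma, this says that the
  blocks partition the coordinates.\<close>

lemma ex_block_index:
  assumes "i < sum_list (map degree fs)"
  obtains j k where "j < length fs" "k < degree (fs ! j)" "i = block_offset fs j + k"
proof -
  define j where "j = (LEAST j. i < block_offset fs (Suc j))"
  have ex: "i < block_offset fs (length fs)" using assms by (simp add: block_offset_length)
  have fs: "length fs \<noteq> 0" using assms by auto
  have j: "i < block_offset fs (Suc j)"
    unfolding j_def by (rule LeastI[of _ "length fs - 1"]) (use ex fs in simp)
  have len: "j < length fs"
  proof -
    have "j \<le> length fs - 1" unfolding j_def by (rule Least_le) (use ex fs in simp)
    then show ?thesis using fs by linarith
  qed
  have "block_offset fs j \<le> i"
  proof (cases j)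
    case (Suc j')
    then show ?thesis
      using not_less_Least[of j' "\<lambda>j. i < block_offset fs (Suc j)"] unfolding j_def by simp
  qed (simp add: block_offset_def)
  with j len that[of j "i - block_offset fs j"] show thesis by (simp add: block_offset_Suc)
qed

lemma sum_block_coeffs:
  assumes "j < length fs" "k < degree (fs ! j)"
  shows "(\<Sum>j'<length fs. block_coeffs fs j' (a j') $ (block_offset fs j + k)) = coeff (a j) k"
proof -
  have "block_coeffs fs j' (a j') $ (block_offset fs j + k) = (if j' = j then coeff (a j) k else 0)"
    if "j' < length fs" for j'
  proof -
    have "block_offset fs j' \<le> block_offset fs j + k \<and>
        block_offset fs j + k < block_offset fs j' + degree (fs ! j') \<longleftrightarrow> j' = j"
    proof (cases j j' rule: linorder_cases)
      case less
      then have "block_offset fs (Suc j) \<le> block_offset fs j'" by (intro block_offset_mono) simp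
      with less assms show ?thesis by (simp add: block_offset_Suc)
    next
      case greater
      then have "block_offset fs (Suc j') \<le> block_offset fs j" by (intro block_offset_mono) simp
      with greater assms that show ?thesis by (simp add: block_offset_Suc)
    qed (use assms in simp)
    then show ?thesis
      using block_index_bound[OF assms] by (auto simp: block_coeffs_def Let_def simp flip: block_offset_def)
  qed
  then show ?thesis using assms(1) by simp
qed

abbreviation block_generator :: "'a::comm_ring_1 poly list \<Rightarrow> nat \<Rightarrow> 'a vec" where
  "block_generator fs j \<equiv> block_coeffs fs j 1"

text \<open>Coefficients below the block degrees can be read off from the coordinates. Both the
  spanning property and the absence of further relations are instances of this formula.\<close>

lemma lin_comb_block_generators:
  assumes a: "\<And>j. j < length fs \<Longrightarrow> degree (a j) < degree (fs ! j)"
    and "j < length fs" "k < degree (fs ! j)"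
  shows "lin_comb (mat_module (block_companion fs)) (length fs) (block_generator fs) a $ (block_offset fs j + k)
    = coeff (a j) k"
proof -
  have "lin_comb (mat_module (block_companion fs)) (length fs) (block_generator fs) a $ (block_offset fs j + k)
      = (\<Sum>i<length fs. (poly_mat (a i) (block_companion fs) *\<^sub>v block_generator fs i) $ (block_offset fs j + k))"
    unfolding lin_comb_def finsum_mat_module[OF block_companion_carrier]
    using block_index_bound[OF assms(2,3)]
    by (subst index_finsum_vec)
      (auto intro!: mult_mat_vec_carrier[of _ _ "sum_list (map degree fs)"])
  also have "\<dots> = (\<Sum>i<length fs. block_coeffs fs i (a i) $ (block_offset fs j + k))"
    using a by (intro sum.cong refl) (simp add: poly_mat_block_companion)
  finally show ?thesis by (simp add: sum_block_coeffs[OF assms(2,3)])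
qed

lemma block_companion_module:
  "cmodule (mat_module (block_companion fs))"
  by (rule cmodule.intro) (rule mat_module_is_module[OF block_companion_carrier])

lemma block_generators_generate:
  assumes fs: "\<And>j. j < length fs \<Longrightarrow> 0 < degree (fs ! j)" and v: "v \<in> carrier_vec (sum_list (map degree fs))"
  shows "\<exists>a. v = lin_comb (mat_module (block_companion fs)) (length fs) (block_generator fs) a"
proof -
  define a where "a j = Poly (map (\<lambda>k. v $ (block_offset fs j + k)) [0..<degree (fs ! j)])" for j
  let ?M = "mat_module (block_companion fs)" and ?n = "sum_list (map degree fs)"
  interpret cmodule ?M by (rule block_companion_module)
  have deg: "degree (a j) < degree (fs ! j)" if "j < length fs" for j
  proof -
    have "degree (a j) \<le> degree (fs ! j) - 1"
      unfolding a_def by (rule degree_le) (auto simp: nth_default_def)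
    then show ?thesis using fs[OF that] by simp
  qed
  have "v = lin_comb ?M (length fs) (block_generator fs) a"
  proof (rule eq_vecI)
    have "lin_comb ?M (length fs) (block_generator fs) a \<in> carrier ?M"
      by (rule lin_comb_closed) (simp add: carrier_matD[OF block_companion_carrier])
    then have "lin_comb ?M (length fs) (block_generator fs) a \<in> carrier_vec ?n"
      by (simp only: mat_module_simps carrier_matD[OF block_companion_carrier])
    then have dim: "dim_vec (lin_comb ?M (length fs) (block_generator fs) a) = ?n"
      by (rule carrier_vecD)
    then show "dim_vec v = dim_vec (lin_comb ?M (length fs) (block_generator fs) a)"
      using carrier_vecD[OF v] by (simp only:)
    fix i assume "i < dim_vec (lin_comb ?M (length fs) (block_generator fs) a)"
    then have "i < ?n" by (simp only: dim)
    then obtain j k where jk: "j < length fs" "k < degree (fs ! j)" "i = block_offset fs j + k"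
      by (rule ex_block_index)
    have "lin_comb ?M (length fs) (block_generator fs) a $ i = coeff (a j) k"
      unfolding jk(3) by (rule lin_comb_block_generators[OF deg jk(1,2)])
    then show "v $ i = lin_comb ?M (length fs) (block_generator fs) a $ i"
      using jk by (simp add: a_def nth_default_def)
  qed
  then show ?thesis by blast
qed

text \<open>Over a field each coefficient may be replaced by its remainder modulo \<open>f\<^sub>j\<close>, since
  \<open>f\<^sub>j\<close> kills the \<open>j\<close>-th generator; the remainders are then read off to be zero.\<close>

lemma block_generators_relation:
  fixes fs :: "'k::field poly list"
  assumes fs: "\<And>j. j < length fs \<Longrightarrow> monic (fs ! j) \<and> 0 < degree (fs ! j)"
    and b: "lin_comb (mat_module (block_companion fs)) (length fs) (block_generator fs) b = 0\<^sub>v (sum_list (map degree fs))"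
    and j: "j < length fs"
  shows "fs ! j dvd b j"
proof -
  let ?M = "mat_module (block_companion fs)"
  interpret cmodule ?M by (rule block_companion_module)
  have h: "block_generator fs j \<in> carrier ?M" for j
    by (simp add: carrier_matD[OF block_companion_carrier])
  have deg: "degree (b j mod fs ! j) < degree (fs ! j)" if "j < length fs" for j
  proof -
    have "fs ! j \<noteq> 0" using fs[OF that] by auto
    then show ?thesis using fs[OF that] degree_mod_less'[of "fs ! j" "b j"] by (cases "b j mod fs ! j = 0") auto
  qed
  have "lin_comb ?M (length fs) (block_generator fs) b
      = lin_comb ?M (length fs) (block_generator fs) (\<lambda>j. b j mod fs ! j)"
  proof (rule lin_comb_cong)
    fix j assume j: "j < length fs"
    have "b j \<odot>\<^bsub>?M\<^esub> block_generator fs j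
        = ((b j div fs ! j) * fs ! j + b j mod fs ! j) \<odot>\<^bsub>?M\<^esub> block_generator fs j"
      by (simp only: div_mult_mod_eq)
    also have "\<dots> = (b j div fs ! j) \<odot>\<^bsub>?M\<^esub> (fs ! j \<odot>\<^bsub>?M\<^esub> block_generator fs j)
        \<oplus>\<^bsub>?M\<^esub> (b j mod fs ! j) \<odot>\<^bsub>?M\<^esub> block_generator fs j"
      using h by (simp only: smult_l_distr smult_assoc)
    also have "fs ! j \<odot>\<^bsub>?M\<^esub> block_generator fs j = \<zero>\<^bsub>?M\<^esub>"
      using block_companion_annihilated[OF j] fs[OF j] by (simp add: carrier_matD[OF block_companion_carrier])
    finally show "b j \<odot>\<^bsub>?M\<^esub> block_generator fs j = (b j mod fs ! j) \<odot>\<^bsub>?M\<^esub> block_generator fs j"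
      using h smult_closed[OF h] by (simp only: smult_r_null l_zero)
  qed (rule h)
  then have "lin_comb ?M (length fs) (block_generator fs) (\<lambda>j. b j mod fs ! j) = 0\<^sub>v (sum_list (map degree fs))"
    using b by simp
  then have "coeff (b j mod fs ! j) k = 0" if "k < degree (fs ! j)" for k
    using lin_comb_block_generators[OF deg j that] block_index_bound[OF j that] by simp
  then have "b j mod fs ! j = 0"
    using deg[OF j] by (metis leading_coeff_0_iff)
  then show ?thesis by auto
qed

lemma monic_power_degree:
  fixes p :: "'a::comm_ring_1 poly"
  assumes "monic p"
  shows "monic (p ^ l)" "degree (p ^ l) = degree p * l"
proof -
  have "monic (p ^ l) \<and> degree (p ^ l) = degree p * l"
  proof (induction l)
    case (Suc l)
    have "coeff (p * p ^ l) (degree p + degree (p ^ l)) = 1"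
      unfolding coeff_mult_degree_sum using assms Suc.IH by (metis mult_1)
    moreover from this have "degree (p * p ^ l) = degree p + degree (p ^ l)"
      by (intro antisym degree_mult_le le_degree) simp
    ultimately show ?case using Suc by simp
  qed simp
  then show "monic (p ^ l)" "degree (p ^ l) = degree p * l" by blast+
qed

text \<open>Each exponent is at least one, so every block is nonempty and its first basis vector is
  the class of \<open>1\<close>.\<close>

lemma block_vec_eq_block_generator:
  fixes q :: "'a::comm_ring_1 poly"
  assumes q: "monic q" "0 < degree q" and lam: "\<forall>l\<in>set lam. 1 \<le> l" and j: "j < length lam"
  shows "block_vec (degree q * sum_list lam) (degree q) lam j = block_generator (map (\<lambda>l. q ^ l) lam) j"
proof -
  have deg: "map degree (map (\<lambda>l. q ^ l) ls) = map ((*) (degree q)) ls" for ls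
    by (simp add: monic_power_degree[OF q(1)])
  have "1 \<le> lam ! j" using lam j by simp
  then have pos: "0 < degree (map (\<lambda>l. q ^ l) lam ! j)"
    using j q by (simp add: monic_power_degree[OF q(1)])
  show ?thesis
    unfolding block_vec_def block_coeffs_def take_map deg sum_list_const_mult
    by (rule eq_vecI) (use pos in \<open>auto simp: unit_vec_def Let_def\<close>)
qed

section \<open>Restriction of scalars\<close>

lemma restrict_scalars_simps [simp]:
  "carrier (restrict_scalars \<phi> M) = carrier M" "zero (restrict_scalars \<phi> M) = zero M"
  "add (restrict_scalars \<phi> M) = add M" "s \<odot>\<^bsub>restrict_scalars \<phi> M\<^esub> x = \<phi> s \<odot>\<^bsub>M\<^esub> x"
  by (simp_all add: restrict_scalars_def)

lemma restrict_ext_simps [simp]: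
  "middle (restrict_ext \<phi> X) = restrict_scalars \<phi> (middle X)" "inc (restrict_ext \<phi> X) = inc X"
  "prj (restrict_ext \<phi> X) = prj X"
  by (simp_all add: restrict_ext_def)

lemma finsum_restrict_scalars [simp]: "finsum (restrict_scalars \<phi> M) f S = finsum M f S"
  by (simp add: finsum_def finprod_def)

lemma lin_comb_restrict_scalars [simp]:
  "lin_comb (restrict_scalars \<phi> M) r g a = lin_comb M r g (\<lambda>i. \<phi> (a i))"
  by (simp add: lin_comb_def)

lemma module_restrict_scalars:
  fixes \<phi> :: "'s::comm_ring_1 \<Rightarrow> 'a::comm_ring_1"
  assumes "comm_ring_hom \<phi>" "module class_ring M"
  shows "module class_ring (restrict_scalars \<phi> M)"
proof -
  interpret comm_ring_hom \<phi> by fact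
  interpret M: cmodule M by (rule cmodule.intro) fact
  have "abelian_group (restrict_scalars \<phi> M)"
  proof (rule abelian_groupI)
    fix x assume "x \<in> carrier (restrict_scalars \<phi> M)"
    then show "\<exists>y\<in>carrier (restrict_scalars \<phi> M).
        y \<oplus>\<^bsub>restrict_scalars \<phi> M\<^esub> x = \<zero>\<^bsub>restrict_scalars \<phi> M\<^esub>"
      by (intro bexI[of _ "\<ominus>\<^bsub>M\<^esub> x"]) (simp_all add: M.l_neg)
  qed (simp_all add: M.a_ac)
  then show ?thesis
    by (rule module_class_ringI)
      (simp_all add: hom_add hom_mult M.smult_l_distr M.smult_r_distr M.smult_assoc)
qed

lemma module_hom_restrict_scalars:
  "f \<in> module_hom class_ring M N \<Longrightarrow>
    f \<in> module_hom class_ring (restrict_scalars \<phi> M) (restrict_scalars \<phi> N)"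
  by (simp add: LinearCombinations.module_hom_def)

lemma is_extension_restrict:
  fixes \<phi> :: "'s::comm_ring_1 \<Rightarrow> 'a::comm_ring_1"
  assumes "comm_ring_hom \<phi>" "is_extension N Q X"
  shows "is_extension (restrict_scalars \<phi> N) (restrict_scalars \<phi> Q) (restrict_ext \<phi> X)"
  using assms unfolding is_extension_def
  by (simp add: module_restrict_scalars module_hom_restrict_scalars)

lemma ext_equiv_restrict:
  assumes "ext_equiv N X Y"
  shows "ext_equiv (restrict_scalars \<phi> N) (restrict_ext \<phi> X) (restrict_ext \<phi> Y)"
  using assms module_hom_restrict_scalars unfolding ext_equiv_def
  by (simp only: restrict_ext_simps restrict_scalars_simps) blast

section \<open>The residue map of a local ring of length two\<close>

lemma comm_ring_hom_map_poly:
  assumes "comm_ring_hom f" shows "comm_ring_hom (map_poly f)"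
proof -
  interpret comm_ring_hom f by fact
  have "map_poly f (p * q) = map_poly f p * map_poly f q" for p q
    by (rule poly_eqI) (simp add: coeff_mult coeff_map_poly hom_sum hom_mult)
  moreover have "map_poly f (p + q) = map_poly f p + map_poly f q" for p q
    by (rule poly_eqI) (simp add: coeff_map_poly hom_add)
  ultimately show ?thesis by unfold_locales simp_all
qed

text \<open>A local principal ideal ring of length two enters through two facts: the maximal ideal
  \<open>(\<pi>)\<close> is both the kernel of the residue map and the annihilator of \<open>\<pi>\<close>. Thus multiplication by \<open>\<pi>\<close>
  identifies the residue field with \<open>(\<pi>)\<close>.\<close>

locale length_two_residue_map = comm_ring_hom \<rho> for \<rho> :: "'r::comm_ring_1 \<Rightarrow> 'k::field" +
  fixes \<pi> :: 'r
  assumes surj: "surj \<rho>"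
    and ker: "\<rho> x = 0 \<longleftrightarrow> (\<exists>y. x = \<pi> * y)"
    and ann: "\<pi> * y = 0 \<longleftrightarrow> \<rho> y = 0"

lemma PIdl_class_ring: "PIdl\<^bsub>class_ring\<^esub> (a :: 'r::comm_ring_1) = range (\<lambda>y. y * a)"
  by (auto simp: cgenideal_def)

text \<open>The first term of the composition series is a maximal ideal, hence equals \<open>m = (\<pi>)\<close>, and
  it is a minimal nonzero ideal. If \<open>\<pi>\<^sup>2\<close> were nonzero, minimality would give \<open>\<pi> = a \<pi>\<^sup>2\<close>, so
  \<open>u = 1 - a \<pi>\<close> would kill \<open>\<pi>\<close>. The ring would then split, with \<open>(u)\<close> as a second maximal ideal,
  contradicting locality. Once \<open>\<pi>\<^sup>2 = 0\<close>, an element killing \<open>\<pi>\<close> cannot be invertible modulo \<open>\<pi>\<close>.\<close>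

lemma length_two_residue_mapI:
  fixes \<pi> :: "'r::comm_ring_1" and \<rho> :: "'r \<Rightarrow> 'k::field"
  assumes R: "local_pir_length_two \<pi>" and hom: "comm_ring_hom \<rho>" and surj: "surj \<rho>"
    and ker: "{x. \<rho> x = 0} = PIdl\<^bsub>class_ring\<^esub> \<pi>"
  shows "length_two_residue_map \<rho> \<pi>"
proof -
  interpret comm_ring_hom \<rho> by (rule hom)
  define m where "m = PIdl\<^bsub>class_ring\<^esub> \<pi>"
  have ideal_PIdl: "ideal (PIdl\<^bsub>class_ring\<^esub> a) class_ring" for a :: 'r
    by (rule cring.cgenideal_ideal) (auto intro: class_cring.cring_axioms)
  have max: "{I. maximalideal I (class_ring :: 'r ring)} = {m}"
    using R by (simp add: local_pir_length_two_def m_def)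
  obtain I :: "nat \<Rightarrow> 'r set" where I: "I 0 = {0}" "I 2 = UNIV" "\<And>i. i \<le> 2 \<Longrightarrow> ideal (I i) class_ring"
    "\<And>i. i < 2 \<Longrightarrow> I i \<subset> I (Suc i)"
    "\<And>i J. i < 2 \<Longrightarrow> ideal J class_ring \<Longrightarrow> I i \<subset> J \<Longrightarrow> \<not> J \<subset> I (Suc i)"
    using R unfolding local_pir_length_two_def has_length_def by auto
  have "maximalideal (I 1) class_ring"
  proof (rule maximalidealI)
    show "ideal (I 1) class_ring" using I(3) by simp
    show "carrier class_ring \<noteq> I 1" using I(4)[of 1] I(2) by (auto simp: numeral_2_eq_2)
    fix J :: "'r set" assume "ideal J class_ring" "I 1 \<subseteq> J" "J \<subseteq> carrier class_ring"
    then show "J = I 1 \<or> J = carrier class_ring"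
      using I(5)[of 1 J] I(2) by (auto simp: numeral_2_eq_2)
  qed
  then have I1: "I 1 = m" using max by blast
  have m0: "{0} \<subset> m" using I(4)[of 0] I(1) I1 by simp
  have minimal: "J = {0} \<or> J = m" if "ideal J class_ring" "J \<subseteq> m" for J
    using I(5)[of 0 J] I(1) I1 that additive_subgroup.zero_closed[OF ideal.axioms(1)[OF that(1)]] by auto
  have kerm: "\<rho> x = 0 \<longleftrightarrow> x \<in> m" for x using ker unfolding m_def by blast
  have mem: "x \<in> m \<longleftrightarrow> (\<exists>y. x = \<pi> * y)" for x
    by (auto simp: m_def PIdl_class_ring mult.commute)
  have mult_mem: "y * (a * \<pi>) \<in> m" for y a
    unfolding mem by (rule exI[of _ "y * a"]) (simp add: mult_ac)
  have "\<pi> \<noteq> 0" using m0 mem by auto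
  have "\<rho> \<pi> = 0" using kerm mem by (metis mult.right_neutral)
  have sq: "\<pi> * \<pi> = 0"
  proof (rule ccontr)
    assume nz: "\<pi> * \<pi> \<noteq> 0"
    have "PIdl\<^bsub>class_ring\<^esub> (\<pi> * \<pi>) \<subseteq> m" by (auto simp: PIdl_class_ring mult_mem)
    moreover have "\<pi> * \<pi> \<in> PIdl\<^bsub>class_ring\<^esub> (\<pi> * \<pi>)" by (auto simp: PIdl_class_ring intro: range_eqI[of _ _ 1])
    ultimately have "PIdl\<^bsub>class_ring\<^esub> (\<pi> * \<pi>) = m" using minimal[OF ideal_PIdl] nz by blast
    moreover have "\<pi> \<in> m" using mem by (metis mult.right_neutral)
    ultimately obtain a where a: "\<pi> = a * (\<pi> * \<pi>)" by (auto simp: PIdl_class_ring)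
    define u where "u = 1 - a * \<pi>"
    have pu: "\<pi> * u = 0" using a by (simp add: u_def algebra_simps)
    have "\<rho> u = 1" using \<open>\<rho> \<pi> = 0\<close> by (simp add: u_def hom_distribs)
    (* An ideal J above (u) with x in J outside (u) contains the nonzero element x a \<pi> of m, hence
       all of m by minimality, hence a \<pi> and so 1 = a \<pi> + u. *)
    have "maximalideal (PIdl\<^bsub>class_ring\<^esub> u) class_ring"
    proof (rule maximalidealI[OF ideal_PIdl])
      show "carrier class_ring \<noteq> PIdl\<^bsub>class_ring\<^esub> u"
      proof
        assume "carrier class_ring = PIdl\<^bsub>class_ring\<^esub> u"
        moreover have "(1 :: 'r) \<in> carrier class_ring" by simp
        ultimately have "1 \<in> PIdl\<^bsub>class_ring\<^esub> u" by (simp only:)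
        then obtain b where "1 = b * u" by (auto simp: PIdl_class_ring)
        then have "\<pi> = b * (\<pi> * u)" by (metis mult.left_commute mult.right_neutral)
        then show False using pu \<open>\<pi> \<noteq> 0\<close> by simp
      qed
      fix J :: "'r set" assume J: "ideal J class_ring" "PIdl\<^bsub>class_ring\<^esub> u \<subseteq> J" "J \<subseteq> carrier class_ring"
      have J_mult: "y * x \<in> J" if "x \<in> J" for x y
        using ideal.I_l_closed[OF J(1) that, of y] by simp
      have J_add: "x + y \<in> J" if "x \<in> J" "y \<in> J" for x y
        using additive_subgroup.a_closed[OF ideal.axioms(1)[OF J(1)] that] by simp
      have uJ: "y * u \<in> J" for y using J(2) by (auto simp: PIdl_class_ring)
      show "J = PIdl\<^bsub>class_ring\<^esub> u \<or> J = carrier class_ring"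
      proof (rule disjCI)
        assume "J \<noteq> carrier class_ring"
        have "J \<subseteq> PIdl\<^bsub>class_ring\<^esub> u"
        proof
          fix x assume x: "x \<in> J"
          have split: "x = x * (a * \<pi>) + x * u" by (simp add: u_def algebra_simps)
          show "x \<in> PIdl\<^bsub>class_ring\<^esub> u"
          proof (cases "x * (a * \<pi>) = 0")
            case True
            then show ?thesis using split by (auto simp: PIdl_class_ring)
          next
            case False
            have "x * (a * \<pi>) \<in> J" using J_mult[OF x, of "a * \<pi>"] by (simp add: mult.commute)
            then have sub: "PIdl\<^bsub>class_ring\<^esub> (x * (a * \<pi>)) \<subseteq> J" by (auto simp: PIdl_class_ring J_mult)
            have "PIdl\<^bsub>class_ring\<^esub> (x * (a * \<pi>)) \<subseteq> m"
              using mult_mem[of _ "x * a"] by (auto simp: PIdl_class_ring mult.assoc)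
            moreover have "x * (a * \<pi>) \<in> PIdl\<^bsub>class_ring\<^esub> (x * (a * \<pi>))"
              by (auto simp: PIdl_class_ring intro: range_eqI[of _ _ 1])
            ultimately have "PIdl\<^bsub>class_ring\<^esub> (x * (a * \<pi>)) = m"
              using minimal[OF ideal_PIdl] False by blast
            then have "a * \<pi> \<in> J" using sub mem by (metis mult.commute subsetD)
            then have "a * \<pi> + 1 * u \<in> J" by (intro J_add uJ)
            then have "1 \<in> J" by (simp add: u_def)
            then have "J = UNIV" using J_mult[of 1] by auto
            with \<open>J \<noteq> carrier class_ring\<close> show ?thesis by simp
          qed
        qed
        with J(2) show "J = PIdl\<^bsub>class_ring\<^esub> u" by blast
      qed
    qed
    then have "PIdl\<^bsub>class_ring\<^esub> u = m" using max by blast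
    moreover have "u \<in> PIdl\<^bsub>class_ring\<^esub> u" by (auto simp: PIdl_class_ring intro: range_eqI[of _ _ 1])
    ultimately have "\<rho> u = 0" using kerm by simp
    with \<open>\<rho> u = 1\<close> show False by simp
  qed
  show ?thesis
  proof (unfold_locales)
    show "surj \<rho>" by (rule surj)
    show "\<rho> x = 0 \<longleftrightarrow> (\<exists>y. x = \<pi> * y)" for x using kerm mem by simp
    show "\<pi> * y = 0 \<longleftrightarrow> \<rho> y = 0" for y
    proof
      assume y: "\<pi> * y = 0"
      show "\<rho> y = 0"
      proof (rule ccontr)
        assume "\<rho> y \<noteq> 0"
        obtain z where z: "\<rho> z = inverse (\<rho> y)" using surj by (metis surjD)
        have "\<rho> (z * y - 1) = 0" using z \<open>\<rho> y \<noteq> 0\<close> by (simp add: hom_distribs)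
        then obtain w where "z * y - 1 = \<pi> * w" using kerm mem by auto
        then have "\<pi> * (z * y - 1) = (\<pi> * \<pi>) * w" by (simp add: mult.assoc)
        then have "z * (\<pi> * y) - \<pi> = 0" using sq by (simp add: algebra_simps)
        with y \<open>\<pi> \<noteq> 0\<close> show False by simp
      qed
    next
      assume "\<rho> y = 0"
      then obtain w where "y = \<pi> * w" using kerm mem by auto
      then have "\<pi> * y = (\<pi> * \<pi>) * w" by (simp add: mult.assoc)
      then show "\<pi> * y = 0" using sq by simp
    qed
  qed
qed

context length_two_residue_map
begin

lemma pi_sq: "\<pi> * \<pi> = 0" and hom_pi [simp]: "\<rho> \<pi> = 0"
proof -
  show "\<rho> \<pi> = 0" using ker by (metis mult.right_neutral)
  then show "\<pi> * \<pi> = 0" using ann by simp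
qed

lemma ex_map_vec:
  assumes "x \<in> carrier_vec n" obtains y where "y \<in> carrier_vec n" "map_vec \<rho> y = x"
proof (rule that)
  show "map_vec (inv_into UNIV \<rho>) x \<in> carrier_vec n" using assms by simp
  show "map_vec \<rho> (map_vec (inv_into UNIV \<rho>) x) = x" by (rule eq_vecI) (simp_all add: surj_f_inv_f[OF surj])
qed

lemma smult_pi_eq_iff:
  assumes "y \<in> carrier_vec n" "y' \<in> carrier_vec n"
  shows "\<pi> \<cdot>\<^sub>v y = \<pi> \<cdot>\<^sub>v y' \<longleftrightarrow> map_vec \<rho> y = map_vec \<rho> y'"
proof -
  have "\<pi> * a = \<pi> * b \<longleftrightarrow> \<rho> a = \<rho> b" for a b
    using ann[of "a - b"] by (simp add: right_diff_distrib hom_distribs)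
  then show ?thesis using assms by (simp add: vec_eq_iff)
qed

lemma ex_smult_pi:
  assumes "y \<in> carrier_vec n" "map_vec \<rho> y = 0\<^sub>v n"
  obtains z where "z \<in> carrier_vec n" "y = \<pi> \<cdot>\<^sub>v z"
proof -
  have "\<exists>w. y $ i = \<pi> * w" if "i < n" for i
  proof -
    have "\<rho> (y $ i) = map_vec \<rho> y $ i" using assms(1) that by simp
    then show ?thesis using assms(2) that ker by simp
  qed
  then obtain w where w: "\<And>i. i < n \<Longrightarrow> y $ i = \<pi> * w i" by metis
  show thesis
    by (rule that[of "vec n w"]) (use assms(1) w in \<open>auto intro!: eq_vecI\<close>)
qed

lemma map_mat_poly_mat:
  assumes B: "B \<in> carrier_mat n n"
  shows "map_mat \<rho> (poly_mat f B) = poly_mat (map_poly \<rho> f) (map_mat \<rho> B)"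
proof (induction f)
  case (pCons a f)
  have "map_mat \<rho> (poly_mat (pCons a f) B) = map_mat \<rho> (a \<cdot>\<^sub>m 1\<^sub>m n) + map_mat \<rho> (B * poly_mat f B)"
    using B poly_mat_carrier[OF B, of f] unfolding poly_mat_pCons[OF B]
    by (intro eq_matI) (auto simp: hom_add carrier_matD[OF poly_mat_carrier])
  also have "map_mat \<rho> (a \<cdot>\<^sub>m 1\<^sub>m n) = \<rho> a \<cdot>\<^sub>m 1\<^sub>m n"
    by (rule eq_matI) (auto simp: hom_distribs)
  also have "map_mat \<rho> (B * poly_mat f B) = map_mat \<rho> B * poly_mat (map_poly \<rho> f) (map_mat \<rho> B)"
    using mat_hom_mult[OF B poly_mat_carrier[OF B]] pCons.IH by simp
  finally show ?case
    using B by (simp add: poly_mat_pCons[of "map_mat \<rho> B" n] hom_distribs)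
qed (use B in \<open>auto simp: poly_mat_0 intro!: eq_matI\<close>)

lemma map_vec_poly_mat:
  assumes B: "B \<in> carrier_mat n n" and v: "v \<in> carrier_vec n"
  shows "map_vec \<rho> (poly_mat f B *\<^sub>v v) = poly_mat (map_poly \<rho> f) (map_mat \<rho> B) *\<^sub>v map_vec \<rho> v"
  using mult_mat_vec_hom[OF poly_mat_carrier[OF B] v] map_mat_poly_mat[OF B] by simp

end

section \<open>The extension attached to a lift of a matrix\<close>

context length_two_residue_map
begin

text \<open>\<open>M\<close> of the residual matrix, as a module over \<open>R[t]\<close>. It is both the submodule and the
  quotient in the extension attached to \<open>B\<close>.\<close>

abbreviation residue_module :: "'r mat \<Rightarrow> ('r poly, 'k vec) module" where
  "residue_module B \<equiv> restrict_scalars (map_poly \<rho>) (mat_module (map_mat \<rho> B))"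

text \<open>Since \<open>\<pi>\<close> kills exactly the vectors that reduce to zero, the lift chosen in \<open>lift_ext\<close> does
  not matter.\<close>

lemma inc_lift_ext:
  assumes "B \<in> carrier_mat n n" and y: "y \<in> carrier_vec n"
  shows "inc (lift_ext \<pi> \<rho> B) (map_vec \<rho> y) = \<pi> \<cdot>\<^sub>v y"
proof -
  define z where "z = (SOME z. z \<in> carrier_vec n \<and> map_vec \<rho> z = map_vec \<rho> y)"
  have "z \<in> carrier_vec n \<and> map_vec \<rho> z = map_vec \<rho> y"
    unfolding z_def by (rule someI[of _ y]) (use y in simp)
  then have "\<pi> \<cdot>\<^sub>v z = \<pi> \<cdot>\<^sub>v y" using smult_pi_eq_iff[of z n y] y by simp
  moreover have "dim_row B = n" using assms(1) by simp
  ultimately show ?thesis by (simp add: lift_ext_def z_def)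
qed

lemma lift_ext_simps [simp]:
  "middle (lift_ext \<pi> \<rho> B) = mat_module B" "prj (lift_ext \<pi> \<rho> B) = map_vec \<rho>"
  by (simp_all add: lift_ext_def)

lemma is_extension_lift_ext:
  assumes B: "B \<in> carrier_mat n n"
  shows "is_extension (residue_module B) (residue_module B) (lift_ext \<pi> \<rho> B)"
proof -
  have dim: "dim_row B = n" using B by simp
  have mod: "module class_ring (residue_module B)"
    using B by (intro module_restrict_scalars comm_ring_hom_map_poly comm_ring_hom_axioms mat_module_is_module) auto
  have modB: "module class_ring (mat_module B)" using B by (rule mat_module_is_module)
  let ?i = "inc (lift_ext \<pi> \<rho> B)"
  have inc_hom: "?i \<in> module_hom class_ring (residue_module B) (mat_module B)"
  proof (rule module_homI)
    fix x assume "x \<in> carrier (residue_module B)"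
    then have "x \<in> carrier_vec n" using dim by simp
    then obtain y where y: "y \<in> carrier_vec n" "map_vec \<rho> y = x" by (rule ex_map_vec)
    have i: "?i x = \<pi> \<cdot>\<^sub>v y" using inc_lift_ext[OF B y(1)] y(2) by simp
    show "?i x \<in> carrier (mat_module B)" using y i dim by simp
    show "?i (f \<odot>\<^bsub>residue_module B\<^esub> x) = f \<odot>\<^bsub>mat_module B\<^esub> ?i x" for f
    proof -
      have "f \<odot>\<^bsub>residue_module B\<^esub> x = map_vec \<rho> (poly_mat f B *\<^sub>v y)"
        using map_vec_poly_mat[OF B y(1)] y(2) by simp
      moreover have "poly_mat f B *\<^sub>v y \<in> carrier_vec n"
        using mult_mat_vec_carrier[OF poly_mat_carrier[OF B] y(1)] .
      ultimately have "?i (f \<odot>\<^bsub>residue_module B\<^esub> x) = \<pi> \<cdot>\<^sub>v (poly_mat f B *\<^sub>v y)"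
        using inc_lift_ext[OF B] by metis
      also have "\<dots> = poly_mat f B *\<^sub>v (\<pi> \<cdot>\<^sub>v y)"
        using mult_mat_smult_vec[OF poly_mat_carrier[OF B] y(1)] by simp
      finally show ?thesis by (simp add: i)
    qed
    fix x' assume "x' \<in> carrier (residue_module B)"
    then have "x' \<in> carrier_vec n" using dim by simp
    then obtain y' where y': "y' \<in> carrier_vec n" "map_vec \<rho> y' = x'" by (rule ex_map_vec)
    have i': "?i x' = \<pi> \<cdot>\<^sub>v y'" using inc_lift_ext[OF B y'(1)] y'(2) by simp
    have "x + x' = map_vec \<rho> (y + y')"
      using y y' by (auto simp: hom_distribs intro!: eq_vecI)
    then have "?i (x + x') = \<pi> \<cdot>\<^sub>v (y + y')"
      using inc_lift_ext[OF B, of "y + y'"] y(1) y'(1) by simp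
    then show "?i (x \<oplus>\<^bsub>residue_module B\<^esub> x') = ?i x \<oplus>\<^bsub>mat_module B\<^esub> ?i x'"
      using y(1) y'(1) by (simp add: i i' smult_add_distrib_vec[of _ n])
  qed
  have prj_hom: "map_vec \<rho> \<in> module_hom class_ring (mat_module B) (residue_module B)"
  proof (rule module_homI)
    fix x assume "x \<in> carrier (mat_module B)"
    then have x: "x \<in> carrier_vec n" using dim by simp
    then show "map_vec \<rho> x \<in> carrier (residue_module B)" using dim by simp
    show "map_vec \<rho> (f \<odot>\<^bsub>mat_module B\<^esub> x) = f \<odot>\<^bsub>residue_module B\<^esub> map_vec \<rho> x" for f
      using map_vec_poly_mat[OF B x] by simp
    fix y assume "y \<in> carrier (mat_module B)"
    then show "map_vec \<rho> (x \<oplus>\<^bsub>mat_module B\<^esub> y) = map_vec \<rho> x \<oplus>\<^bsub>residue_module B\<^esub> map_vec \<rho> y"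
      using x dim by (auto simp: hom_distribs intro!: eq_vecI)
  qed
  have inj: "inj_on ?i (carrier_vec n)"
  proof (rule inj_onI)
    fix x x' assume x: "x \<in> carrier_vec n" and x': "x' \<in> carrier_vec n" and eq: "?i x = ?i x'"
    obtain y where y: "y \<in> carrier_vec n" "map_vec \<rho> y = x" using x by (rule ex_map_vec)
    obtain y' where y': "y' \<in> carrier_vec n" "map_vec \<rho> y' = x'" using x' by (rule ex_map_vec)
    show "x = x'"
      using eq inc_lift_ext[OF B y(1)] inc_lift_ext[OF B y'(1)] smult_pi_eq_iff[OF y(1) y'(1)] y(2) y'(2)
      by simp
  qed
  have surj: "map_vec \<rho> ` carrier_vec n = carrier_vec n"
  proof -
    have "x \<in> map_vec \<rho> ` carrier_vec n" if "x \<in> carrier_vec n" for x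
      using that by (rule ex_map_vec) blast
    then show ?thesis by auto
  qed
  have exact: "?i ` carrier_vec n = {x \<in> carrier_vec n. map_vec \<rho> x = 0\<^sub>v n}"
  proof (rule Set.set_eqI, rule iffI)
    fix z assume "z \<in> ?i ` carrier_vec n"
    then obtain x where x: "x \<in> carrier_vec n" "z = ?i x" by blast
    obtain y where y: "y \<in> carrier_vec n" "map_vec \<rho> y = x" using x(1) by (rule ex_map_vec)
    have "z = \<pi> \<cdot>\<^sub>v y" using inc_lift_ext[OF B y(1)] y(2) x(2) by simp
    moreover have "map_vec \<rho> (\<pi> \<cdot>\<^sub>v y) = 0\<^sub>v n"
      using y(1) by (auto simp: hom_distribs intro!: eq_vecI)
    ultimately show "z \<in> {x \<in> carrier_vec n. map_vec \<rho> x = 0\<^sub>v n}" using y(1) by simp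
  next
    fix z assume "z \<in> {x \<in> carrier_vec n. map_vec \<rho> x = 0\<^sub>v n}"
    then obtain y where y: "y \<in> carrier_vec n" "z = \<pi> \<cdot>\<^sub>v y" using ex_smult_pi[of z n] by blast
    have "z = ?i (map_vec \<rho> y)" using inc_lift_ext[OF B y(1)] y(2) by simp
    then show "z \<in> ?i ` carrier_vec n" using y(1) by simp
  qed
  show ?thesis
    unfolding is_extension_def using mod modB inc_hom prj_hom inj surj exact dim by simp
qed

text \<open>The data of the extension attached to \<open>B\<close>, for any choice of lifts \<open>h j\<close>: the relation
  \<open>\<pi>\<close> always contributes the generators themselves, because \<open>\<pi> h\<^sub>j\<close> is the image of the reduction of
  \<open>h\<^sub>j\<close> under the inclusion.\<close>

lemma has_lifts_lift_ext:
  assumes B: "B \<in> carrier_mat n n" and h: "\<And>j. j < r \<Longrightarrow> h j \<in> carrier_vec n"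
    and y: "\<And>j. j < r \<Longrightarrow> y j \<in> carrier_vec n"
    and \<alpha>: "\<And>j. j < r \<Longrightarrow> poly_mat (\<alpha> j) B *\<^sub>v h j = \<pi> \<cdot>\<^sub>v y j"
  shows "has_lifts (lift_ext \<pi> \<rho> B) r (\<lambda>j. map_vec \<rho> (h j)) \<alpha> [:\<pi>:]
    (\<lambda>j. map_vec \<rho> (y j)) (\<lambda>j. map_vec \<rho> (h j))"
  unfolding has_lifts_def
proof (intro exI[of _ h] allI impI conjI)
  fix j assume j: "j < r"
  show "h j \<in> carrier (middle (lift_ext \<pi> \<rho> B))" using h[OF j] B by simp
  show "\<alpha> j \<odot>\<^bsub>middle (lift_ext \<pi> \<rho> B)\<^esub> h j = inc (lift_ext \<pi> \<rho> B) (map_vec \<rho> (y j))"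
    using inc_lift_ext[OF B y[OF j]] \<alpha>[OF j] by simp
  have "poly_mat [:\<pi>:] B *\<^sub>v h j = \<pi> \<cdot>\<^sub>v h j" using B h[OF j] by (rule poly_mat_const_vec)
  then show "[:\<pi>:] \<odot>\<^bsub>middle (lift_ext \<pi> \<rho> B)\<^esub> h j = inc (lift_ext \<pi> \<rho> B) (map_vec \<rho> (h j))"
    using inc_lift_ext[OF B h[OF j]] by simp
qed simp

end

section \<open>Presentation of the residual module\<close>

context length_two_residue_map
begin

lemma degree_map_poly_monic:
  assumes "monic f" shows "degree (map_poly \<rho> f) = degree f" "monic (map_poly \<rho> f)"
proof -
  have "coeff (map_poly \<rho> f) (degree f) = 1" using assms by (simp add: coeff_map_poly)
  then show "degree (map_poly \<rho> f) = degree f"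
    by (intro antisym degree_map_poly_le le_degree) simp
  then show "monic (map_poly \<rho> f)" using assms by (simp add: coeff_map_poly)
qed

lemma map_mat_block_companion:
  assumes "\<And>f. f \<in> set fs \<Longrightarrow> monic f"
  shows "map_mat \<rho> (block_companion fs) = block_companion (map (map_poly \<rho>) fs)"
proof -
  have "map_mat \<rho> (companion_mat f) = companion_mat (map_poly \<rho> f)" if "f \<in> set fs" for f
    using degree_map_poly_monic[OF assms[OF that]]
    by (intro eq_matI) (auto simp: companion_mat_def coeff_map_poly hom_uminus)
  then show ?thesis by (simp add: map_mat_diag_block_mat cong: map_cong)
qed

lemma ex_map_poly: obtains f where "map_poly \<rho> f = g"
proof
  show "map_poly \<rho> (map_poly (\<lambda>x. if x = 0 then 0 else inv_into UNIV \<rho> x) g) = g"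
    by (rule poly_eqI) (simp add: coeff_map_poly surj_f_inv_f[OF surj])
qed

lemma map_poly_eq_0:
  assumes "map_poly \<rho> f = 0" obtains c where "f = c * [:\<pi>:]"
proof
  have "\<rho> (coeff f i) = 0" for i
    using arg_cong[OF assms, of "\<lambda>g. coeff g i"] by (simp add: coeff_map_poly)
  then have "\<exists>y. coeff f i = \<pi> * y" for i using ker by simp
  then have *: "coeff f i = \<pi> * (SOME y. coeff f i = \<pi> * y)" for i by (rule someI_ex)
  show "f = map_poly (\<lambda>x. if x = 0 then 0 else SOME y. x = \<pi> * y) f * [:\<pi>:]"
    by (rule poly_eqI) (use * in \<open>auto simp: coeff_map_poly\<close>)
qed

text \<open>Generators and relations over \<open>k[t]\<close> are those of the block companion matrix. Over
  \<open>R[t]\<close> the only new relation is \<open>\<pi>\<close>: a coefficient that is divisible by \<open>f\<^sub>j\<close> after reduction differs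
  from a multiple of \<open>f\<^sub>j\<close> by a multiple of \<open>\<pi>\<close>.\<close>

lemma residue_module_presentation:
  assumes A: "map_mat \<rho> A = block_companion (map (map_poly \<rho>) fs)"
    and fs: "\<And>f. f \<in> set fs \<Longrightarrow> monic f \<and> 0 < degree f"
  shows "generated_with_relations (residue_module A) (length fs)
    (block_generator (map (map_poly \<rho>) fs)) (\<lambda>j. fs ! j) [:\<pi>:]"
proof -
  let ?fs = "map (map_poly \<rho>) fs"
  let ?n = "sum_list (map degree ?fs)"
  let ?M = "mat_module (block_companion ?fs)"
  have carrier: "carrier ?M = carrier_vec ?n"
    by (simp only: mat_module_simps carrier_matD[OF block_companion_carrier])
  have fs': "monic (?fs ! j) \<and> 0 < degree (?fs ! j)" if "j < length ?fs" for j
    using fs[of "fs ! j"] that by (simp add: degree_map_poly_monic)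
  interpret M: cmodule ?M by (rule block_companion_module)
  interpret hp: comm_ring_hom "map_poly \<rho>"
    by (rule comm_ring_hom_map_poly) (rule comm_ring_hom_axioms)
  show ?thesis
    unfolding generated_with_relations_def A
  proof (intro conjI allI impI ballI)
    fix x assume "x \<in> carrier (restrict_scalars (map_poly \<rho>) ?M)"
    then have "x \<in> carrier_vec ?n" by (simp only: restrict_scalars_simps carrier)
    then obtain a where a: "x = lin_comb ?M (length ?fs) (block_generator ?fs) a"
      using block_generators_generate[of ?fs x] fs' by metis
    have "\<forall>i. \<exists>b. map_poly \<rho> b = a i" by (metis ex_map_poly)
    then obtain b where "\<And>i. map_poly \<rho> (b i) = a i" by metis
    then show "\<exists>b. x = lin_comb (restrict_scalars (map_poly \<rho>) ?M) (length fs) (block_generator ?fs) b"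
      using a by (intro exI[of _ b]) simp
  next
    fix b j assume b: "lin_comb (restrict_scalars (map_poly \<rho>) ?M) (length fs) (block_generator ?fs) b
      = \<zero>\<^bsub>restrict_scalars (map_poly \<rho>) ?M\<^esub>" and j: "j < length fs"
    have "lin_comb ?M (length ?fs) (block_generator ?fs) (\<lambda>i. map_poly \<rho> (b i)) = 0\<^sub>v ?n"
      using b by (simp only: lin_comb_restrict_scalars restrict_scalars_simps mat_module_simps
          carrier_matD[OF block_companion_carrier] length_map)
    then have "?fs ! j dvd map_poly \<rho> (b j)"
      using fs' j by (intro block_generators_relation[of ?fs "\<lambda>i. map_poly \<rho> (b i)"]) auto
    then obtain q where q: "map_poly \<rho> (b j) = map_poly \<rho> (fs ! j) * q" using j by (auto simp: dvd_def)
    obtain s where s: "map_poly \<rho> s = q" by (rule ex_map_poly)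
    have "map_poly \<rho> (b j - s * fs ! j) = 0"
      using q s by (simp add: hp.hom_minus hp.hom_mult mult.commute)
    then obtain t where "b j - s * fs ! j = t * [:\<pi>:]" by (rule map_poly_eq_0)
    then have "b j = s * fs ! j + t * [:\<pi>:]" by (simp add: algebra_simps)
    then show "\<exists>s t. b j = s * fs ! j + t * [:\<pi>:]" by blast
  qed (simp only: restrict_scalars_simps carrier, rule block_coeffs_carrier)
qed

end

section \<open>Lifts from the matrix of an extension\<close>

text \<open>\<open>E(\<xi>)\<close> is known only modulo \<open>p\<close> to the power \<open>min \<lambda>\<^sub>i \<lambda>\<^sub>j\<close>, but lifts can be chosen that
  realise a given representative \<open>\<epsilon>\<close> exactly. If the minimum is \<open>\<lambda>\<^sub>i\<close>, the discrepancy kills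
  \<open>e\<^sub>i\<close>. If it is \<open>\<lambda>\<^sub>j\<close>, the discrepancy is \<open>p\<close> to the power \<open>\<lambda>\<^sub>j\<close> times some \<open>c\<^sub>i\<^sub>j\<close>, and it is
  absorbed by adding \<open>\<Sum> c\<^sub>i\<^sub>j e\<^sub>i\<close> to the \<open>j\<close>-th lift.\<close>

lemma ext_matrix_imp_lifts:
  assumes E: "has_ext_matrix p lam e \<xi> \<epsilon>" and \<xi>: "\<And>X. X \<in> \<xi> \<Longrightarrow> is_extension N N X"
    and e: "\<And>i. i < length lam \<Longrightarrow> e i \<in> carrier N"
    and p: "\<And>i. i < length lam \<Longrightarrow> p ^ (lam ! i) \<odot>\<^bsub>N\<^esub> e i = \<zero>\<^bsub>N\<^esub>"
  shows "\<exists>X\<in>\<xi>. has_lifts X (length lam) e (\<lambda>j. p ^ (lam ! j)) 0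
    (\<lambda>j. lin_comb N (length lam) e (\<lambda>i. \<epsilon> i j)) (\<lambda>_. \<zero>\<^bsub>N\<^esub>)"
proof -
  let ?r = "length lam"
  obtain X f \<eta> where X: "X \<in> \<xi>"
    and f: "\<And>j. j < ?r \<Longrightarrow> f j \<in> carrier (middle X) \<and> prj X (f j) = e j \<and>
          p ^ (lam ! j) \<odot>\<^bsub>middle X\<^esub> f j = lin_comb (middle X) ?r (\<lambda>i. inc X (e i)) (\<lambda>i. \<eta> i j)"
    and \<eta>: "\<And>i j. i < ?r \<Longrightarrow> j < ?r \<Longrightarrow> p ^ min (lam ! i) (lam ! j) dvd \<epsilon> i j - \<eta> i j"
    using E unfolding has_ext_matrix_def lin_comb_def by blast
  interpret cext N N X by unfold_locales (rule \<xi>[OF X])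
  have "\<exists>c. \<epsilon> i j \<odot>\<^bsub>N\<^esub> e i = (\<eta> i j + p ^ (lam ! j) * c) \<odot>\<^bsub>N\<^esub> e i" if i: "i < ?r" and j: "j < ?r" for i j
  proof (cases "lam ! j \<le> lam ! i")
    case True
    then obtain c where "\<epsilon> i j - \<eta> i j = p ^ (lam ! j) * c"
      using \<eta>[OF i j] by (auto simp: min_absorb2 dvd_def)
    then have "\<epsilon> i j = \<eta> i j + p ^ (lam ! j) * c" by (simp add: algebra_simps)
    then show ?thesis by auto
  next
    case False
    then obtain c where "\<epsilon> i j - \<eta> i j = p ^ (lam ! i) * c"
      using \<eta>[OF i j] by (auto simp: min_absorb1 dvd_def)
    then have "\<epsilon> i j = \<eta> i j + c * p ^ (lam ! i)" by (simp add: algebra_simps)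
    then have "\<epsilon> i j \<odot>\<^bsub>N\<^esub> e i = \<eta> i j \<odot>\<^bsub>N\<^esub> e i"
      using e[OF i] p[OF i] by (simp add: N.smult_l_distr N.smult_assoc)
    then show ?thesis by (intro exI[of _ 0]) simp
  qed
  then obtain c where c: "\<And>i j. i < ?r \<Longrightarrow> j < ?r \<Longrightarrow>
      \<epsilon> i j \<odot>\<^bsub>N\<^esub> e i = (\<eta> i j + p ^ (lam ! j) * c i j) \<odot>\<^bsub>N\<^esub> e i"
    by metis
  define g where "g j = f j \<oplus>\<^bsub>middle X\<^esub> inc X (lin_comb N ?r e (\<lambda>i. c i j))" for j
  have closed: "lin_comb N ?r e a \<in> carrier N" for a using e by auto
  have "has_lifts X ?r e (\<lambda>j. p ^ (lam ! j)) 0 (\<lambda>j. lin_comb N ?r e (\<lambda>i. \<epsilon> i j)) (\<lambda>_. \<zero>\<^bsub>N\<^esub>)"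
    unfolding has_lifts_def
  proof (intro exI[of _ g] allI impI conjI)
    fix j assume j: "j < ?r"
    have fj: "f j \<in> carrier (middle X)" using f[OF j] by simp
    then show g: "g j \<in> carrier (middle X)" using closed by (simp add: g_def)
    show "prj X (g j) = e j" using f[OF j] closed e[OF j] by (simp add: g_def prj.add)
    show "0 \<odot>\<^bsub>middle X\<^esub> g j = inc X \<zero>\<^bsub>N\<^esub>" using g by simp
    have "p ^ (lam ! j) \<odot>\<^bsub>middle X\<^esub> g j
        = inc X (lin_comb N ?r e (\<lambda>i. \<eta> i j)) \<oplus>\<^bsub>middle X\<^esub> inc X (p ^ (lam ! j) \<odot>\<^bsub>N\<^esub> lin_comb N ?r e (\<lambda>i. c i j))"
      using f[OF j] fj closed e by (simp add: g_def M.smult_r_distr inc.lin_comb inc.smult)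
    also have "\<dots> = inc X (lin_comb N ?r e (\<lambda>i. \<eta> i j) \<oplus>\<^bsub>N\<^esub> p ^ (lam ! j) \<odot>\<^bsub>N\<^esub> lin_comb N ?r e (\<lambda>i. c i j))"
      using closed by (simp add: inc.add)
    also have "lin_comb N ?r e (\<lambda>i. \<eta> i j) \<oplus>\<^bsub>N\<^esub> p ^ (lam ! j) \<odot>\<^bsub>N\<^esub> lin_comb N ?r e (\<lambda>i. c i j)
        = lin_comb N ?r e (\<lambda>i. \<eta> i j + p ^ (lam ! j) * c i j)"
      using e by (simp add: N.lin_comb_add N.lin_comb_smult)
    also have "\<dots> = lin_comb N ?r e (\<lambda>i. \<epsilon> i j)"
      using e c j by (intro N.lin_comb_cong) auto
    finally show "p ^ (lam ! j) \<odot>\<^bsub>middle X\<^esub> g j = inc X (lin_comb N ?r e (\<lambda>i. \<epsilon> i j))" .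
  qed
  with X show ?thesis by blast
qed

lemma has_lifts_restrict:
  assumes "has_lifts X r e (\<lambda>j. \<phi> (\<alpha> j)) (\<phi> c) w u"
  shows "has_lifts (restrict_ext \<phi> X) r e \<alpha> c w u"
  using assms by (simp add: has_lifts_def)

section \<open>Bases and conjugation\<close>

text \<open>Restricted to constant polynomials, a linear combination of columns is the usual product
  of a matrix and a vector.\<close>

lemma lin_comb_const_polys:
  fixes A :: "'a::comm_ring_1 mat"
  assumes A: "A \<in> carrier_mat n n" and P: "P \<in> carrier_mat n m"
  shows "lin_comb (mat_module A) m (col P) (\<lambda>i. [:c $ i:]) = P *\<^sub>v vec m (($) c)"
proof (rule eq_vecI)
  have col: "col P i \<in> carrier_vec n" for i using P by (simp add: carrier_vecI)
  fix i assume "i < dim_vec (P *\<^sub>v vec m (($) c))"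
  then have i: "i < n" using P by simp
  have "lin_comb (mat_module A) m (col P) (\<lambda>i. [:c $ i:]) $ i = (\<Sum>j<m. (c $ j \<cdot>\<^sub>v col P j) $ i)"
    unfolding lin_comb_def finsum_mat_module[OF A]
    using i col by (subst index_finsum_vec) (auto simp: poly_mat_const_vec[OF A])
  also have "\<dots> = (P *\<^sub>v vec m (($) c)) $ i"
    using i P by (auto simp: scalar_prod_def atLeast0LessThan mult.commute intro!: sum.cong)
  finally show "lin_comb (mat_module A) m (col P) (\<lambda>i. [:c $ i:]) $ i = (P *\<^sub>v vec m (($) c)) $ i" .
next
  interpret cmodule "mat_module A" by (rule cmodule.intro) (rule mat_module_is_module[OF A])
  have "lin_comb (mat_module A) m (col P) (\<lambda>i. [:c $ i:]) \<in> carrier (mat_module A)"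
    using A P by (intro lin_comb_closed) (auto simp: carrier_vecI)
  then show "dim_vec (lin_comb (mat_module A) m (col P) (\<lambda>i. [:c $ i:])) = dim_vec (P *\<^sub>v vec m (($) c))"
    using A P by simp
qed

context length_two_residue_map
begin

text \<open>A matrix that reduces to the identity is \<open>1 + X\<close> with entries of \<open>X\<close> in \<open>(\<pi>)\<close>, so \<open>X\<^sup>2 = 0\<close> and \<open>1 - X\<close> is its
  inverse.\<close>

lemma inverse_of_lift_of_one:
  assumes P: "P \<in> carrier_mat n n" and one: "map_mat \<rho> P = 1\<^sub>m n"
  obtains P' where "P' \<in> carrier_mat n n" "P * P' = 1\<^sub>m n" "P' * P = 1\<^sub>m n" "map_mat \<rho> P' = 1\<^sub>m n"
proof
  define X where "X = P - 1\<^sub>m n"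
  have X: "X \<in> carrier_mat n n" unfolding X_def by (rule minus_carrier_mat) simp
  have "\<exists>y. X $$ (i, j) = \<pi> * y" if "i < n" "j < n" for i j
  proof -
    have "\<rho> (P $$ (i, j)) = 1\<^sub>m n $$ (i, j)"
      using arg_cong[OF one, of "\<lambda>M. M $$ (i, j)"] that P by simp
    then have "\<rho> (X $$ (i, j)) = 0" using that P by (simp add: X_def hom_minus)
    then show ?thesis using ker by simp
  qed
  then obtain y where y: "\<And>i j. i < n \<Longrightarrow> j < n \<Longrightarrow> X $$ (i, j) = \<pi> * y i j" by metis
  have "X $$ (i, k) * X $$ (k, j) = 0" if "i < n" "j < n" "k < n" for i j k
  proof -
    have "X $$ (i, k) * X $$ (k, j) = (\<pi> * \<pi>) * (y i k * y k j)" using that y by (simp add: mult_ac)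
    then show ?thesis by (simp add: pi_sq)
  qed
  then have sq: "X * X = 0\<^sub>m n n"
    using X by (intro eq_matI) (auto simp: scalar_prod_def)
  have P_X: "P = 1\<^sub>m n + X" using P by (auto simp: X_def)
  show "1\<^sub>m n - X \<in> carrier_mat n n" using X by (rule minus_carrier_mat)
  have "P * (1\<^sub>m n - X) = P * 1\<^sub>m n - P * X"
    using P X by (intro mult_minus_distrib_mat[of _ n n _ n]) auto
  also have "P * X = X"
    unfolding P_X using X sq add_mult_distrib_mat[of "1\<^sub>m n" n n X X n] by simp
  finally show "P * (1\<^sub>m n - X) = 1\<^sub>m n" using P by (auto simp: X_def)
  have "(1\<^sub>m n - X) * P = 1\<^sub>m n * P - X * P"
    using P X by (intro minus_mult_distrib_mat[of _ n n _ _ n]) auto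
  also have "X * P = X"
    unfolding P_X using X sq mult_add_distrib_mat[of X n n "1\<^sub>m n" n X] by simp
  finally show "(1\<^sub>m n - X) * P = 1\<^sub>m n" using P by (auto simp: X_def)
  show "map_mat \<rho> (1\<^sub>m n - X) = 1\<^sub>m n"
  proof (rule eq_matI)
    fix i j assume "i < dim_row (1\<^sub>m n :: 'k mat)" "j < dim_col (1\<^sub>m n :: 'k mat)"
    then have ij: "i < n" "j < n" by auto
    have "\<rho> (X $$ (i, j)) = 0" using y[OF ij] by (simp add: hom_mult)
    then show "map_mat \<rho> (1\<^sub>m n - X) $$ (i, j) = 1\<^sub>m n $$ (i, j)"
      using ij X by (simp add: hom_minus)
  qed (use X in simp_all)
qed

text \<open>An equivalence from \<open>E\<close> to the extension of \<open>A\<close> turns a basis of \<open>E\<close> lifting the standard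
  basis into the columns of a matrix \<open>P\<close> that reduces to the identity. If \<open>t\<close> has the matrix \<open>B\<close> in
  the basis of \<open>E\<close>, then \<open>A P = P B\<close>. Conversely, the columns of any such \<open>P\<close> pull back to a basis
  of \<open>E\<close> that lifts the standard one.\<close>

lemma matrices_in_lifted_bases:
  assumes A: "A \<in> carrier_mat n n"
  shows "{B \<in> carrier_mat n n.
      \<exists>E \<in> ext_class (residue_module A) (residue_module A) (lift_ext \<pi> \<rho> A).
      \<exists>b. module_basis n (restrict_scalars (\<lambda>c. [:c:]) (middle E)) b \<and>
          (\<forall>j<n. prj E (b j) = unit_vec n j) \<and>
          (\<forall>j<n. [:0, 1:] \<odot>\<^bsub>middle E\<^esub> b j
             = (\<Oplus>\<^bsub>middle E\<^esub>i\<in>{..<n}. [:B $$ (i, j):] \<odot>\<^bsub>middle E\<^esub> b i))}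
    = kernel_conj_class \<rho> A" (is "?L = _")
proof (rule Set.set_eqI, rule iffI)
  let ?N = "residue_module A" and ?Y = "lift_ext \<pi> \<rho> A"
  have carrier: "carrier (mat_module A) = carrier_vec n" using A by simp
  have X_act: "[:0, 1:] \<odot>\<^bsub>mat_module A\<^esub> v = A *\<^sub>v v" for v
    using poly_mat_X[OF A] by simp
  have Y_ext: "is_extension ?N ?N ?Y" by (rule is_extension_lift_ext[OF A])
  fix B
  {
    assume "B \<in> ?L"
    then obtain b and E :: "('r poly, 'k vec, 'k vec \<times> 'k vec, 'k vec) extension"
      where B: "B \<in> carrier_mat n n"
      and E: "is_extension ?N ?N E" "ext_equiv ?N E ?Y"
      and b: "module_basis n (restrict_scalars (\<lambda>c. [:c:]) (middle E)) b"
        "\<And>j. j < n \<Longrightarrow> prj E (b j) = unit_vec n j"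
        "\<And>j. j < n \<Longrightarrow> [:0, 1:] \<odot>\<^bsub>middle E\<^esub> b j = lin_comb (middle E) n b (\<lambda>i. [:B $$ (i, j):])"
      by (auto simp: ext_class_def lin_comb_def)
    interpret E: cext ?N ?N E by unfold_locales (rule E(1))
    obtain f where f: "f \<in> module_hom class_ring (middle E) (mat_module A)"
      "\<And>x. x \<in> carrier (middle E) \<Longrightarrow> map_vec \<rho> (f x) = prj E x"
      using E(2) unfolding ext_equiv_def by auto
    interpret f: cmodule_hom "middle E" "mat_module A" f
      by (intro cmodule_hom.intro cmodule_hom_axioms.intro cmodule.intro E.M.is_module
          mat_module_is_module[OF A] f(1))
    have bc: "b j \<in> carrier (middle E)" if "j < n" for j
      using b(1) that by (simp add: module_basis_def)
    have fb: "f (b j) \<in> carrier_vec n" if "j < n" for j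
      using f.closed[OF bc[OF that]] carrier by simp
    define P where "P = mat n n (\<lambda>(i, j). f (b j) $ i)"
    have P: "P \<in> carrier_mat n n" by (simp add: P_def)
    have colP: "col P j = f (b j)" if "j < n" for j
      using fb[OF that] that by (auto simp: P_def)
    have one: "map_mat \<rho> P = 1\<^sub>m n"
    proof (rule eq_matI)
      fix i j assume "i < dim_row (1\<^sub>m n :: 'k mat)" "j < dim_col (1\<^sub>m n :: 'k mat)"
      then have ij: "i < n" "j < n" by auto
      have "map_vec \<rho> (f (b j)) $ i = unit_vec n j $ i"
        using f(2)[OF bc[OF ij(2)]] b(2)[OF ij(2)] by simp
      then show "map_mat \<rho> P $$ (i, j) = 1\<^sub>m n $$ (i, j)"
        using ij fb[OF ij(2)] by (auto simp: P_def)
    qed (use P in simp_all)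
    obtain P' where P': "P' \<in> carrier_mat n n" "P * P' = 1\<^sub>m n" "P' * P = 1\<^sub>m n" "map_mat \<rho> P' = 1\<^sub>m n"
      using P one by (rule inverse_of_lift_of_one)
    have "A * P = P * B"
    proof (rule mat_col_eqI)
      fix j assume "j < dim_col (P * B)"
      then have j: "j < n" using B by simp
      have X_b: "[:0, 1:] \<odot>\<^bsub>middle E\<^esub> b j = lin_comb (middle E) n b (\<lambda>i. [:col B j $ i:])"
        unfolding b(3)[OF j] using bc B j by (intro E.M.lin_comb_cong) auto
      have "A *\<^sub>v f (b j) = f ([:0, 1:] \<odot>\<^bsub>middle E\<^esub> b j)"
        using f.smult[OF bc[OF j]] X_act by simp
      also have "\<dots> = lin_comb (mat_module A) n (\<lambda>i. f (b i)) (\<lambda>i. [:col B j $ i:])"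
        unfolding X_b using bc by (rule f.lin_comb)
      also have "\<dots> = lin_comb (mat_module A) n (col P) (\<lambda>i. [:col B j $ i:])"
        using fb colP carrier by (intro f.N.lin_comb_cong) auto
      also have "\<dots> = P *\<^sub>v col B j"
        using lin_comb_const_polys[OF A P, of "col B j"] B by (auto intro!: arg_cong[of _ _ "(*\<^sub>v) P"])
      finally show "col (A * P) j = col (P * B) j"
        unfolding col_mult2[OF A P j] col_mult2[OF P B j] colP[OF j] .
    qed (use A P B in simp_all)
    then have "(P' * P) * B = P' * A * P"
      unfolding assoc_mult_mat[OF P'(1) P B] assoc_mult_mat[OF P'(1) A P] by simp
    then have "B = P' * A * P" using P'(3) B by simp
    then have "similar_mat_wit B A P' P"
      using P P' A B by (simp add: similar_mat_wit_def Let_def)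
    then show "B \<in> kernel_conj_class \<rho> A"
      using P'(4) A unfolding kernel_conj_class_def by auto
  next
    assume "B \<in> kernel_conj_class \<rho> A"
    then obtain P P' where wit: "similar_mat_wit B A P P'" and one: "map_mat \<rho> P = 1\<^sub>m n"
      using A by (auto simp: kernel_conj_class_def)
    note wit' = similar_mat_witD[OF refl wit]
    have dimB: "dim_row B = n" using wit'(5) A by (metis carrier_matD(1))
    note B = wit'(4)[unfolded dimB] and P = wit'(6)[unfolded dimB] and P' = wit'(7)[unfolded dimB]
      and inv = wit'(1,2)[unfolded dimB] and BA = wit'(3)
    have one': "map_mat \<rho> P' = 1\<^sub>m n"
    proof -
      have "map_mat \<rho> (P * P') = map_mat \<rho> P * map_mat \<rho> P'" using P P' by (rule mat_hom_mult)
      then show ?thesis using inv one P' by (simp add: mat_hom_one)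
    qed
    have comm: "A * P' = P' * B"
    proof -
      have "P' * B = (P' * P) * (A * P')"
        unfolding BA assoc_mult_mat[OF P A P'] assoc_mult_mat[OF P' P mult_carrier_mat[OF A P']] ..
      then show ?thesis using inv A P' by simp
    qed
    obtain E :: "('r poly, 'k vec, 'k vec \<times> 'k vec, 'k vec) extension"
      where E: "is_extension ?N ?N E" "ext_equiv ?N E ?Y"
      using ex_ext_equiv_on_product[OF Y_ext] by blast
    interpret E: cext ?N ?N E by unfold_locales (rule E(1))
    obtain f where f: "f \<in> module_hom class_ring (middle E) (mat_module A)"
      "bij_betw f (carrier (middle E)) (carrier_vec n)"
      "\<And>x. x \<in> carrier (middle E) \<Longrightarrow> map_vec \<rho> (f x) = prj E x"
      using E(2) carrier unfolding ext_equiv_def by auto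
    interpret f: cmodule_hom "middle E" "mat_module A" f
      by (intro cmodule_hom.intro cmodule_hom_axioms.intro cmodule.intro E.M.is_module
          mat_module_is_module[OF A] f(1))
    have colc: "col P' j \<in> carrier_vec n" for j using P' by (simp add: carrier_vecI)
    have "\<exists>x\<in>carrier (middle E). f x = col P' j" for j
      using f(2) colc[of j] by (metis bij_betw_imp_surj_on imageE)
    then obtain b where b: "\<And>j. b j \<in> carrier (middle E)" "\<And>j. f (b j) = col P' j" by metis
    have inj: "x = y" if "x \<in> carrier (middle E)" "y \<in> carrier (middle E)" "f x = f y" for x y
      using f(2) that by (auto simp: bij_betw_def inj_on_def)
    have lc_closed: "lin_comb (middle E) n b a \<in> carrier (middle E)" for a using b by auto
    have f_lc: "f (lin_comb (middle E) n b (\<lambda>i. [:c $ i:])) = P' *\<^sub>v c" if "c \<in> carrier_vec n" for c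
    proof -
      have "f (lin_comb (middle E) n b (\<lambda>i. [:c $ i:])) = lin_comb (mat_module A) n (col P') (\<lambda>i. [:c $ i:])"
        using f.lin_comb[of n b "\<lambda>i. [:c $ i:]"] b by simp
      also have "\<dots> = P' *\<^sub>v c"
        using lin_comb_const_polys[OF A P', of c] that by (auto intro!: arg_cong[of _ _ "(*\<^sub>v) P'"])
      finally show ?thesis .
    qed
    have basis: "module_basis n (restrict_scalars (\<lambda>c. [:c:]) (middle E)) b"
      unfolding module_basis_def
    proof (intro conjI allI impI ballI)
      fix x assume "x \<in> carrier (restrict_scalars (\<lambda>c. [:c:]) (middle E))"
      then have x: "x \<in> carrier (middle E)" by simp
      have fx: "f x \<in> carrier_vec n" using f.closed[OF x] carrier by simp
      have iff: "x = lin_comb (middle E) n b (\<lambda>i. [:c $ i:]) \<longleftrightarrow> c = P *\<^sub>v f x" if c: "c \<in> carrier_vec n" for c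
      proof -
        have "x = lin_comb (middle E) n b (\<lambda>i. [:c $ i:]) \<longleftrightarrow> f x = P' *\<^sub>v c"
          using inj[OF x lc_closed] f_lc[OF c] by metis
        also have "\<dots> \<longleftrightarrow> c = P *\<^sub>v f x"
        proof
          assume "f x = P' *\<^sub>v c"
          then have "P *\<^sub>v f x = (P * P') *\<^sub>v c" unfolding assoc_mult_mat_vec[OF P P' c] by simp
          then show "c = P *\<^sub>v f x" using inv c by simp
        next
          assume "c = P *\<^sub>v f x"
          then have "P' *\<^sub>v c = (P' * P) *\<^sub>v f x" unfolding assoc_mult_mat_vec[OF P' P fx] by simp
          then show "f x = P' *\<^sub>v c" using inv fx by simp
        qed
        finally show ?thesis .
      qed
      have "P *\<^sub>v f x \<in> carrier_vec n" using P fx by (rule mult_mat_vec_carrier)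
      then have "\<exists>!c. c \<in> carrier_vec n \<and> x = lin_comb (middle E) n b (\<lambda>i. [:c $ i:])"
        using iff by (intro ex1I[of _ "P *\<^sub>v f x"]) auto
      then show "\<exists>!c. c \<in> carrier_vec n \<and>
          x = (\<Oplus>\<^bsub>restrict_scalars (\<lambda>c. [:c:]) (middle E)\<^esub>i\<in>{..<n}.
            c $ i \<odot>\<^bsub>restrict_scalars (\<lambda>c. [:c:]) (middle E)\<^esub> b i)"
        by (simp add: lin_comb_def)
    qed (simp add: b)
    have prj: "prj E (b j) = unit_vec n j" if j: "j < n" for j
    proof -
      have "prj E (b j) = map_vec \<rho> (col P' j)" using f(3)[OF b(1)[of j]] b(2) by simp
      also have "\<dots> = col (map_mat \<rho> P') j" using P' j by (auto intro!: eq_vecI)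
      finally show ?thesis using j by (simp add: one')
    qed
    have X_b: "[:0, 1:] \<odot>\<^bsub>middle E\<^esub> b j = lin_comb (middle E) n b (\<lambda>i. [:col B j $ i:])" if j: "j < n" for j
    proof (rule inj)
      have cB: "col B j \<in> carrier_vec n" using B by (simp add: carrier_vecI)
      have "f ([:0, 1:] \<odot>\<^bsub>middle E\<^esub> b j) = A *\<^sub>v col P' j"
        using f.smult[OF b(1)] X_act b(2) by simp
      also have "\<dots> = col (A * P') j" by (rule col_mult2[OF A P' j, symmetric])
      also have "\<dots> = P' *\<^sub>v col B j" unfolding comm by (rule col_mult2[OF P' B j])
      finally show "f ([:0, 1:] \<odot>\<^bsub>middle E\<^esub> b j) = f (lin_comb (middle E) n b (\<lambda>i. [:col B j $ i:]))"
        using f_lc[OF cB] by simp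
    qed (use b lc_closed in auto)
    have X_b': "[:0, 1:] \<odot>\<^bsub>middle E\<^esub> b j
        = (\<Oplus>\<^bsub>middle E\<^esub>i\<in>{..<n}. [:B $$ (i, j):] \<odot>\<^bsub>middle E\<^esub> b i)" if j: "j < n" for j
    proof -
      have "lin_comb (middle E) n b (\<lambda>i. [:col B j $ i:]) = lin_comb (middle E) n b (\<lambda>i. [:B $$ (i, j):])"
        using b B j by (intro E.M.lin_comb_cong) auto
      then show ?thesis using X_b[OF j] by (simp add: lin_comb_def)
    qed
    have "E \<in> ext_class ?N ?N ?Y" using E by (simp add: ext_class_def)
    then show "B \<in> ?L" using B basis prj X_b' by blast
  }
qed

end

section \<open>The matrix attached to a class\<close>

theorem theorem6p4:
  fixes \<pi> :: "'r::comm_ring_1"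
    and \<rho> :: "'r \<Rightarrow> 'k::field"
    and p :: "'k poly"
    and pp :: "'r poly"
    and lam :: "nat list"
    and d n :: nat
    and A :: "'r mat"
    and \<epsilon> :: "nat \<Rightarrow> nat \<Rightarrow> 'r poly"
    and \<xi> :: "('k poly, 'k vec, 'k vec \<times> 'k vec, 'k vec) extension set"
  assumes R: "local_pir_length_two \<pi>"
    and residue: "comm_ring_hom \<rho>" "surj \<rho>" "{x. \<rho> x = 0} = PIdl\<^bsub>class_ring\<^esub> \<pi>"
    and p: "monic p" "irreducible p" "degree p = d"
    and lam: "sorted_wrt (\<ge>) lam" "\<forall>l\<in>set lam. 1 \<le> l"
    and n: "n = d * sum_list lam"
    and A: "A \<in> carrier_mat n n"
      "map_mat \<rho> A = diag_block_mat (map (\<lambda>l. companion_mat (p ^ l)) lam)"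
    and pp: "monic pp" "map_poly \<rho> pp = p"
    and \<epsilon>: "\<forall>j<length lam.
        (poly_mat pp A ^\<^sub>m (lam ! j)) *\<^sub>v block_vec n d lam j
          = finsum_vec TYPE('r) n (\<lambda>i. poly_mat (\<epsilon> i j) A *\<^sub>v (\<pi> \<cdot>\<^sub>v block_vec n d lam i)) {..<length lam}"
    and \<xi>: "\<xi> \<in> Ext1 (mat_module (map_mat \<rho> A)) (mat_module (map_mat \<rho> A))"
    and E: "has_ext_matrix p lam (block_vec n d lam) \<xi> (\<lambda>i j. map_poly \<rho> (\<epsilon> i j))"
  shows "A_xi \<pi> \<rho> (diag_block_mat (map (\<lambda>l. companion_mat (pp ^ l)) lam)) \<xi> = kernel_conj_class \<rho> A"
proof -
  interpret length_two_residue_map \<rho> \<pi> using R residue by (rule length_two_residue_mapI)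
  have hp: "comm_ring_hom (map_poly \<rho>)" by (rule comm_ring_hom_map_poly[OF residue(1)])
  then interpret hp: comm_ring_hom "map_poly \<rho>" .
  define r where "r = length lam"
  define pps where "pps = map (\<lambda>l. pp ^ l) lam"
  define ps where "ps = map (\<lambda>l. p ^ l) lam"
  have ps: "ps = map (map_poly \<rho>) pps" by (simp add: ps_def pps_def hp.hom_power pp)
  have "degree p \<noteq> 0"
  proof
    assume "degree p = 0"
    then have "p = 1" using p(1) by (metis coeff_pCons_0 degree_0_id of_nat_1 one_pCons)
    then show False using p(2) by simp
  qed
  then have d: "0 < degree p" by simp
  have deg_pp: "degree pp = d" using degree_map_poly_monic[OF pp(1)] pp(2) p(3) by simp
  have pps: "monic f \<and> 0 < degree f" if f: "f \<in> set pps" for f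
  proof -
    obtain l where "l \<in> set lam" "f = pp ^ l" using f by (auto simp: pps_def)
    moreover from this have "0 < l" using lam(2) by auto
    ultimately show ?thesis using d p(3) deg_pp monic_power_degree[OF pp(1), of l] by simp
  qed
  define A0 where "A0 = block_companion pps"
  have A0_eq: "diag_block_mat (map (\<lambda>l. companion_mat (pp ^ l)) lam) = A0"
    by (simp add: A0_def pps_def o_def)
  have "map degree pps = map ((*) d) lam"
    by (simp add: pps_def monic_power_degree[OF pp(1)] deg_pp)
  then have n_pps: "sum_list (map degree pps) = n" by (simp add: n sum_list_const_mult)
  have A0: "A0 \<in> carrier_mat n n"
    unfolding A0_def n_pps[symmetric] by (rule block_companion_carrier)
  have res_A: "map_mat \<rho> A = block_companion ps" using A(2) by (simp add: ps_def o_def)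
  have res_A0: "map_mat \<rho> A0 = map_mat \<rho> A"
    unfolding res_A ps A0_def by (rule map_mat_block_companion) (use pps in blast)
  have h: "block_vec n d lam j = block_generator pps j" if "j < r" for j
    using block_vec_eq_block_generator[of pp lam j] that lam(2) pp(1) deg_pp d p(3)
    by (simp add: n r_def pps_def)
  have e: "block_vec n d lam j = block_generator ps j" if "j < r" for j
    using block_vec_eq_block_generator[of p lam j] that lam(2) p(1,3) d by (simp add: n r_def ps_def)
  let ?h = "block_vec n d lam :: nat \<Rightarrow> 'r vec" and ?e = "block_vec n d lam :: nat \<Rightarrow> 'k vec"
  have hc: "?h j \<in> carrier_vec n" and ec: "?e j \<in> carrier_vec n" for j by (simp_all add: block_vec_def)
  have he: "(\<lambda>j. map_vec \<rho> (?h j)) = ?e"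
    by (intro ext eq_vecI) (auto simp: block_vec_def unit_vec_def)
  let ?N = "mat_module (map_mat \<rho> A)"
  let ?N' = "residue_module A"
  let ?\<alpha> = "\<lambda>j. pp ^ (lam ! j)"
  let ?w = "\<lambda>j. lin_comb ?N' r ?e (\<lambda>i. \<epsilon> i j)"
  have carrier: "carrier ?N = carrier_vec n" "carrier ?N' = carrier_vec n" "\<zero>\<^bsub>?N'\<^esub> = 0\<^sub>v n"
    using A(1) by simp_all
  interpret Z: cext ?N' ?N' "lift_ext \<pi> \<rho> A"
    by unfold_locales (rule is_extension_lift_ext[OF A(1)])
  interpret MA: cmodule "mat_module A" by (rule cmodule.intro) (rule mat_module_is_module[OF A(1)])
  have wc: "?w j \<in> carrier_vec n" for j
    using Z.N.lin_comb_closed[of r ?e "\<lambda>i. \<epsilon> i j"] ec carrier by blast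

  have pres: "generated_with_relations ?N' r ?e ?\<alpha> [:\<pi>:]"
  proof -
    have "generated_with_relations ?N' (length pps) (block_generator ps) (\<lambda>j. pps ! j) [:\<pi>:]"
      unfolding ps by (rule residue_module_presentation) (use res_A ps pps in auto)
    moreover have "length pps = r" by (simp add: pps_def r_def)
    moreover have "lin_comb ?N' r (block_generator ps) a = lin_comb ?N' r ?e a" for a
      by (rule Z.N.lin_comb_cong[symmetric]) (use ec carrier in auto, simp add: e)
    moreover have "pps ! j = ?\<alpha> j" if "j < r" for j using that by (simp add: pps_def r_def)
    ultimately show ?thesis using e by (simp add: generated_with_relations_def)
  qed

  have liftsZ: "has_lifts (lift_ext \<pi> \<rho> A) r ?e ?\<alpha> [:\<pi>:] ?w ?e"
  proof -
    let ?y = "\<lambda>j. lin_comb (mat_module A) r ?h (\<lambda>i. \<epsilon> i j)"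
    have yc: "?y j \<in> carrier_vec n" for j
      using MA.lin_comb_closed[of r ?h "\<lambda>i. \<epsilon> i j"] hc A(1) by auto
    have y: "poly_mat (?\<alpha> j) A *\<^sub>v ?h j = \<pi> \<cdot>\<^sub>v ?y j" if "j < r" for j
    proof (rule eq_vecI)
      fix i assume "i < dim_vec (\<pi> \<cdot>\<^sub>v ?y j)"
      then have i: "i < n" using yc[of j] by simp
      have c: "poly_mat f A *\<^sub>v v \<in> carrier_vec n" if "v \<in> carrier_vec n" for f v
        using poly_mat_carrier[OF A(1)] that by (rule mult_mat_vec_carrier)
      have "(poly_mat (?\<alpha> j) A *\<^sub>v ?h j) $ i
          = finsum_vec TYPE('r) n (\<lambda>k. poly_mat (\<epsilon> k j) A *\<^sub>v (\<pi> \<cdot>\<^sub>v ?h k)) {..<r} $ i"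
        using \<epsilon> that by (simp add: poly_mat_power[OF A(1)] r_def)
      also have "\<dots> = (\<Sum>k<r. (poly_mat (\<epsilon> k j) A *\<^sub>v (\<pi> \<cdot>\<^sub>v ?h k)) $ i)"
        by (rule index_finsum_vec) (use i c hc in auto)
      also have "\<dots> = (\<Sum>k<r. \<pi> * (poly_mat (\<epsilon> k j) A *\<^sub>v ?h k) $ i)"
        using mult_mat_smult_vec[OF poly_mat_carrier[OF A(1)] hc] i c[OF hc] by (intro sum.cong refl) (simp add: carrier_matD[OF poly_mat_carrier[OF A(1)]])
      also have "\<dots> = \<pi> * ?y j $ i"
        unfolding lin_comb_def finsum_mat_module[OF A(1)]
        by (subst index_finsum_vec) (use i c hc in \<open>auto simp: sum_distrib_left\<close>)
      finally show "(poly_mat (?\<alpha> j) A *\<^sub>v ?h j) $ i = (\<pi> \<cdot>\<^sub>v ?y j) $ i"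
        using i yc[of j] by simp
    qed (use yc[of j] A(1) in \<open>simp add: carrier_matD[OF poly_mat_carrier[OF A(1)]]\<close>)
    have "map_vec \<rho> (?y j) = ?w j" for j
      using Z.prj.lin_comb[of r ?h "\<lambda>i. \<epsilon> i j"] hc A(1) he by (simp add: fun_cong[OF he])
    then show ?thesis
      using has_lifts_lift_ext[OF A(1), of r ?h ?y ?\<alpha>] hc yc y he by simp
  qed

  have liftsY: "has_lifts (lift_ext \<pi> \<rho> A0) r ?e ?\<alpha> [:\<pi>:] (\<lambda>_. 0\<^sub>v n) ?e"
  proof -
    have "poly_mat (?\<alpha> j) A0 *\<^sub>v ?h j = \<pi> \<cdot>\<^sub>v 0\<^sub>v n" if j: "j < r" for j
    proof -
      have j': "j < length pps" "pps ! j = ?\<alpha> j" using j by (simp_all add: pps_def r_def)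
      have "poly_mat (pps ! j) A0 *\<^sub>v block_generator pps j = 0\<^sub>v n"
        unfolding A0_def n_pps[symmetric]
        by (rule block_companion_annihilated[OF j'(1)]) (use pps nth_mem[OF j'(1)] in blast)+
      moreover have "\<pi> \<cdot>\<^sub>v 0\<^sub>v n = 0\<^sub>v n" by (rule eq_vecI) auto
      ultimately show ?thesis using h[OF j] j'(2) by simp
    qed
    then show ?thesis
      using has_lifts_lift_ext[OF A0, of r ?h "\<lambda>_. 0\<^sub>v n" ?\<alpha>] hc he by (simp add: vec_hom_zero)
  qed

  (* The data obtained from one representative of the class pass to all others by equivalence. *)
  obtain X0 :: "('k poly, 'k vec, 'k vec \<times> 'k vec, 'k vec) extension" where X0: "is_extension ?N ?N X0" "\<xi> = ext_class ?N ?N X0"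
    using \<xi> by (auto simp: Ext1_def)
  have \<xi>_ext: "is_extension ?N ?N X" if "X \<in> \<xi>" for X using that X0 by (simp add: ext_class_def)
  obtain X where X: "X \<in> \<xi>" and liftsX: "has_lifts (restrict_ext (map_poly \<rho>) X) r ?e ?\<alpha> [:\<pi>:] ?w (\<lambda>_. 0\<^sub>v n)"
  proof -
    have "p ^ (lam ! i) \<odot>\<^bsub>?N\<^esub> ?e i = \<zero>\<^bsub>?N\<^esub>" if i: "i < length lam" for i
    proof -
      have i': "i < length ps" "ps ! i = p ^ (lam ! i)" using i by (simp_all add: ps_def)
      have "monic (ps ! i) \<and> 0 < degree (ps ! i)"
      proof -
        have "0 < lam ! i" using i lam(2) nth_mem[OF i] by fastforce
        then show ?thesis unfolding i'(2) using d monic_power_degree[OF p(1), of "lam ! i"] by simp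
      qed
      then have "poly_mat (ps ! i) (block_companion ps) *\<^sub>v block_generator ps i = 0\<^sub>v (sum_list (map degree ps))"
        by (intro block_companion_annihilated[OF i'(1)]) auto
      moreover have "sum_list (map degree ps) = dim_row A"
        using carrier_matD(1)[OF block_companion_carrier[of ps]] by (simp flip: res_A)
      ultimately show ?thesis using e[of i] i i'(2) by (simp add: r_def flip: res_A)
    qed
    then obtain X where X: "X \<in> \<xi>" "has_lifts X r ?e (\<lambda>j. p ^ (lam ! j)) 0
        (\<lambda>j. lin_comb ?N r ?e (\<lambda>i. map_poly \<rho> (\<epsilon> i j))) (\<lambda>_. \<zero>\<^bsub>?N\<^esub>)"
      using ext_matrix_imp_lifts[OF E \<xi>_ext] ec carrier(1) unfolding r_def by blast
    (* Over k[t] the uniformizer acts as zero, so the relation c becomes 0 with data 0. *)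
    have "map_poly \<rho> [:\<pi>:] = 0" by (rule poly_eqI) (simp add: coeff_map_poly coeff_pCons split: nat.split)
    then have "has_lifts (restrict_ext (map_poly \<rho>) X) r ?e ?\<alpha> [:\<pi>:] ?w (\<lambda>_. 0\<^sub>v n)"
      using X(2) A(1) by (intro has_lifts_restrict) (simp add: hp.hom_power pp(2))
    with X(1) show thesis by (rule that)
  qed

  have Ext_add: "Ext_add ?N' ?N' (Ext_restrict (map_poly \<rho>) ?N ?N \<xi>)
      (ext_class ?N' ?N' (lift_ext \<pi> \<rho> A0)) = ext_class ?N' ?N' (lift_ext \<pi> \<rho> A)"
  proof (rule Ext_add_eqI[OF Z.is_ext])
    have Y0: "is_extension ?N' ?N' (lift_ext \<pi> \<rho> A0)"
      using is_extension_lift_ext[OF A0] by (simp add: res_A0)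
    have X': "is_extension ?N' ?N' (restrict_ext (map_poly \<rho>) X)"
      by (rule is_extension_restrict[OF hp \<xi>_ext[OF X]])
    show "Ext_restrict (map_poly \<rho>) ?N ?N \<xi> \<noteq> {}"
      using X X' ext_equiv_refl[OF X'] by (auto simp: Ext_restrict_def ext_class_def)
    show "ext_class ?N' ?N' (lift_ext \<pi> \<rho> A0) \<noteq> {}"
      using ex_ext_equiv_on_product[OF Y0] by (auto simp: ext_class_def)
    fix X1 Y1
    assume "X1 \<in> Ext_restrict (map_poly \<rho>) ?N ?N \<xi>"
    then obtain X2 where X2: "X2 \<in> \<xi>" and X1: "is_extension ?N' ?N' X1"
      "ext_equiv ?N' X1 (restrict_ext (map_poly \<rho>) X2)"
      by (auto simp: Ext_restrict_def ext_class_def)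
    have "ext_equiv ?N X X0" "ext_equiv ?N X2 X0"
      using X X2 X0(2) by (simp_all add: ext_class_def)
    moreover from this(2) have "ext_equiv ?N X0 X2" by (rule ext_equiv_sym[OF \<xi>_ext[OF X2]])
    ultimately have "ext_equiv ?N' (restrict_ext (map_poly \<rho>) X) (restrict_ext (map_poly \<rho>) X2)"
      by (blast intro: ext_equiv_restrict ext_equiv_trans)
    then have "ext_equiv ?N' (restrict_ext (map_poly \<rho>) X) X1"
      using ext_equiv_sym[OF X1] by (rule ext_equiv_trans)
    then have liftsX1: "has_lifts X1 r ?e ?\<alpha> [:\<pi>:] ?w (\<lambda>_. 0\<^sub>v n)"
      by (rule has_lifts_ext_equiv[OF liftsX]) (use wc carrier in auto)
    assume "Y1 \<in> ext_class ?N' ?N' (lift_ext \<pi> \<rho> A0)"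
    then have Y1: "is_extension ?N' ?N' Y1" "ext_equiv ?N' Y1 (lift_ext \<pi> \<rho> A0)"
      by (simp_all add: ext_class_def)
    have liftsY1: "has_lifts Y1 r ?e ?\<alpha> [:\<pi>:] (\<lambda>_. 0\<^sub>v n) ?e"
      by (rule has_lifts_ext_equiv[OF liftsY ext_equiv_sym[OF Y1]]) (use ec carrier in auto)
    have "(\<lambda>j. ?w j \<oplus>\<^bsub>?N'\<^esub> 0\<^sub>v n) = ?w" "(\<lambda>j. 0\<^sub>v n \<oplus>\<^bsub>?N'\<^esub> ?e j) = ?e"
      using wc ec by simp_all
    then have "has_lifts (lift_ext \<pi> \<rho> A) r ?e ?\<alpha> [:\<pi>:] (\<lambda>j. ?w j \<oplus>\<^bsub>?N'\<^esub> 0\<^sub>v n) (\<lambda>j. 0\<^sub>v n \<oplus>\<^bsub>?N'\<^esub> ?e j)"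
      using liftsZ by (simp only:)
    then show "ext_equiv ?N' (lift_ext \<pi> \<rho> A) (baer_sum ?N' X1 Y1)"
      by (rule ext_equiv_baer_sum[OF X1(1) Y1(1) Z.is_ext pres liftsX1 liftsY1])
        (use wc ec carrier in auto)
  qed
  have "dim_row A0 = n" using A0 by simp
  then show ?thesis
    unfolding A0_eq A_xi_def Let_def res_A0 Ext_add
    using matrices_in_lifted_bases[OF A(1)] by (simp only:)
qed

end
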